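(* Let $n\geq 2$ be an integer, let $\chi\in C_c^\infty(\{u\in\mathbb{R}^n:1/2<|u|<2\})$ and $\beta\in C_c^\infty(\{\tau\in\mathbb{R}:1/2\leq|\tau|\leq 2\})$. For $\lambda\geq 1$ and $r\in(0,\infty)^n$ define $$K_\lambda(u)=\chi(u)\,\lambda\,\check\beta\bigl(\lambda(|u|^2-1)\bigr),\qquad K_{\lambda,r}(y)=\frac{1}{r_1\cdots r_n}K_\lambda\left(\frac{y_1}{r_1},\ldots,\frac{y_n}{r_n}\right).$$ Then there is a constant $C$, depending only on $n$, $\chi$ and $\beta$, such that for every $\lambda\geq 1$ and every $f\in L^2(\mathbb{R}^n)$, $$\left\|\sup_{r\in[1,2]^n}|K_{\lambda,r}*f|\right\|_{L^2(\mathbb{R}^n)}\leq C\,\lambda^{-(n-3)/4}\,\|f\|_{L^2(\mathbb{R}^n)}.$$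
   Context: $|u|$ is the Euclidean norm. $\check\beta$ is the inverse Fourier transform $\check\beta(t)=\int_{\mathbb{R}}e^{2\pi i t\tau}\beta(\tau)\,d\tau$. For a set $E$, writing $\beta\in C_c^\infty(E)$ means that $\beta$ is a smooth function with compact support contained in $E$. The symbol $*$ denotes convolution on $\mathbb{R}^n$. *)

theory Defs
  imports "HOL-Analysis.Analysis"
begin

primrec C_k :: "nat \<Rightarrow> ('a::euclidean_space \<Rightarrow> 'b::real_normed_vector) \<Rightarrow> bool" where
  "C_k 0 f \<longleftrightarrow> continuous_on UNIV f"
| "C_k (Suc k) f \<longleftrightarrow>
     f differentiable_on UNIV \<and> (\<forall>b\<in>Basis. C_k k (\<lambda>x. frechet_derivative f (at x) b))"

definition smooth :: "('a::euclidean_space \<Rightarrow> 'b::real_normed_vector) \<Rightarrow> bool" where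
  "smooth f \<longleftrightarrow> (\<forall>k. C_k k f)"

(* Elements of C_c^infinity(E) are taken as functions on the whole space, extended by zero off E. *)
definition test_functions :: "'a::euclidean_space set \<Rightarrow> ('a \<Rightarrow> complex) set" where
  "test_functions E = {f. smooth f \<and> compact (closure {x. f x \<noteq> 0}) \<and> closure {x. f x \<noteq> 0} \<subseteq> E}"

definition inverse_fourier :: "(real \<Rightarrow> complex) \<Rightarrow> real \<Rightarrow> complex" where
  "inverse_fourier \<beta> t =
     (\<integral>\<tau>. exp (2 * complex_of_real pi * \<i> * complex_of_real (t * \<tau>)) * \<beta> \<tau> \<partial>lebesgue)"

definition convolve :: "('a::euclidean_space \<Rightarrow> complex) \<Rightarrow> ('a \<Rightarrow> complex) \<Rightarrow> 'a \<Rightarrow> complex" where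
  "convolve g f x = (\<integral>y. g (x - y) * f y \<partial>lebesgue)"

(* Extended-valued L^2 norm of a function with values in [0,infinity]. For a non-measurable
   argument the nonnegative integral is only a lower integral, so measurability is always
   stated separately. *)
definition L2_norm :: "('a::euclidean_space \<Rightarrow> ennreal) \<Rightarrow> ennreal" where
  "L2_norm g = (let I = (\<integral>\<^sup>+x. (g x)\<^sup>2 \<partial>lebesgue)
                in if I = \<infinity> then \<infinity> else ennreal (sqrt (enn2real I)))"

definition L2_functions :: "('a::euclidean_space \<Rightarrow> complex) set" where
  "L2_functions = {f \<in> borel_measurable lebesgue. L2_norm (\<lambda>x. ennreal (norm (f x))) < \<infinity>}"

definition kernel ::
    "((real^'n) \<Rightarrow> complex) \<Rightarrow> (real \<Rightarrow> complex) \<Rightarrow> real \<Rightarrow> (real^'n) \<Rightarrow> complex" where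
  "kernel \<psi> \<beta> l u =
     \<psi> u * complex_of_real l * inverse_fourier \<beta> (l * ((norm u)\<^sup>2 - 1))"

definition dilated_kernel ::
    "((real^'n) \<Rightarrow> complex) \<Rightarrow> (real \<Rightarrow> complex) \<Rightarrow> real \<Rightarrow> (real^'n) \<Rightarrow> (real^'n) \<Rightarrow> complex" where
  "dilated_kernel \<psi> \<beta> l r y =
     complex_of_real (1 / (\<Prod>i\<in>UNIV. r $ i)) * kernel \<psi> \<beta> l (\<chi> i. y $ i / r $ i)"

(* The supremum is formed in [0,infinity], where it always exists. *)
definition maximal_function ::
    "((real^'n) \<Rightarrow> complex) \<Rightarrow> (real \<Rightarrow> complex) \<Rightarrow> real \<Rightarrow> ((real^'n) \<Rightarrow> complex)
      \<Rightarrow> (real^'n) \<Rightarrow> ennreal" where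
  "maximal_function \<psi> \<beta> l f x =
     (SUP r \<in> {r. \<forall>i. 1 \<le> r $ i \<and> r $ i \<le> 2}.
        ennreal (norm (convolve (dilated_kernel \<psi> \<beta> l r) f x)))"

end

theory Submission
  imports Defs
begin

text \<open>The kernel is a superposition of Gaussian waves whose phases are linear in the parameters
\<open>r\<^sub>j\<^sup>-\<^sup>2\<close>. Writing out the inverse Fourier transform, \<open>K\<^bsub>\<lambda>,r\<^esub> * f (x)\<close> becomes, up to the factor
\<open>\<lambda> / (r\<^sub>1 \<cdots> r\<^sub>n)\<close>, an integral over \<open>\<tau>\<close> of \<open>\<beta>(\<tau>)\<close> times a unimodular factor times
\<open>\<integral> exp (2\<pi>i\<lambda>\<tau> \<Sum>\<^sub>j (x\<^sub>j - y\<^sub>j)\<^sup>2 / r\<^sub>j\<^sup>2) \<chi>((x - y)/r) f(y) dy\<close>.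
There are \<open>n\<close> parameters, and each one over which a supremum is taken costs a factor
\<open>\<lambda>\<^bsup>1/4\<^esup>\<close>. One parameter can be saved: fix a coordinate \<open>k\<close> and substitute
\<open>\<tau> = r\<^sub>k\<^sup>2 \<sigma>\<close>. The quadratic form then has coefficient \<open>1\<close> in the coordinate \<open>k\<close> and
coefficients \<open>r\<^sub>k\<^sup>2 / r\<^sub>j\<^sup>2 \<in> [1/4, 4]\<close> in the others, while the dependence of the symbol on
\<open>r\<^sub>k\<close> is bounded and can be absorbed by taking absolute values inside the \<open>\<sigma>\<close>-integral
(\<open>convolve_pointwise_bound\<close>). It remains to bound, for each \<open>\<sigma>\<close> of size about \<open>1\<close>, the maximal function of
the wave averages at the single frequency \<open>\<Lambda> = 2\<pi>\<lambda>\<sigma>\<close>.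

For one frequency the argument is that of Kolmogorov, Seliverstov and Plessner. Choose \<open>r = \<rho>(x)\<close>
measurably, and let \<open>T\<close> be the resulting linear operator. The kernel of \<open>T T\<^sup>*\<close> at \<open>(x, x')\<close> is an
oscillatory integral in \<open>y\<close> whose phase is a sum of functions of single coordinates. In a coordinate
\<open>j \<noteq> k\<close> the phase is \<open>\<Lambda> (w (x\<^sub>j - y)\<^sup>2 - w' (x'\<^sub>j - y)\<^sup>2)\<close> with unrelated \<open>w\<close> and \<open>w'\<close>: if
\<open>\<bar>w - w'\<bar>\<close> is not small compared with \<open>\<bar>x\<^sub>j - x'\<^sub>j\<bar>\<close>, the second derivative is large, and otherwise the
first derivative is. Either way the coordinate contributes
\<open>(1 + \<bar>\<Lambda>\<bar> \<bar>x\<^sub>j - x'\<^sub>j\<bar>)\<^bsup>-1/2\<^esup>\<close> (\<open>two_centre_phase_bound\<close>). In the coordinate \<open>k\<close> the coefficients agree, the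
phase is linear, and two integrations by parts give \<open>(1 + \<Lambda>\<^sup>2 (x\<^sub>k - x'\<^sub>k)\<^sup>2)\<^sup>-\<^sup>1\<close>. The product of these
bounds (\<open>kernel_bound\<close>) depends on \<open>x - x'\<close> only and has integral \<open>O(\<bar>\<Lambda>\<bar>\<^bsup>-(n-1)/2 - 1\<^esup>)\<close>
(\<open>schur_weight_integral\<close>), so Schur's test gives the squared norm of \<open>T\<close> (\<open>TT_star_bound\<close>). With the factor
\<open>\<lambda>\<^sup>2\<close> the square of the final bound is \<open>\<lambda>\<^bsup>2 - 1 - (n-1)/2\<^esup> = \<lambda>\<^bsup>-(n-3)/2\<^esup>\<close>.

Measurable choices are made over finite sets of parameters only. The full supremum is
recovered by monotone convergence, because \<open>K\<^bsub>\<lambda>,r\<^esub> * f (x)\<close> is continuous in \<open>r\<close> and a countable dense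
set of parameters suffices (\<open>maximal_function_borel\<close>).\<close>

section \<open>Oscillatory integrals with quadratic phases in one variable\<close>

text \<open>\<open>F = cis P / (i P')\<close> is a primitive of \<open>cis P\<close> up to the error \<open>P'' cis P / (i P'\<^sup>2)\<close>. Since \<open>P''\<close> is
constant, the size of this error is exactly the derivative of the monotone function
\<open>\<minusplus>1 / P'\<close>, so its total contribution is bounded by the boundary values of \<open>1 / P'\<close>.\<close>

lemma nonstationary_quadratic_phase:
  fixes \<Phi> :: "real \<Rightarrow> complex"
  assumes \<Phi>: "\<And>s. (\<Phi> has_vector_derivative cis (\<alpha> * s\<^sup>2 + \<beta> * s + \<gamma>)) (at s)"
    and ab: "a \<le> b" and \<mu>: "\<mu> > 0"
    and p: "\<And>s. a \<le> s \<Longrightarrow> s \<le> b \<Longrightarrow> \<mu> \<le> \<bar>2 * \<alpha> * s + \<beta>\<bar>"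
  shows "norm (\<Phi> b - \<Phi> a) \<le> 4 / \<mu>"
proof (cases "a = b")
  case True
  then show ?thesis using \<mu> by simp
next
  case False
  define P where "P s = \<alpha> * s\<^sup>2 + \<beta> * s + \<gamma>" for s
  define q where "q s = 2 * \<alpha> * s + \<beta>" for s
  define F where "F s = cis (P s) / (\<i> * of_real (q s))" for s
  define \<phi> where "\<phi> s = - sgn \<alpha> / q s" for s
  have q0: "q s \<noteq> 0" if "a \<le> s" "s \<le> b" for s
    using p[OF that] \<mu> by (auto simp: q_def)
  have P': "(P has_vector_derivative q s) (at s)" for s
    unfolding P_def q_def
    by (auto intro!: derivative_eq_intros simp: has_real_derivative_iff_has_vector_derivative[symmetric])
  have cP: "((\<lambda>s. cis (P s)) has_vector_derivative (\<i> * of_real (q s) * cis (P s))) (at s)" for s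
    using P'[of s] unfolding has_vector_derivative_def
    by (auto intro!: derivative_eq_intros simp: scaleR_conv_of_real ac_simps)
  have qd: "(q has_derivative (\<lambda>h. h * (2 * \<alpha>))) (at s)" for s
    unfolding q_def by (auto intro!: derivative_eq_intros)
  have F': "(F has_vector_derivative (cis (P s) - cis (P s) * of_real (2*\<alpha>) / (\<i> * of_real (q s)^2))) (at s)"
    if "a \<le> s" "s \<le> b" for s
  proof -
    have inv: "((\<lambda>s. 1 / (of_real (q s) :: complex)) has_vector_derivative (- of_real (2*\<alpha>) / (of_real (q s))\<^sup>2)) (at s)"
      using q0[OF that] qd[of s] unfolding has_vector_derivative_def
      by (auto intro!: derivative_eq_intros simp: field_simps power2_eq_square scaleR_conv_of_real)
    have "((\<lambda>s. cis (P s) * (1 / (of_real (q s))) / \<i>) has_vector_derivative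
       ((cis (P s) * (- of_real (2*\<alpha>) / (of_real (q s))\<^sup>2) + \<i> * of_real (q s) * cis (P s) * (1 / of_real (q s))) / \<i>)) (at s)"
      by (intro has_vector_derivative_divide has_vector_derivative_mult cP inv)
    moreover have "(\<lambda>s. cis (P s) * (1 / (of_real (q s))) / \<i>) = F"
      by (simp add: F_def fun_eq_iff divide_inverse ac_simps)
    moreover have "(cis (P s) * (- of_real (2*\<alpha>) / (of_real (q s))\<^sup>2) + \<i> * of_real (q s) * cis (P s) * (1 / of_real (q s))) / \<i>
        = cis (P s) - cis (P s) * of_real (2*\<alpha>) / (\<i> * of_real (q s)^2)"
      using q0[OF that] by (simp add: divide_inverse algebra_simps)
    ultimately show ?thesis by metis
  qed
  have \<phi>': "(\<phi> has_vector_derivative (2 * \<bar>\<alpha>\<bar> / (q s)\<^sup>2)) (at s)" if "a \<le> s" "s \<le> b" for s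
  proof -
    have "(\<phi> has_real_derivative (2 * \<bar>\<alpha>\<bar> / (q s)\<^sup>2)) (at s)"
      unfolding \<phi>_def using q0[OF that] unfolding q_def
      by (auto intro!: derivative_eq_intros simp: power2_eq_square abs_sgn field_simps)
    then show ?thesis by (simp add: has_real_derivative_iff_has_vector_derivative)
  qed
  have H': "((\<lambda>s. \<Phi> s - F s) has_vector_derivative (cis (P s) * of_real (2*\<alpha>) / (\<i> * of_real (q s)^2))) (at s)"
    if "a \<le> s" "s \<le> b" for s
    using has_vector_derivative_diff[OF \<Phi>[folded P_def] F'[OF that]] by (simp add: P_def)
  have bd: "norm ((\<Phi> b - F b) - (\<Phi> a - F a)) \<le> \<phi> b - \<phi> a"
  proof (rule differentiable_bound_general[of a b "\<lambda>s. \<Phi> s - F s" \<phi>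
      "\<lambda>s. cis (P s) * of_real (2*\<alpha>) / (\<i> * of_real (q s)^2)" "\<lambda>s. 2 * \<bar>\<alpha>\<bar> / (q s)\<^sup>2"])
    show "a < b" using ab False by simp
    show "continuous_on {a..b} (\<lambda>s. \<Phi> s - F s)"
      using H' by (intro continuous_at_imp_continuous_on ballI) (auto intro!: has_vector_derivative_continuous)
    show "continuous_on {a..b} \<phi>"
      using \<phi>' by (intro continuous_at_imp_continuous_on ballI) (auto intro!: has_vector_derivative_continuous)
  qed (use H' \<phi>' in \<open>auto simp: norm_mult norm_divide norm_power\<close>)
  have bF: "norm (F s) \<le> 1 / \<mu>" if "a \<le> s" "s \<le> b" for s
    using p[OF that, folded q_def] \<mu>
    by (simp add: F_def norm_divide norm_mult del: of_real_add of_real_mult) (intro frac_le, auto)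
  have b\<phi>: "\<bar>\<phi> s\<bar> \<le> 1 / \<mu>" if "a \<le> s" "s \<le> b" for s
    using p[OF that, folded q_def] \<mu> by (auto simp: \<phi>_def abs_divide sgn_if intro!: frac_le)
  have "norm (\<Phi> b - \<Phi> a) \<le> norm ((\<Phi> b - F b) - (\<Phi> a - F a)) + norm (F b) + norm (F a)"
    using norm_triangle_ineq4[of "(\<Phi> b - F b) - (\<Phi> a - F a) + F b" "F a"]
      norm_triangle_ineq[of "(\<Phi> b - F b) - (\<Phi> a - F a)" "F b"] by (simp add: algebra_simps)
  also have "\<dots> \<le> 2/\<mu> + 1/\<mu> + 1/\<mu>"
    using bd bF[of a] bF[of b] b\<phi>[of a] b\<phi>[of b] ab by (simp add: abs_if split: if_splits)
  finally show ?thesis by simp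
qed

lemma trivial_phase_bound:
  fixes \<Phi> :: "real \<Rightarrow> complex"
  assumes \<Phi>: "\<And>s. (\<Phi> has_vector_derivative cis (P s)) (at s)"
  shows "norm (\<Phi> b - \<Phi> a) \<le> \<bar>b - a\<bar>"
proof -
  have "norm (\<Phi> b - \<Phi> a) \<le> 1 * norm (b - a)"
    by (rule differentiable_bound[of UNIV \<Phi> "\<lambda>s h. h *\<^sub>R cis (P s)"])
       (use \<Phi> in \<open>auto simp: has_vector_derivative_def intro!: onorm_le\<close>)
  then show ?thesis by simp
qed

text \<open>Outside the interval of radius \<open>\<bar>\<alpha>\<bar>\<^bsup>-1/2\<^esup>\<close> around the critical point the derivative of the phase is
at least \<open>2 \<bar>\<alpha>\<bar>\<^bsup>1/2\<^esup>\<close>; inside it the trivial bound is of the same size.\<close>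

lemma stationary_quadratic_phase:
  fixes \<Phi> :: "real \<Rightarrow> complex"
  assumes \<Phi>: "\<And>s. (\<Phi> has_vector_derivative cis (\<alpha> * s\<^sup>2 + \<beta> * s + \<gamma>)) (at s)"
    and \<alpha>: "\<alpha> \<noteq> 0"
  shows "norm (\<Phi> b - \<Phi> a) \<le> 6 / sqrt \<bar>\<alpha>\<bar>"
proof -
  define m where "m = - \<beta> / (2*\<alpha>)"
  define \<delta> where "\<delta> = 1 / sqrt \<bar>\<alpha>\<bar>"
  have \<delta>: "\<delta> > 0" using \<alpha> by (simp add: \<delta>_def)
  have q: "\<bar>2 * \<alpha> * s + \<beta>\<bar> = 2 * \<bar>\<alpha>\<bar> * \<bar>s - m\<bar>" for s
  proof -
    have "2 * \<alpha> * s + \<beta> = 2 * \<alpha> * (s - m)" using \<alpha> by (simp add: m_def field_simps)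
    then show ?thesis by (simp add: abs_mult)
  qed
  have a\<delta>: "2 * \<bar>\<alpha>\<bar> * \<delta> = 2 / \<delta>"
    using \<alpha> by (simp add: \<delta>_def field_simps)
  have away: "norm (\<Phi> d - \<Phi> c) \<le> 2 * \<delta>" if "c \<le> d" "\<And>s. c \<le> s \<Longrightarrow> s \<le> d \<Longrightarrow> \<delta> \<le> \<bar>s - m\<bar>" for c d
  proof -
    have "norm (\<Phi> d - \<Phi> c) \<le> 4 / (2/\<delta>)"
    proof (rule nonstationary_quadratic_phase[OF \<Phi> that(1)])
      fix s assume "c \<le> s" "s \<le> d"
      then have "2 * \<bar>\<alpha>\<bar> * \<delta> \<le> 2 * \<bar>\<alpha>\<bar> * \<bar>s - m\<bar>" using that(2) by (intro mult_left_mono) auto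
      then show "2/\<delta> \<le> \<bar>2 * \<alpha> * s + \<beta>\<bar>" by (simp add: q a\<delta>)
    qed (use \<delta> in auto)
    then show ?thesis by simp
  qed
  have main: "norm (\<Phi> y - \<Phi> m) \<le> 3 * \<delta>" for y
  proof -
    consider "\<bar>y - m\<bar> \<le> \<delta>" | "y > m + \<delta>" | "y < m - \<delta>" by linarith
    then show ?thesis
    proof cases
      case 1
      then show ?thesis using trivial_phase_bound[OF \<Phi>, of y m] \<delta> by linarith
    next
      case 2
      have "norm (\<Phi> y - \<Phi> (m+\<delta>)) \<le> 2 * \<delta>" by (rule away) (use 2 in auto)
      moreover have "norm (\<Phi> (m+\<delta>) - \<Phi> m) \<le> \<delta>" using trivial_phase_bound[OF \<Phi>, of "m+\<delta>" m] \<delta> by simp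
      ultimately show ?thesis using norm_triangle_ineq[of "\<Phi> y - \<Phi> (m+\<delta>)" "\<Phi> (m+\<delta>) - \<Phi> m"] by simp
    next
      case 3
      have "norm (\<Phi> (m-\<delta>) - \<Phi> y) \<le> 2 * \<delta>" by (rule away) (use 3 in auto)
      moreover have "norm (\<Phi> (m-\<delta>) - \<Phi> m) \<le> \<delta>" using trivial_phase_bound[OF \<Phi>, of "m-\<delta>" m] \<delta> by simp
      ultimately show ?thesis using norm_triangle_ineq4[of "\<Phi> (m-\<delta>) - \<Phi> m" "\<Phi> (m-\<delta>) - \<Phi> y"] by simp
    qed
  qed
  show ?thesis
    using norm_triangle_ineq4[of "\<Phi> b - \<Phi> m" "\<Phi> a - \<Phi> m"] main[of a] main[of b]
    by (simp add: \<delta>_def)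
qed

text \<open>The bound is uniform in the coefficients \<open>w\<close> and \<open>w'\<close>, which is what makes a maximal estimate possible. The derivative of
the phase is \<open>2\<Lambda> ((w - w')(s - x') - w (x - x'))\<close>. If \<open>\<bar>w - w'\<bar>\<close> is at least a small multiple of
\<open>\<bar>x - x'\<bar>\<close>, the second derivative \<open>2\<Lambda>(w - w')\<close> is large; if not, the second term dominates as long as
\<open>s\<close> stays within distance \<open>4\<close> of \<open>x'\<close>, so that there is no critical point.\<close>

lemma two_centre_phase_bound:
  fixes \<Phi> :: "real \<Rightarrow> complex"
  assumes \<Phi>: "\<And>s. (\<Phi> has_vector_derivative cis (\<Lambda> * (w * (x - s)\<^sup>2 - w' * (x' - s)\<^sup>2))) (at s)"
    and w: "1/4 \<le> w"
    and y: "\<bar>y - x'\<bar> \<le> 4"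
  shows "norm (\<Phi> y - \<Phi> x') \<le> 72 / sqrt (1 + \<bar>\<Lambda>\<bar> * \<bar>x - x'\<bar>)"
proof -
  define X where "X = \<bar>\<Lambda>\<bar> * \<bar>x - x'\<bar>"
  have X0: "X \<ge> 0" by (simp add: X_def)
  define \<alpha> where "\<alpha> = \<Lambda> * (w - w')"
  define \<beta> where "\<beta> = \<Lambda> * (2 * w' * x' - 2 * w * x)"
  define \<gamma> where "\<gamma> = \<Lambda> * (w * x\<^sup>2 - w' * x'\<^sup>2)"
  have ph: "\<Lambda> * (w * (x - s)\<^sup>2 - w' * (x' - s)\<^sup>2) = \<alpha> * s\<^sup>2 + \<beta> * s + \<gamma>" for s
    by (simp add: \<alpha>_def \<beta>_def \<gamma>_def power2_eq_square algebra_simps)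
  note \<Phi>' = \<Phi>[unfolded ph]
  have triv: "norm (\<Phi> y - \<Phi> x') \<le> 4" using trivial_phase_bound[OF \<Phi>', of y x'] y by linarith
  show ?thesis
  proof (cases "X \<le> 1")
    case True
    then have "sqrt (1 + X) \<le> sqrt (16\<^sup>2)" by (intro real_sqrt_le_mono) simp
    then have "sqrt (1 + X) \<le> 16" by simp
    then have "4 \<le> 72 / sqrt (1 + X)" using X0 by (simp add: field_simps)
    then show ?thesis using triv by (simp add: X_def)
  next
    case False
    have s2: "sqrt (1 + X) \<le> sqrt (2\<^sup>2 * X)" using False by (intro real_sqrt_le_mono) simp
    then have s2: "sqrt (1 + X) \<le> 2 * sqrt X" by (simp add: real_sqrt_mult)
    have nz: "\<Lambda> \<noteq> 0" "x \<noteq> x'" using False by (auto simp: X_def)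
    have sX: "sqrt X > 0" using False by simp
    \<comment> \<open>The threshold \<open>1/32\<close> keeps \<open>\<bar>(w - w')(s - x')\<bar>\<close> within half of the least value \<open>\<bar>x - x'\<bar> / 4\<close> of \<open>w \<bar>x - x'\<bar>\<close>.\<close>
    have "norm (\<Phi> y - \<Phi> x') \<le> 36 / sqrt X \<or> norm (\<Phi> y - \<Phi> x') \<le> 16 / X"
    proof (cases "\<bar>w - w'\<bar> \<ge> \<bar>x - x'\<bar> / 32")
      case True
      then have w0: "w \<noteq> w'" using nz by auto
      have "X / 36 \<le> \<bar>\<alpha>\<bar>" 
      proof -
        have "\<bar>\<Lambda>\<bar> * (\<bar>x - x'\<bar> / 32) \<le> \<bar>\<Lambda>\<bar> * \<bar>w - w'\<bar>" using True by (intro mult_left_mono) auto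
        then have "X / 32 \<le> \<bar>\<alpha>\<bar>" by (simp add: X_def \<alpha>_def abs_mult)
        then show ?thesis using X0 by linarith
      qed
      then have "sqrt (X / 6\<^sup>2) \<le> sqrt \<bar>\<alpha>\<bar>" by (intro real_sqrt_le_mono) simp
      then have le: "sqrt X / 6 \<le> sqrt \<bar>\<alpha>\<bar>" by (simp add: real_sqrt_divide)
      have "norm (\<Phi> y - \<Phi> x') \<le> 6 / sqrt \<bar>\<alpha>\<bar>"
        by (rule stationary_quadratic_phase[OF \<Phi>']) (use nz w0 in \<open>simp add: \<alpha>_def\<close>)
      also have "\<dots> \<le> 6 / (sqrt X / 6)" using le sX by (intro divide_left_mono mult_pos_pos) auto
      finally show ?thesis by simp
    next
      case False
      have low: "X/4 \<le> \<bar>2 * \<alpha> * s + \<beta>\<bar>" if "\<bar>s - x'\<bar> \<le> 4" for s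
      proof -
        have e: "2 * \<alpha> * s + \<beta> = 2 * \<Lambda> * ((w - w') * (s - x') - w * (x - x'))"
          by (simp add: \<alpha>_def \<beta>_def algebra_simps)
        have "\<bar>(w - w') * (s - x')\<bar> \<le> \<bar>x - x'\<bar> / 32 * 4"
          unfolding abs_mult using False that by (intro mult_mono) auto
        moreover have "\<bar>w * (x - x')\<bar> \<ge> \<bar>x - x'\<bar> / 4"
          unfolding abs_mult using w mult_right_mono[OF w, of "\<bar>x - x'\<bar>"] by simp
        ultimately have "\<bar>x - x'\<bar> / 8 \<le> \<bar>(w - w') * (s - x') - w * (x - x')\<bar>" by linarith
        then have "2 * \<bar>\<Lambda>\<bar> * (\<bar>x - x'\<bar> / 8) \<le> 2 * \<bar>\<Lambda>\<bar> * \<bar>(w - w') * (s - x') - w * (x - x')\<bar>"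
          by (intro mult_left_mono) auto
        then show ?thesis by (simp add: e abs_mult X_def)
      qed
      have "norm (\<Phi> y - \<Phi> x') \<le> 4 / (X/4)"
      proof (cases "x' \<le> y")
        case True
        show ?thesis
          by (rule nonstationary_quadratic_phase[OF \<Phi>' True])
             (use y \<open>\<not> X \<le> 1\<close> True in \<open>auto intro!: low simp del: divide_le_eq_numeral1 le_divide_eq_numeral1\<close>)
      next
        case False
        then have "y \<le> x'" by simp
        have "norm (\<Phi> x' - \<Phi> y) \<le> 4 / (X/4)"
          by (rule nonstationary_quadratic_phase[OF \<Phi>' \<open>y \<le> x'\<close>])
             (use y \<open>\<not> X \<le> 1\<close> False in \<open>auto intro!: low simp del: divide_le_eq_numeral1 le_divide_eq_numeral1\<close>)
        then show ?thesis by (simp add: norm_minus_commute)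
      qed
      then show ?thesis by simp
    qed
    moreover have "16 / X \<le> 32 / sqrt X"
    proof -
      have "sqrt X * 1 \<le> sqrt X * sqrt X" using False by (intro mult_left_mono) auto
      then have "sqrt X \<le> X" using X0 by simp
      then show ?thesis using sX by (intro frac_le) auto
    qed
    ultimately have "norm (\<Phi> y - \<Phi> x') \<le> 36 / sqrt X" using sX
      by (smt (verit, best) divide_right_mono)
    also have "\<dots> \<le> 72 / sqrt (1 + X)"
    proof -
      have "36 * sqrt (1 + X) \<le> 72 * sqrt X" using s2 by simp
      then show ?thesis using sX X0 by (simp add: field_simps)
    qed
    finally show ?thesis by (simp add: X_def)
  qed
qed

section \<open>Integration by parts in a coordinate direction\<close>

text \<open>Only a derivative in one direction is recorded, because integration by parts is carried out one
coordinate at a time and the primitives involved need not be handled as jointly differentiable functions.\<close>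

definition has_partial :: "'a::euclidean_space \<Rightarrow> ('a \<Rightarrow> complex) \<Rightarrow> ('a \<Rightarrow> complex) \<Rightarrow> bool" where
  "has_partial e f f' \<longleftrightarrow> (\<forall>y. ((\<lambda>s. f (y + s *\<^sub>R e)) has_vector_derivative f' y) (at 0))"

lemma has_partial_at:
  assumes "has_partial e f f'"
  shows "((\<lambda>s. f (y + s *\<^sub>R e)) has_vector_derivative f' (y + t *\<^sub>R e)) (at t)"
proof -
  have 1: "((\<lambda>s. f ((y + t *\<^sub>R e) + s *\<^sub>R e)) has_vector_derivative f' (y + t *\<^sub>R e)) (at (t - t))"
    using assms unfolding has_partial_def by simp
  have 2: "((\<lambda>s. s - t) has_vector_derivative 1) (at t)"
    by (auto intro!: derivative_eq_intros simp: has_real_derivative_iff_has_vector_derivative[symmetric])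
  show ?thesis
    using vector_diff_chain_at[OF 2 1] by (simp add: o_def algebra_simps)
qed

lemma has_partial_mult:
  assumes "has_partial e f f'" "has_partial e g g'"
  shows "has_partial e (\<lambda>y. f y * g y) (\<lambda>y. f y * g' y + f' y * g y)"
  unfolding has_partial_def
proof
  fix y
  show "((\<lambda>s. f (y + s *\<^sub>R e) * g (y + s *\<^sub>R e)) has_vector_derivative f y * g' y + f' y * g y) (at 0)"
    using has_vector_derivative_mult[of "\<lambda>s. f (y + s *\<^sub>R e)" "f' y" 0 UNIV "\<lambda>s. g (y + s *\<^sub>R e)" "g' y"] assms
    by (simp add: has_partial_def)
qed

lemma integrable_continuous_bounded_support:
  fixes f :: "'a::euclidean_space \<Rightarrow> complex"
  assumes "continuous_on UNIV f" "\<And>y. f y \<noteq> 0 \<Longrightarrow> y \<in> cball c R"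
  shows "integrable lborel f"
proof -
  have "integrable lborel (\<lambda>y. indicator (cball c R) y *\<^sub>R f y)"
    using assms(1) by (intro borel_integrable_compact) (auto intro: continuous_on_subset)
  moreover have "(\<lambda>y. indicator (cball c R) y *\<^sub>R f y) = f"
    using assms(2) by (auto simp: fun_eq_iff indicator_def)
  ultimately show ?thesis by simp
qed

text \<open>By translation invariance \<open>\<integral> (H(y + e) - H(y)) dy = 0\<close>. The integrand is \<open>\<integral>\<^sub>0\<^sup>1 H'(y + t e) dt\<close>, and
after exchanging the integrals each \<open>t\<close> contributes the same \<open>\<integral> H'\<close>.\<close>

lemma integral_partial_zero:
  fixes H H' :: "'a::euclidean_space \<Rightarrow> complex"
  assumes cH: "continuous_on UNIV H" and cH': "continuous_on UNIV H'"
    and d: "has_partial e H H'"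
    and sH: "\<And>y. H y \<noteq> 0 \<Longrightarrow> y \<in> cball c R"
    and sH': "\<And>y. H' y \<noteq> 0 \<Longrightarrow> y \<in> cball c R"
  shows "(\<integral>y. H' y \<partial>lborel) = 0"
proof -
  have [measurable]: "H \<in> borel_measurable borel" "H' \<in> borel_measurable borel"
    using cH cH' by (auto intro: borel_measurable_continuous_onI)
  have iH: "integrable lborel H" and iH': "integrable lborel H'"
    using integrable_continuous_bounded_support[OF cH sH] integrable_continuous_bounded_support[OF cH' sH'] by auto
  have shift: "integrable lborel (\<lambda>y. g (y + t *\<^sub>R e)) \<and> (\<integral>y. g (y + t *\<^sub>R e) \<partial>lborel) = (\<integral>y. g y \<partial>lborel)"
    if "integrable lborel g" for g :: "'a \<Rightarrow> complex" and t
  proof -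
    have [measurable]: "g \<in> borel_measurable borel" using that by auto
    have 1: "lborel = distr lborel borel (\<lambda>y::'a. t *\<^sub>R e + y)" by (simp add: lborel_distr_plus)
    have "integrable (distr lborel borel (\<lambda>y::'a. t *\<^sub>R e + y)) g" using that 1 by simp
    then have "integrable lborel (\<lambda>y. g (t *\<^sub>R e + y))"
      by (subst (asm) integrable_distr_eq) auto
    moreover have "(\<integral>y. g y \<partial>lborel) = (\<integral>y. g (t *\<^sub>R e + y) \<partial>lborel)"
      by (subst 1, subst integral_distr) auto
    ultimately show ?thesis by (simp add: add.commute)
  qed
  have ftc: "(\<integral>t. indicator {0..1} t *\<^sub>R H' (y + t *\<^sub>R e) \<partial>lborel) = H (y + e) - H y" for y
  proof -
    have "(\<integral>t. indicator {0..1} t *\<^sub>R H' (y + t *\<^sub>R e) \<partial>lborel) = H (y + 1 *\<^sub>R e) - H (y + 0 *\<^sub>R e)"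
    proof (rule integral_FTC_Icc)
      show "continuous_on {0..1} (\<lambda>t. H' (y + t *\<^sub>R e))"
        by (intro continuous_on_compose2[OF cH'] continuous_intros) auto
      fix t :: real
      show "((\<lambda>t. H (y + t *\<^sub>R e)) has_vector_derivative H' (y + t *\<^sub>R e)) (at t within {0..1})"
        using has_partial_at[OF d, of y t] by (rule has_vector_derivative_at_within)
    qed simp
    then show ?thesis by simp
  qed
  obtain M where M: "\<And>y. norm (H' y) \<le> M"
  proof -
    have "compact (H' ` cball c R)"
      using cH' by (intro compact_continuous_image) (auto intro: continuous_on_subset)
    then obtain M where "\<And>z. z \<in> H' ` cball c R \<Longrightarrow> norm z \<le> M"
      using compact_imp_bounded bounded_iff by metis
    then have "norm (H' y) \<le> max M 0" for y using sH'[of y] by (cases "H' y = 0") (auto simp: le_max_iff_disj)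
    then show ?thesis using that by blast
  qed
  have int2: "integrable (lborel \<Otimes>\<^sub>M lborel) (\<lambda>(t, y). indicator {0..1} t *\<^sub>R H' (y + t *\<^sub>R e))"
  proof (rule lborel_pair.Fubini_integrable)
    show "(\<lambda>(t, y). indicator {0..1} t *\<^sub>R H' (y + t *\<^sub>R e)) \<in> borel_measurable (lborel \<Otimes>\<^sub>M lborel)"
      by measurable
    show "AE x in lborel. integrable lborel (\<lambda>y. case (x, y) of (t, y) \<Rightarrow> indicator {0..1} t *\<^sub>R H' (y + t *\<^sub>R e))"
      using shift[OF iH'] by auto
    have "(\<integral>y. norm (H' (y + t *\<^sub>R e)) \<partial>lborel) = (\<integral>y. norm (H' y) \<partial>lborel)" for t
      using shift[of "\<lambda>y. of_real (norm (H' y))" t] integrable_norm[OF iH'] by simp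
    then show "integrable lborel (\<lambda>x. \<integral>y. norm (case (x, y) of (t, y) \<Rightarrow> indicat_real {0..1} t *\<^sub>R H' (y + t *\<^sub>R e)) \<partial>lborel)"
      by simp
  qed
  have "0 = (\<integral>y. H (y + 1 *\<^sub>R e) - H y \<partial>lborel)"
    using shift[OF iH, of 1] iH by (subst Bochner_Integration.integral_diff) auto
  also have "\<dots> = (\<integral>y. (\<integral>t. indicator {0..1} t *\<^sub>R H' (y + t *\<^sub>R e) \<partial>lborel) \<partial>lborel)"
    by (simp add: ftc)
  also have "\<dots> = (\<integral>t. (\<integral>y. indicator {0..1} t *\<^sub>R H' (y + t *\<^sub>R e) \<partial>lborel) \<partial>lborel)"
    using lborel_pair.Fubini_integral[OF int2] by simp
  also have "\<dots> = (\<integral>y. H' y \<partial>lborel)"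
    using shift[OF iH'] by simp
  finally show ?thesis by simp
qed

text \<open>\<open>iterated_primitive [i\<^sub>1, \<dots>, i\<^sub>m] E \<Phi>\<close> expresses that \<open>E = \<partial>\<^bsub>i\<^sub>1\<^esub> \<cdots> \<partial>\<^bsub>i\<^sub>m\<^esub> \<Phi>\<close> through continuous intermediate functions.\<close>

primrec iterated_primitive :: "'n list \<Rightarrow> ((real^'n) \<Rightarrow> complex) \<Rightarrow> ((real^'n) \<Rightarrow> complex) \<Rightarrow> bool" where
  "iterated_primitive [] E \<Phi> \<longleftrightarrow> continuous_on UNIV E \<and> \<Phi> = E"
| "iterated_primitive (i # is) E \<Phi> \<longleftrightarrow> continuous_on UNIV E \<and>
     (\<exists>E'. has_partial (axis i 1) E' E \<and> iterated_primitive is E' \<Phi>)"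

lemma iterated_primitive_continuous: "iterated_primitive is E \<Phi> \<Longrightarrow> continuous_on UNIV E"
  by (cases "is") auto

definition coord_prod :: "('n \<Rightarrow> real \<Rightarrow> complex) \<Rightarrow> (real^'n) \<Rightarrow> complex" where
  "coord_prod e y = (\<Prod>j\<in>UNIV. e j (y $ j))"

lemma continuous_coord_prod:
  fixes e :: "'n::finite \<Rightarrow> real \<Rightarrow> complex"
  assumes "\<And>j. continuous_on UNIV (e j)"
  shows "continuous_on UNIV (coord_prod e)"
proof -
  have "continuous_on UNIV (\<lambda>y :: real^'n. e j (y $ j))" for j
    by (rule continuous_on_compose2[OF assms]) (auto intro!: continuous_intros)
  then show ?thesis
    unfolding coord_prod_def[abs_def] by (intro continuous_on_prod)
qed

lemma has_partial_coord_prod: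
  fixes e :: "'n::finite \<Rightarrow> real \<Rightarrow> complex"
  assumes "\<And>s. (F has_vector_derivative e i s) (at s)"
  shows "has_partial (axis i 1) (coord_prod (e(i := F))) (coord_prod e)"
  unfolding has_partial_def
proof
  fix y :: "real^'n"
  define Q where "Q = (\<Prod>j\<in>UNIV-{i}. e j (y $ j))"
  have *: "coord_prod (e(i := F)) (y + s *\<^sub>R axis i 1) = F (y $ i + s) * Q" for s
  proof -
    have "(\<Prod>j\<in>UNIV-{i}. (e(i := F)) j ((y + s *\<^sub>R axis i 1) $ j)) = Q"
      unfolding Q_def by (intro prod.cong) (auto simp: axis_def)
    then show ?thesis
      unfolding coord_prod_def by (subst prod.remove[of _ i]) auto
  qed
  have "coord_prod e y = e i (y $ i) * Q"
    unfolding coord_prod_def Q_def by (subst prod.remove[of _ i]) auto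
  moreover have "((\<lambda>s. F (y $ i + s) * Q) has_vector_derivative e i (y $ i) * Q) (at 0)"
  proof -
    have 1: "((\<lambda>s. y $ i + s) has_vector_derivative 1) (at 0)"
      by (auto intro!: derivative_eq_intros simp: has_real_derivative_iff_has_vector_derivative[symmetric])
    have "(F has_vector_derivative e i (y $ i)) (at (y $ i + 0))" using assms[of "y $ i"] by simp
    from vector_diff_chain_at[OF 1 this]
    have "((\<lambda>s. F (y $ i + s)) has_vector_derivative e i (y $ i)) (at 0)" by (simp add: o_def)
    from has_vector_derivative_mult[OF this has_vector_derivative_const[of Q]] show ?thesis by simp
  qed
  ultimately show "((\<lambda>s. coord_prod (e(i := F)) (y + s *\<^sub>R axis i 1)) has_vector_derivative coord_prod e y) (at 0)"
    by (simp add: *)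
qed

text \<open>For a product of functions of single coordinates, primitives are taken factor by factor. The list
\<open>ks\<close> leaves room for integrating a coordinate outside \<open>js\<close>, possibly more than once.\<close>

lemma iterated_primitive_coord_prod:
  fixes e :: "'n::finite \<Rightarrow> real \<Rightarrow> complex"
  assumes "distinct js"
    and "\<And>j. continuous_on UNIV (e j)"
    and "\<And>j s. j \<in> set js \<Longrightarrow> (F j has_vector_derivative e j s) (at s)"
    and "iterated_primitive ks (coord_prod (\<lambda>j. if j \<in> set js then F j else e j)) \<Phi>"
  shows "iterated_primitive (js @ ks) (coord_prod e) \<Phi>"
  using assms
proof (induction js arbitrary: e)
  case Nil
  then show ?case by simp
next
  case (Cons i js)
  have "continuous_on UNIV (F i)"
    using Cons.prems(3)[of i] by (intro continuous_at_imp_continuous_on ballI) (auto intro!: has_vector_derivative_continuous)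
  then have "iterated_primitive (js @ ks) (coord_prod (e(i := F i))) \<Phi>"
  proof (intro Cons.IH)
    have "(\<lambda>j. if j \<in> set js then F j else (e(i := F i)) j) = (\<lambda>j. if j \<in> set (i # js) then F j else e j)"
      using Cons.prems(1) by (auto simp: fun_eq_iff)
    then show "iterated_primitive ks (coord_prod (\<lambda>j. if j \<in> set js then F j else (e(i := F i)) j)) \<Phi>"
      using Cons.prems(4) by simp
  qed (use Cons.prems in auto)
  moreover have "has_partial (axis i 1) (coord_prod (e(i := F i))) (coord_prod e)"
    by (rule has_partial_coord_prod) (use Cons.prems in auto)
  ultimately show ?case
    using continuous_coord_prod[of e] Cons.prems by auto
qed

section \<open>Oscillatory integrals with rescaled amplitudes\<close>

text \<open>The class is closed under partial derivatives and carries a fixed support, so that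
induction on the number of derivatives stays inside it.\<close>

definition amplitude :: "((real^'n) \<Rightarrow> complex) set" where
  "amplitude = {\<psi>. smooth \<psi> \<and> {u. \<psi> u \<noteq> 0} \<subseteq> cball 0 2}"

definition dyadic_box :: "(real^'n) set" where
  "dyadic_box = {r. \<forall>i. 1 \<le> r $ i \<and> r $ i \<le> 2}"

definition rescale :: "real^'n \<Rightarrow> real^'n \<Rightarrow> real^'n" where
  "rescale r u = (\<chi> i. u $ i / r $ i)"

lemma smooth_differentiable: "smooth f \<Longrightarrow> f differentiable (at x)"
  unfolding smooth_def by (metis C_k.simps(2) UNIV_I differentiable_on_def)

lemma smooth_frechet: "smooth f \<Longrightarrow> b \<in> Basis \<Longrightarrow> smooth (\<lambda>x. frechet_derivative f (at x) b)"
  unfolding smooth_def by (metis C_k.simps(2))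

lemma smooth_continuous: "smooth f \<Longrightarrow> continuous_on UNIV f"
  unfolding smooth_def by (metis C_k.simps(1))

lemma amplitude_continuous: "\<psi> \<in> amplitude \<Longrightarrow> continuous_on UNIV \<psi>"
  by (auto simp: amplitude_def smooth_continuous)

lemma amplitude_support: "\<psi> \<in> amplitude \<Longrightarrow> \<psi> u \<noteq> 0 \<Longrightarrow> norm u \<le> 2"
  by (auto simp: amplitude_def)

lemma amplitude_bounded:
  assumes "\<psi> \<in> amplitude"
  obtains M where "M \<ge> 0" "\<And>u. norm (\<psi> u) \<le> M"
proof -
  have "compact (\<psi> ` cball 0 2)"
    using amplitude_continuous[OF assms] by (intro compact_continuous_image) (auto intro: continuous_on_subset)
  then obtain M where M: "\<And>z. z \<in> \<psi> ` cball 0 2 \<Longrightarrow> norm z \<le> M"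
    using compact_imp_bounded bounded_iff by metis
  have "norm (\<psi> u) \<le> max M 0" for u
    using M[of "\<psi> u"] amplitude_support[OF assms, of u]
    by (cases "\<psi> u = 0") (auto simp: le_max_iff_disj)
  then show ?thesis using that[of "max M 0"] by auto
qed

lemma amplitude_derivative:
  fixes \<psi> :: "(real^'n) \<Rightarrow> complex"
  assumes "\<psi> \<in> amplitude"
  shows "(\<lambda>x. frechet_derivative \<psi> (at x) (axis i 1)) \<in> amplitude"
proof -
  have "smooth (\<lambda>x. frechet_derivative \<psi> (at x) (axis i 1))"
    using assms by (intro smooth_frechet) (auto simp: amplitude_def Basis_vec_def)
  moreover have "u \<in> cball 0 2" if u: "frechet_derivative \<psi> (at u) (axis i 1) \<noteq> 0" for u
  proof (rule ccontr)
    assume "u \<notin> cball 0 2"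
    moreover have "open (- cball 0 2 :: (real^'n) set)" by (simp add: open_Compl)
    moreover have "\<psi> v = 0" if "v \<in> - cball 0 2" for v
      using that amplitude_support[OF assms, of v] by force
    ultimately have "(\<psi> has_derivative (\<lambda>h. 0)) (at u)"
      by (intro has_derivative_transform_within_open[OF has_derivative_const, where s = "- cball 0 2"]) auto
    then have "frechet_derivative \<psi> (at u) = (\<lambda>h. 0)" by (metis frechet_derivative_at)
    then show False using u by simp
  qed
  ultimately show ?thesis by (auto simp: amplitude_def)
qed

lemma rescale_bound:
  assumes "r \<in> dyadic_box" "norm (rescale r u) \<le> 2"
  shows "\<bar>u $ j\<bar> \<le> 4"
proof -
  have r: "1 \<le> r $ j" "r $ j \<le> 2" using assms(1) by (auto simp: dyadic_box_def)
  have "\<bar>u $ j / r $ j\<bar> \<le> 2"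
    using component_le_norm_cart[of "rescale r u" j] assms(2) by (simp add: rescale_def)
  then have "\<bar>u $ j\<bar> \<le> 2 * r $ j" using r by (simp add: abs_divide field_simps)
  then show ?thesis using r by linarith
qed

lemma continuous_rescale: "continuous_on UNIV (rescale r)"
  unfolding rescale_def[abs_def] divide_inverse
  by (intro continuous_on_vec_lambda continuous_intros)

lemma continuous_on_amplitude_rescale:
  "continuous_on UNIV \<psi> \<Longrightarrow> continuous_on UNIV (\<lambda>y. \<psi> (rescale r (x - y)))"
  by (rule continuous_on_compose2[where t=UNIV and g=\<psi>, OF _ continuous_on_compose2[OF continuous_rescale]])
     (auto intro!: continuous_intros)

lemma has_partial_amplitude_rescale:
  fixes \<psi> :: "(real^'n) \<Rightarrow> complex"
  assumes "\<psi> \<in> amplitude"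
  shows "has_partial (axis i 1) (\<lambda>y. \<psi> (rescale r (x - y)))
     (\<lambda>y. - of_real (1 / r $ i) * frechet_derivative \<psi> (at (rescale r (x - y))) (axis i 1))"
  unfolding has_partial_def
proof
  fix y :: "real^'n"
  define u where "u = rescale r (x - y)"
  define L where "L = frechet_derivative \<psi> (at u)"
  have d: "(\<psi> has_derivative L) (at u)"
    using assms smooth_differentiable[of \<psi> u] unfolding L_def amplitude_def
    by (simp add: frechet_derivative_works[symmetric])
  have eq: "rescale r (x - (y + s *\<^sub>R axis i 1)) = u + s *\<^sub>R (- (1 / r $ i) *\<^sub>R axis i 1)" for s
  unfolding vec_eq_iff
  proof
    fix j
    show "rescale r (x - (y + s *\<^sub>R axis i 1)) $ j = (u + s *\<^sub>R (- (1 / r $ i) *\<^sub>R axis i 1)) $ j"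
      by (cases "j = i") (simp_all add: u_def rescale_def axis_def diff_divide_distrib add_divide_distrib)
  qed
  have inner: "((\<lambda>s. u + s *\<^sub>R (- (1 / r $ i) *\<^sub>R axis i 1)) has_derivative (\<lambda>s. s *\<^sub>R (- (1 / r $ i) *\<^sub>R axis i 1))) (at 0)"
    using has_derivative_add[OF has_derivative_const[of u "at 0"]
        has_derivative_scaleR_left[OF has_derivative_ident[of "at 0"], of "- (1 / r $ i) *\<^sub>R axis i 1"]]
    by simp
  have "((\<lambda>s. \<psi> (u + s *\<^sub>R (- (1 / r $ i) *\<^sub>R axis i 1))) has_derivative (\<lambda>s. L (s *\<^sub>R (- (1 / r $ i) *\<^sub>R axis i 1)))) (at 0)"
    by (rule has_derivative_compose[OF inner]) (use d in simp)
  moreover have "L (s *\<^sub>R (- (1 / r $ i) *\<^sub>R axis i 1)) = s *\<^sub>R (- of_real (1 / r $ i) * L (axis i 1))" for s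
    using linear_scale[OF has_derivative_linear[OF d], of "s * (- (1 / r $ i))" "axis i 1"]
    by (simp add: scaleR_conv_of_real[where 'a=complex])
  ultimately show "((\<lambda>s. \<psi> (rescale r (x - (y + s *\<^sub>R axis i 1)))) has_vector_derivative
        - of_real (1 / r $ i) * frechet_derivative \<psi> (at (rescale r (x - y))) (axis i 1)) (at 0)"
    unfolding has_vector_derivative_def eq L_def u_def by simp
qed

lemma has_partial_cnj:
  assumes "has_partial e f f'"
  shows "has_partial e (\<lambda>y. cnj (f y)) (\<lambda>y. cnj (f' y))"
  unfolding has_partial_def
proof
  fix y
  show "((\<lambda>s. cnj (f (y + s *\<^sub>R e))) has_vector_derivative cnj (f' y)) (at 0)"
    using bounded_linear.has_vector_derivative[OF bounded_linear_cnj] assms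
    unfolding has_partial_def by blast
qed

text \<open>One integration by parts: \<open>h\<close> is the original integrand, and \<open>f\<close> and \<open>g\<close> are the terms in which the
derivative has fallen on one of the two amplitudes.\<close>

lemma norm_integral_le_if_combination_zero:
  fixes f g h :: "'a \<Rightarrow> complex"
  assumes "integrable M f" "integrable M g" "integrable M h"
    and zero: "(\<integral>y. c * f y + d * g y + h y \<partial>M) = 0" and c: "norm c \<le> 1" and d: "norm d \<le> 1"
  shows "norm (integral\<^sup>L M h) \<le> norm (integral\<^sup>L M f) + norm (integral\<^sup>L M g)"
proof -
  define a b where "a = c * integral\<^sup>L M f" and "b = d * integral\<^sup>L M g"
  have "a + b + integral\<^sup>L M h = 0"
    using zero assms(1-3) by (simp add: a_def b_def)
  then have "integral\<^sup>L M h = - (a + b)" by (metis add_eq_0_iff)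
  then have "norm (integral\<^sup>L M h) \<le> norm a + norm b" by (metis norm_minus_cancel norm_triangle_ineq)
  also have "norm a \<le> norm (integral\<^sup>L M f)"
    using c by (simp add: a_def norm_mult mult_left_le_one_le)
  also have "norm b \<le> norm (integral\<^sup>L M g)"
    using d by (simp add: b_def norm_mult mult_left_le_one_le)
  finally show ?thesis by simp
qed

text \<open>Each entry of \<open>js\<close> stands for one integration by parts, trading the oscillating factor for its primitive and
differentiating one of the two amplitudes. A derivative of a rescaled amplitude is \<open>-1/r\<^sub>i\<close> times a rescaled amplitude,
and \<open>1/r\<^sub>i \<le> 1\<close>, so the constant depends on the amplitudes alone and not on the dilations or the
centres. The primitive is needed only where the second amplitude can be nonzero, which is within
distance \<open>4\<close> of \<open>x'\<close> in every coordinate.\<close>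

lemma oscillatory_integral_bound:
  fixes \<psi>1 \<psi>2 :: "(real^'n) \<Rightarrow> complex"
  assumes "\<psi>1 \<in> amplitude" "\<psi>2 \<in> amplitude"
  shows "\<exists>C\<ge>0. \<forall>r\<in>dyadic_box. \<forall>r'\<in>dyadic_box. \<forall>x x' E \<Phi>. \<forall>B\<ge>0.
     iterated_primitive js E \<Phi> \<and> (\<forall>y. (\<forall>j. \<bar>y $ j - x' $ j\<bar> \<le> 4) \<longrightarrow> norm (\<Phi> y) \<le> B) \<longrightarrow>
     norm (\<integral>y. E y * (\<psi>1 (rescale r (x - y)) * cnj (\<psi>2 (rescale r' (x' - y)))) \<partial>lborel) \<le> C * B"
  using assms
proof (induction js arbitrary: \<psi>1 \<psi>2)
  case Nil
  obtain M1 where M1: "M1 \<ge> 0" "\<And>u. norm (\<psi>1 u) \<le> M1" using amplitude_bounded[OF Nil(1)] by blast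
  obtain M2 where M2: "M2 \<ge> 0" "\<And>u. norm (\<psi>2 u) \<le> M2" using amplitude_bounded[OF Nil(2)] by blast
  show ?case
  proof (intro exI conjI ballI allI impI)
    show "0 \<le> M1 * M2 * measure lborel (cbox (- vec 4) (vec 4) :: (real^'n) set)" using M1 M2 by simp
    fix r r' x x' :: "real^'n" and E \<Phi> :: "(real^'n) \<Rightarrow> complex" and B :: real
    assume r: "r \<in> dyadic_box" "r' \<in> dyadic_box" and B: "0 \<le> B"
      and *: "iterated_primitive [] E \<Phi> \<and> (\<forall>y. (\<forall>j. \<bar>y $ j - x' $ j\<bar> \<le> 4) \<longrightarrow> norm (\<Phi> y) \<le> B)"
    let ?Q = "cbox (- vec 4 + x') (vec 4 + x') :: (real^'n) set"
    let ?f = "\<lambda>y. E y * (\<psi>1 (rescale r (x - y)) * cnj (\<psi>2 (rescale r' (x' - y))))"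
    have bd: "norm (?f y) \<le> indicator ?Q y * (M1 * M2 * B)" for y
    proof (cases "\<psi>2 (rescale r' (x' - y)) = 0")
      case True
      then show ?thesis using B M1 M2 by (simp add: indicator_def)
    next
      case False
      then have y: "\<bar>(x' - y) $ j\<bar> \<le> 4" for j
        by (intro rescale_bound[OF r(2)] amplitude_support[OF Nil(2)])
      have y': "\<bar>y $ j - x' $ j\<bar> \<le> 4" for j using y[of j] by simp
      then have E: "norm (E y) \<le> B" using * y' by auto
      have "y \<in> ?Q" using y' by (auto simp: mem_box_cart abs_le_iff add.commute intro: add_le_imp_le_diff) (smt (verit))+
      moreover have "norm (?f y) \<le> B * (M1 * M2)"
        unfolding norm_mult using M1 M2 B E by (intro mult_mono) auto
      ultimately show ?thesis by (simp add: mult.commute)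
    qed
    obtain R where R: "\<forall>y\<in>?Q. norm y \<le> R"
      using bounded_cbox[of "- vec 4 + x'" "vec 4 + x'"] unfolding bounded_iff by blast
    have "norm (\<integral>y. ?f y \<partial>lborel) \<le> (\<integral>y. indicator ?Q y * (M1 * M2 * B) \<partial>lborel)"
    proof (rule order_trans[OF integral_norm_bound integral_mono])
      have "integrable lborel ?f"
      proof (rule integrable_continuous_bounded_support[of _ 0 R])
        show "continuous_on UNIV ?f"
          using * by (intro continuous_on_mult continuous_on_cnj continuous_on_amplitude_rescale[OF amplitude_continuous] Nil) auto
        fix y assume "?f y \<noteq> 0"
        then have "y \<in> ?Q" using bd[of y] by (metis indicator_simps(2) mult_zero_left norm_le_zero_iff)
        then show "y \<in> cball 0 R" using R by simp
      qed
      then show "integrable lborel (\<lambda>y. norm (?f y))" by (rule integrable_norm)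
      show "integrable lborel (\<lambda>y. indicat_real ?Q y * (M1 * M2 * B))"
        by (intro integrable_mult_left integrable_real_indicator) (use emeasure_lborel_cbox_finite[of "- vec 4 + x'" "vec 4 + x'"] in simp_all)
    qed (use bd in auto)
    also have "\<dots> = M1 * M2 * B * measure lborel ?Q" by simp
    also have "measure lborel ?Q = measure lborel (cbox (- vec 4) (vec 4) :: (real^'n) set)"
    proof -
      have "vec 4 \<bullet> b = 4" if "b \<in> Basis" for b :: "real^'n"
        using that by (auto simp: Basis_vec_def inner_axis)
      then show ?thesis
        by (auto simp: measure_lborel_cbox_eq inner_diff_left inner_add_left)
    qed
    finally show "norm (\<integral>y. ?f y \<partial>lborel) \<le> M1 * M2 * measure lborel (cbox (- vec 4) (vec 4) :: (real^'n) set) * B"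
      by (simp add: ac_simps)
  qed
next
  case (Cons i js)
  let ?d = "\<lambda>\<psi> x. frechet_derivative \<psi> (at x) (axis i 1)"
  let ?J = "\<lambda>\<psi>1 \<psi>2 E r x r' x' y. E y * (\<psi>1 (rescale r (x - y)) * cnj (\<psi>2 (rescale r' (x' - y))))"
  note d1 = amplitude_derivative[OF Cons.prems(1), of i] and d2 = amplitude_derivative[OF Cons.prems(2), of i]
  from Cons.IH[OF d1 Cons.prems(2)] obtain C1 where C1: "C1 \<ge> 0"
    "\<And>r r' x x' E \<Phi> B. r \<in> dyadic_box \<Longrightarrow> r' \<in> dyadic_box \<Longrightarrow> B \<ge> 0 \<Longrightarrow> iterated_primitive js E \<Phi> \<Longrightarrow>
       (\<And>y. (\<forall>j. \<bar>y $ j - x' $ j\<bar> \<le> 4) \<Longrightarrow> norm (\<Phi> y) \<le> B) \<Longrightarrow> norm (\<integral>y. ?J (?d \<psi>1) \<psi>2 E r x r' x' y \<partial>lborel) \<le> C1 * B"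
    by blast
  from Cons.IH[OF Cons.prems(1) d2] obtain C2 where C2: "C2 \<ge> 0"
    "\<And>r r' x x' E \<Phi> B. r \<in> dyadic_box \<Longrightarrow> r' \<in> dyadic_box \<Longrightarrow> B \<ge> 0 \<Longrightarrow> iterated_primitive js E \<Phi> \<Longrightarrow>
       (\<And>y. (\<forall>j. \<bar>y $ j - x' $ j\<bar> \<le> 4) \<Longrightarrow> norm (\<Phi> y) \<le> B) \<Longrightarrow> norm (\<integral>y. ?J \<psi>1 (?d \<psi>2) E r x r' x' y \<partial>lborel) \<le> C2 * B"
    by blast
  show ?case
  proof (intro exI conjI ballI allI impI)
    show "0 \<le> C1 + C2" using C1 C2 by simp
    fix r r' x x' :: "real^'n" and E \<Phi> :: "(real^'n) \<Rightarrow> complex" and B :: real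
    assume r: "r \<in> dyadic_box" "r' \<in> dyadic_box" and B: "0 \<le> B"
      and *: "iterated_primitive (i # js) E \<Phi> \<and> (\<forall>y. (\<forall>j. \<bar>y $ j - x' $ j\<bar> \<le> 4) \<longrightarrow> norm (\<Phi> y) \<le> B)"
    from * obtain E' where E': "has_partial (axis i 1) E' E" "iterated_primitive js E' \<Phi>" and cE: "continuous_on UNIV E"
      by auto
    have cE': "continuous_on UNIV E'" using E'(2) by (rule iterated_primitive_continuous)
    define c1 c2 :: complex where "c1 = - of_real (1 / r $ i)" and "c2 = - of_real (1 / r' $ i)"
    have c: "norm c1 \<le> 1" "norm c2 \<le> 1"
    proof -
      have "1 \<le> r $ i" "1 \<le> r' $ i" using r by (auto simp: dyadic_box_def)
      then show "norm c1 \<le> 1" "norm c2 \<le> 1" by (simp_all add: c1_def c2_def norm_divide)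
    qed
    have supp: "y \<in> cball x' (norm (vec 4 :: real^'n))" if "\<phi> \<in> amplitude" "\<phi> (rescale r' (x' - y)) \<noteq> 0"
      for \<phi> :: "(real^'n) \<Rightarrow> complex" and y
    proof -
      have "\<bar>(x' - y) $ j\<bar> \<le> 4" for j
        using that by (intro rescale_bound[OF r(2)] amplitude_support[OF that(1)])
      then have "norm (x' - y) \<le> norm (vec 4 :: real^'n)"
        by (intro norm_le_componentwise_cart) auto
      then show ?thesis by (simp add: dist_norm)
    qed
    have cont: "continuous_on UNIV (?J \<phi>1 \<phi>2 F r x r' x')"
      if "\<phi>1 \<in> amplitude" "\<phi>2 \<in> amplitude" "continuous_on UNIV F" for \<phi>1 \<phi>2 F
      by (intro continuous_on_mult continuous_on_cnj continuous_on_amplitude_rescale[OF amplitude_continuous] that)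
    have int: "integrable lborel (?J \<phi>1 \<phi>2 F r x r' x')"
      if "\<phi>1 \<in> amplitude" "\<phi>2 \<in> amplitude" "continuous_on UNIV F" for \<phi>1 \<phi>2 F
      by (rule integrable_continuous_bounded_support[OF cont[OF that], of x' "norm (vec 4 :: real^'n)"])
         (use supp[OF that(2)] in auto)
    let ?T1 = "?J (?d \<psi>1) \<psi>2 E' r x r' x'" and ?T2 = "?J \<psi>1 (?d \<psi>2) E' r x r' x'" and ?T0 = "?J \<psi>1 \<psi>2 E r x r' x'"
    note i1 = int[OF d1 Cons.prems(2) cE'] and i2 = int[OF Cons.prems(1) d2 cE'] and i0 = int[OF Cons.prems cE]
    have "has_partial (axis i 1) (?J \<psi>1 \<psi>2 E' r x r' x')
       (\<lambda>y. E' y * (\<psi>1 (rescale r (x - y)) * cnj (c2 * ?d \<psi>2 (rescale r' (x' - y)))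
           + c1 * ?d \<psi>1 (rescale r (x - y)) * cnj (\<psi>2 (rescale r' (x' - y))))
           + E y * (\<psi>1 (rescale r (x - y)) * cnj (\<psi>2 (rescale r' (x' - y)))))"
      unfolding c1_def c2_def
      by (intro has_partial_mult E' has_partial_cnj has_partial_amplitude_rescale Cons.prems)
    also have "(\<lambda>y. E' y * (\<psi>1 (rescale r (x - y)) * cnj (c2 * ?d \<psi>2 (rescale r' (x' - y)))
           + c1 * ?d \<psi>1 (rescale r (x - y)) * cnj (\<psi>2 (rescale r' (x' - y))))
           + E y * (\<psi>1 (rescale r (x - y)) * cnj (\<psi>2 (rescale r' (x' - y)))))
        = (\<lambda>y. c1 * ?T1 y + cnj c2 * ?T2 y + ?T0 y)"
      by (auto simp: fun_eq_iff algebra_simps)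
    finally have dp: "has_partial (axis i 1) (?J \<psi>1 \<psi>2 E' r x r' x') (\<lambda>y. c1 * ?T1 y + cnj c2 * ?T2 y + ?T0 y)" .
    have "(\<integral>y. c1 * ?T1 y + cnj c2 * ?T2 y + ?T0 y \<partial>lborel) = 0"
    proof (rule integral_partial_zero[OF _ _ dp, of x' "norm (vec 4 :: real^'n)"])
      show "continuous_on UNIV (?J \<psi>1 \<psi>2 E' r x r' x')" by (rule cont[OF Cons.prems cE'])
      show "continuous_on UNIV (\<lambda>y. c1 * ?T1 y + cnj c2 * ?T2 y + ?T0 y)"
        by (intro continuous_on_add continuous_on_mult continuous_on_const cont[OF d1 Cons.prems(2) cE', simplified]
             cont[OF Cons.prems(1) d2 cE', simplified] cont[OF Cons.prems cE, simplified])
      fix y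
      show "y \<in> cball x' (norm (vec 4 :: real^'n))" if "?J \<psi>1 \<psi>2 E' r x r' x' y \<noteq> 0"
        using that supp[OF Cons.prems(2), of y] by fastforce
      show "y \<in> cball x' (norm (vec 4 :: real^'n))" if "c1 * ?T1 y + cnj c2 * ?T2 y + ?T0 y \<noteq> 0"
      proof (rule ccontr)
        assume "y \<notin> cball x' (norm (vec 4 :: real^'n))"
        then have "\<psi>2 (rescale r' (x' - y)) = 0" "?d \<psi>2 (rescale r' (x' - y)) = 0"
          using supp[OF Cons.prems(2), of y] supp[OF d2, of y] by blast+
        then show False using that by simp
      qed
    qed
    from norm_integral_le_if_combination_zero[OF i1 i2 i0 this c(1)] c(2)
    have "norm (\<integral>y. ?T0 y \<partial>lborel) \<le> norm (\<integral>y. ?T1 y \<partial>lborel) + norm (\<integral>y. ?T2 y \<partial>lborel)"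
      by simp
    also have "\<dots> \<le> C1 * B + C2 * B"
      using * by (intro add_mono C1(2)[OF r B E'(2)] C2(2)[OF r B E'(2)]) auto
    finally show "norm (\<integral>y. ?T0 y \<partial>lborel) \<le> (C1 + C2) * B" by (simp add: algebra_simps)
  qed
qed

section \<open>The kernel bound and its integral\<close>

text \<open>The form \<open>r\<^sub>k\<^sup>2 \<Sum>\<^sub>j u\<^sub>j\<^sup>2 / r\<^sub>j\<^sup>2\<close>, normalised to have coefficient \<open>1\<close> in the coordinate \<open>k\<close>, so that no
supremum has to be taken over that coefficient.\<close>

definition normalized_form :: "'n \<Rightarrow> real^'n \<Rightarrow> real^'n \<Rightarrow> real" where
  "normalized_form k r u = (\<Sum>j\<in>UNIV. (r $ k / r $ j)\<^sup>2 * (u $ j)\<^sup>2)"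

definition wave :: "'n \<Rightarrow> ((real^'n) \<Rightarrow> complex) \<Rightarrow> real \<Rightarrow> real^'n \<Rightarrow> real^'n \<Rightarrow> complex" where
  "wave k \<psi> \<Lambda> r u = cis (\<Lambda> * normalized_form k r u) * \<psi> (rescale r u)"

text \<open>The majorant for Schur's test. Its decay in \<open>z\<^sub>k\<close> is quadratic, so that the integral in this
variable is \<open>O(1/\<bar>\<Lambda>\<bar>)\<close>; first order decay in \<open>z\<^sub>k\<close> would cost a logarithm.\<close>

definition schur_weight :: "'n \<Rightarrow> real \<Rightarrow> real^'n \<Rightarrow> real" where
  "schur_weight k \<Lambda> z = (\<Prod>j\<in>UNIV-{k}. 1 / sqrt (1 + \<bar>\<Lambda>\<bar> * \<bar>z $ j\<bar>)) * (1 / (1 + (\<Lambda> * z $ k)\<^sup>2))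
     * indicator {z. \<forall>j. \<bar>z $ j\<bar> \<le> 8} z"

lemma cis_sum: "finite A \<Longrightarrow> cis (sum f A) = (\<Prod>j\<in>A. cis (f j))"
  by (induction A rule: finite_induct) (auto simp: cis_mult[symmetric])

lemma normalized_coefficient_bound:
  assumes "r \<in> dyadic_box"
  shows "1/4 \<le> (r $ k / r $ j)\<^sup>2"
proof -
  have r: "1 \<le> r $ j" "r $ j \<le> 2" "1 \<le> r $ k" using assms by (auto simp: dyadic_box_def)
  then have "1/2 \<le> r $ k / r $ j" by (simp add: field_simps)
  then have "(1/2)\<^sup>2 \<le> (r $ k / r $ j)\<^sup>2" by (intro power_mono) auto
  then show ?thesis by (simp add: power2_eq_square)
qed

text \<open>The phases combine to a product of functions of single coordinates. In the coordinates \<open>j \<noteq> k\<close> the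
primitives vanishing at \<open>x'\<^sub>j\<close> are bounded by \<open>two_centre_phase_bound\<close>. In the coordinate \<open>k\<close> the quadratic terms
cancel and the factor is \<open>cis (c - \<mu> s)\<close>, whose second primitive has size \<open>1/\<mu>\<^sup>2\<close>. Adding the estimate without integration in
the coordinate \<open>k\<close> and \<open>\<mu>\<^sup>2\<close> times the estimate with it gives the factor \<open>1 / (1 + \<mu>\<^sup>2)\<close>.\<close>

lemma kernel_bound:
  fixes \<psi> :: "(real^'n) \<Rightarrow> complex"
  assumes "\<psi> \<in> amplitude"
  obtains C where "C \<ge> 0" "\<And>\<Lambda> r r' x x'. r \<in> dyadic_box \<Longrightarrow> r' \<in> dyadic_box \<Longrightarrow>
     norm (\<integral>y. wave k \<psi> \<Lambda> r (x - y) * cnj (wave k \<psi> \<Lambda> r' (x' - y)) \<partial>lborel) \<le> C * schur_weight k \<Lambda> (x - x')"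
proof -
  obtain js where js: "set js = UNIV - {k}" "distinct js"
    using finite_distinct_list[of "UNIV - {k}"] by auto
  from oscillatory_integral_bound[OF assms assms, of "js @ []"] obtain C1 where C1: "C1 \<ge> 0"
    "\<And>r r' x x' E \<Phi> B. r \<in> dyadic_box \<Longrightarrow> r' \<in> dyadic_box \<Longrightarrow> B \<ge> 0 \<Longrightarrow> iterated_primitive (js @ []) E \<Phi> \<Longrightarrow>
       (\<And>y. (\<forall>j. \<bar>y $ j - x' $ j\<bar> \<le> 4) \<Longrightarrow> norm (\<Phi> y) \<le> B) \<Longrightarrow>
       norm (\<integral>y. E y * (\<psi> (rescale r (x - y)) * cnj (\<psi> (rescale r' (x' - y)))) \<partial>lborel) \<le> C1 * B"
    by blast
  from oscillatory_integral_bound[OF assms assms, of "js @ [k, k]"] obtain C2 where C2: "C2 \<ge> 0"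
    "\<And>r r' x x' E \<Phi> B. r \<in> dyadic_box \<Longrightarrow> r' \<in> dyadic_box \<Longrightarrow> B \<ge> 0 \<Longrightarrow> iterated_primitive (js @ [k, k]) E \<Phi> \<Longrightarrow>
       (\<And>y. (\<forall>j. \<bar>y $ j - x' $ j\<bar> \<le> 4) \<Longrightarrow> norm (\<Phi> y) \<le> B) \<Longrightarrow>
       norm (\<integral>y. E y * (\<psi> (rescale r (x - y)) * cnj (\<psi> (rescale r' (x' - y)))) \<partial>lborel) \<le> C2 * B"
    by blast
  define K where "K = (72::real) ^ (CARD('n) - 1)"
  have K: "K \<ge> 0" by (simp add: K_def)
  show ?thesis
  proof
    show "0 \<le> (C1 + C2) * K" using C1(1) C2(1) K by simp
    fix \<Lambda> :: real and r r' x x' :: "real^'n"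
    assume r: "r \<in> dyadic_box" "r' \<in> dyadic_box"
    define P where "P = (\<Prod>j\<in>UNIV-{k}. 1 / sqrt (1 + \<bar>\<Lambda>\<bar> * \<bar>(x - x') $ j\<bar>))"
    have P: "P \<ge> 0" unfolding P_def by (intro prod_nonneg) auto
    define e where "e j s = cis (\<Lambda> * ((r $ k / r $ j)\<^sup>2 * (x $ j - s)\<^sup>2 - (r' $ k / r' $ j)\<^sup>2 * (x' $ j - s)\<^sup>2))" for j s
    define I where "I = (\<integral>y. wave k \<psi> \<Lambda> r (x - y) * cnj (wave k \<psi> \<Lambda> r' (x' - y)) \<partial>lborel)"
    have ce: "continuous_on UNIV (e j)" for j
      unfolding e_def by (intro continuous_intros)
    have ne: "norm (e j s) = 1" for j s by (simp add: e_def)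
    have E: "wave k \<psi> \<Lambda> r (x - y) * cnj (wave k \<psi> \<Lambda> r' (x' - y))
       = coord_prod e y * (\<psi> (rescale r (x - y)) * cnj (\<psi> (rescale r' (x' - y))))" for y
    proof -
      have "cis (\<Lambda> * normalized_form k r (x - y)) * cnj (cis (\<Lambda> * normalized_form k r' (x' - y))) = coord_prod e y"
        unfolding coord_prod_def e_def
        by (subst cis_sum[symmetric])
           (simp_all add: cis_mult cis_cnj normalized_form_def sum_distrib_left sum_subtractf right_diff_distrib)
      then show ?thesis by (simp add: wave_def)
    qed
    have Ieq: "I = (\<integral>y. coord_prod e y * (\<psi> (rescale r (x - y)) * cnj (\<psi> (rescale r' (x' - y)))) \<partial>lborel)"
      unfolding I_def E ..
    have "\<exists>F. (\<forall>s. (F has_vector_derivative e j s) (at s)) \<and> F (x' $ j) = 0" for j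
    proof -
      have "\<exists>F. \<forall>s. -\<infinity> < ereal s \<longrightarrow> ereal s < \<infinity> \<longrightarrow> (F has_vector_derivative e j s) (at s)"
        using ce[of j] by (intro einterval_antiderivative) (auto simp: continuous_on_eq_continuous_at)
      then obtain F where F: "\<And>s. (F has_vector_derivative e j s) (at s)" by auto
      have "((\<lambda>s. F s - F (x' $ j)) has_vector_derivative e j s) (at s)" for s
        using has_vector_derivative_diff[OF F has_vector_derivative_const] by simp
      then show ?thesis by (intro exI[of _ "\<lambda>s. F s - F (x' $ j)"]) auto
    qed
    then obtain F where F: "\<And>j s. (F j has_vector_derivative e j s) (at s)" "\<And>j. F j (x' $ j) = 0"
      by metis
    define g where "g j = (if j \<in> set js then F j else e j)" for j
    have gk: "g k = e k" using js by (simp add: g_def)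
    have cg: "continuous_on UNIV (g j)" for j
      using F(1)[of j] ce[of j] by (auto simp: g_def intro!: continuous_at_imp_continuous_on has_vector_derivative_continuous)
    have bg: "norm (coord_prod (g(k := h)) y) \<le> K * P * norm (h (y $ k))"
      if y: "\<forall>j. \<bar>y $ j - x' $ j\<bar> \<le> 4" for h y
    proof -
      have "norm (\<Prod>j\<in>UNIV-{k}. (g(k := h)) j (y $ j)) \<le> (\<Prod>j\<in>UNIV-{k}. 72 / sqrt (1 + \<bar>\<Lambda>\<bar> * \<bar>(x - x') $ j\<bar>))"
        unfolding prod_norm[symmetric]
      proof (rule prod_mono, safe)
        fix j assume "j \<noteq> k"
        then have gj: "(g(k := h)) j = F j" using js by (simp add: g_def)
        have "norm (F j (y $ j) - F j (x' $ j)) \<le> 72 / sqrt (1 + \<bar>\<Lambda>\<bar> * \<bar>x $ j - x' $ j\<bar>)"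
          by (rule two_centre_phase_bound[OF F(1)[of j, unfolded e_def] normalized_coefficient_bound[OF r(1)]]) (use y in auto)
        then show "norm ((g(k := h)) j (y $ j)) \<le> 72 / sqrt (1 + \<bar>\<Lambda>\<bar> * \<bar>(x - x') $ j\<bar>)"
          unfolding gj by (simp add: F(2))
      qed simp
      also have "\<dots> = K * P"
        unfolding P_def K_def by (simp add: prod_dividef)
      finally have 1: "norm (\<Prod>j\<in>UNIV-{k}. (g(k := h)) j (y $ j)) \<le> K * P" .
      have "coord_prod (g(k := h)) y = h (y $ k) * (\<Prod>j\<in>UNIV-{k}. (g(k := h)) j (y $ j))"
        unfolding coord_prod_def by (subst prod.remove[of _ k]) auto
      then show ?thesis using mult_left_mono[OF 1, of "norm (h (y $ k))"] by (simp add: norm_mult mult.commute)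
    qed
    have b1: "norm I \<le> C1 * (K * P)"
      unfolding Ieq
    proof (rule C1(2)[OF r])
      show "iterated_primitive (js @ []) (coord_prod e) (coord_prod g)"
        using iterated_primitive_coord_prod[of js e F "[]" "coord_prod g", OF js(2) ce F(1)] continuous_coord_prod[of g, OF cg]
        by (simp add: g_def[abs_def])
      fix y :: "real^'n" assume "\<forall>j. \<bar>y $ j - x' $ j\<bar> \<le> 4"
      from bg[OF this, of "e k"] show "norm (coord_prod g y) \<le> K * P"
        using gk ne by (metis fun_upd_triv mult.right_neutral)
    qed (use K P in auto)
    define \<mu> where "\<mu> = 2 * \<Lambda> * (x - x') $ k"
    have b2: "norm I * \<mu>\<^sup>2 \<le> C2 * (K * P)"
    proof (cases "\<mu> = 0")
      case True
      then show ?thesis using C2(1) K P by simp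
    next
      case False
      define c where "c = - \<i> * of_real \<mu>"
      have c: "c \<noteq> 0" "norm c = \<bar>\<mu>\<bar>" using False by (auto simp: c_def norm_mult)
      have rk: "r $ k \<noteq> 0" "r' $ k \<noteq> 0"
        using r by (auto simp: dyadic_box_def dest!: spec[of _ k])
      have ek: "e k s = cis (\<Lambda> * ((x $ k)\<^sup>2 - (x' $ k)\<^sup>2) - \<mu> * s)" for s
        using rk by (simp add: e_def \<mu>_def power2_eq_square algebra_simps)
      have dek: "(e k has_vector_derivative c * e k s) (at s)" for s
        unfolding ek[abs_def] has_vector_derivative_def c_def
        by (auto intro!: derivative_eq_intros simp: scaleR_conv_of_real algebra_simps)
      define e1 e2 where "e1 s = e k s / c" and "e2 s = e k s / c / c" for s
      have de1: "(e1 has_vector_derivative e k s) (at s)" for s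
        using has_vector_derivative_divide[OF dek[of s], of c] c by (simp add: e1_def[abs_def])
      have de2: "(e2 has_vector_derivative e1 s) (at s)" for s
        using has_vector_derivative_divide[OF de1[of s], of c] by (simp add: e1_def[abs_def] e2_def[abs_def])
      have "norm I \<le> C2 * (K * P / \<mu>\<^sup>2)"
        unfolding Ieq
      proof (rule C2(2)[OF r])
        have ce1: "continuous_on UNIV e1" and ce2: "continuous_on UNIV e2"
          using ce c unfolding e1_def e2_def by (auto intro!: continuous_intros)
        have "has_partial (axis k 1) (coord_prod (g(k := e1))) (coord_prod g)"
          by (rule has_partial_coord_prod) (simp add: gk de1)
        moreover have "has_partial (axis k 1) (coord_prod (g(k := e2))) (coord_prod (g(k := e1)))"
          using has_partial_coord_prod[of e2 "g(k := e1)" k] de2 by simp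
        moreover have "continuous_on UNIV (coord_prod (g(k := e1)))" "continuous_on UNIV (coord_prod (g(k := e2)))"
          using cg ce1 ce2 by (auto intro!: continuous_coord_prod)
        ultimately have "iterated_primitive [k, k] (coord_prod g) (coord_prod (g(k := e2)))"
          using continuous_coord_prod[of g, OF cg] by auto
        then show "iterated_primitive (js @ [k, k]) (coord_prod e) (coord_prod (g(k := e2)))"
          by (intro iterated_primitive_coord_prod[OF js(2) ce F(1)]) (simp add: g_def[abs_def])
        fix y :: "real^'n" assume "\<forall>j. \<bar>y $ j - x' $ j\<bar> \<le> 4"
        from bg[OF this, of e2] show "norm (coord_prod (g(k := e2)) y) \<le> K * P / \<mu>\<^sup>2"
          by (simp add: e2_def norm_divide norm_mult ne c(2) power2_eq_square)
      qed (use K P in auto)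
      then show ?thesis using False by (simp add: field_simps)
    qed
    have z: "I = 0" if "\<not> (\<forall>j. \<bar>(x - x') $ j\<bar> \<le> 8)"
    proof -
      from that obtain j where j: "\<bar>(x - x') $ j\<bar> > 8" by (auto simp: not_le)
      have "\<psi> (rescale r (x - y)) * cnj (\<psi> (rescale r' (x' - y))) = 0" for y
      proof (rule ccontr)
        assume "\<psi> (rescale r (x - y)) * cnj (\<psi> (rescale r' (x' - y))) \<noteq> 0"
        then have "\<bar>(x - y) $ j\<bar> \<le> 4" "\<bar>(x' - y) $ j\<bar> \<le> 4"
          using rescale_bound[OF r(1) amplitude_support[OF assms], of "x - y" j]
            rescale_bound[OF r(2) amplitude_support[OF assms], of "x' - y" j] by auto
        then show False using j by simp
      qed
      then show ?thesis
        unfolding Ieq by (simp only: mult_zero_right Bochner_Integration.integral_zero)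
    qed
    show "norm (\<integral>y. wave k \<psi> \<Lambda> r (x - y) * cnj (wave k \<psi> \<Lambda> r' (x' - y)) \<partial>lborel) \<le> (C1 + C2) * K * schur_weight k \<Lambda> (x - x')"
    proof (cases "\<forall>j. \<bar>(x - x') $ j\<bar> \<le> 8")
      case True
      define q where "q = (\<Lambda> * (x - x') $ k)\<^sup>2"
      have q: "q \<ge> 0" "q \<le> \<mu>\<^sup>2" by (auto simp: q_def \<mu>_def power_mult_distrib)
      have "norm I * q \<le> norm I * \<mu>\<^sup>2" using q by (intro mult_left_mono) auto
      then have "norm I * (1 + q) \<le> (C1 + C2) * K * P" using b1 b2 by (simp add: algebra_simps)
      then have "norm I \<le> (C1 + C2) * K * P / (1 + q)" using q by (simp add: pos_le_divide_eq)
      also have "\<dots> = (C1 + C2) * K * schur_weight k \<Lambda> (x - x')"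
        using True by (simp add: schur_weight_def P_def q_def)
      finally show ?thesis by (simp add: I_def)
    next
      case False
      then show ?thesis using z[OF False] by (simp add: I_def schur_weight_def)
    qed
  qed
qed

lemma schur_weight_nonneg: "schur_weight k \<Lambda> z \<ge> 0"
  unfolding schur_weight_def by (intro mult_nonneg_nonneg prod_nonneg) auto

text \<open>A primitive given by a formula valid for \<open>s \<ge> 0\<close> is enough for an even function such as \<open>(1 + c \<bar>s\<bar>)\<^bsup>-1/2\<^esup>\<close>.\<close>

lemma nn_integral_symmetric_interval:
  fixes f :: "real \<Rightarrow> real"
  assumes [measurable]: "f \<in> borel_measurable borel" and f: "\<And>s. 0 \<le> s \<Longrightarrow> 0 \<le> f s"
    and sym: "\<And>s. f (- s) = f s" and F: "\<And>s. 0 \<le> s \<Longrightarrow> DERIV F s :> f s" and a: "0 \<le> a"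
  shows "(\<integral>\<^sup>+s. ennreal (f s) * indicator {-a..a} s \<partial>lborel) \<le> ennreal (2 * (F a - F 0))"
proof -
  have half: "(\<integral>\<^sup>+s. ennreal (f s) * indicator {0..a} s \<partial>lborel) = ennreal (F a - F 0)"
    by (rule nn_integral_FTC_Icc) (use assms in auto)
  have half': "(\<integral>\<^sup>+s. ennreal (f s) * indicator {-a..0} s \<partial>lborel) = ennreal (F a - F 0)"
  proof -
    have "(\<integral>\<^sup>+s. ennreal (f s) * indicator {-a..0} s \<partial>lborel)
        = ennreal \<bar>-1\<bar> * (\<integral>\<^sup>+s. ennreal (f (0 + -1 * s)) * indicator {-a..0} (0 + -1 * s) \<partial>lborel)"
      by (rule nn_integral_real_affine) auto
    also have "\<dots> = (\<integral>\<^sup>+s. ennreal (f s) * indicator {0..a} s \<partial>lborel)"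
      using sym by (auto intro!: nn_integral_cong simp: indicator_def)
    finally show ?thesis using half by simp
  qed
  have "(\<integral>\<^sup>+s. ennreal (f s) * indicator {-a..a} s \<partial>lborel)
      \<le> (\<integral>\<^sup>+s. ennreal (f s) * indicator {-a..0} s + ennreal (f s) * indicator {0..a} s \<partial>lborel)"
    by (intro nn_integral_mono) (auto simp: indicator_def)
  also have "\<dots> = ennreal (F a - F 0) + ennreal (F a - F 0)"
    by (subst nn_integral_add) (auto simp: half half')
  also have "\<dots> = ennreal (2 * (F a - F 0))"
  proof -
    have "F 0 \<le> F a" by (rule DERIV_nonneg_imp_nondecreasing[OF a]) (use F f in auto)
    then show ?thesis by (simp add: ennreal_plus[symmetric] del: ennreal_plus)
  qed
  finally show ?thesis .
qed

lemma schur_weight_integral: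
  fixes k :: "'n::finite"
  assumes \<Lambda>: "\<Lambda> \<noteq> 0"
  shows "(\<integral>\<^sup>+z. ennreal (schur_weight k \<Lambda> z) \<partial>lborel) \<le> ennreal ((16 / sqrt \<bar>\<Lambda>\<bar>) ^ (CARD('n) - 1) * (pi / \<bar>\<Lambda>\<bar>))"
proof -
  let ?L = "\<bar>\<Lambda>\<bar>"
  have L: "?L > 0" using \<Lambda> by simp
  define f1 where "f1 s = 1 / sqrt (1 + ?L * \<bar>s\<bar>)" for s :: real
  define f2 where "f2 s = 1 / (1 + (\<Lambda> * s)\<^sup>2)" for s :: real
  define f where "f b s = ennreal (if b = axis k (1::real) then f2 s else f1 s) * indicator {-8..8} s" for b :: "real^'n" and s
  have [measurable]: "f1 \<in> borel_measurable borel" "f2 \<in> borel_measurable borel"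
    unfolding f1_def f2_def by measurable
  have fm[measurable]: "f b \<in> borel_measurable borel" for b unfolding f_def by measurable
  have pos: "f1 s \<ge> 0" "f2 s \<ge> 0" for s by (auto simp: f1_def f2_def)
  have B: "(Basis :: (real^'n) set) = (\<lambda>i. axis i 1) ` UNIV" by (auto simp: Basis_vec_def)
  have inj: "inj (\<lambda>i::'n. axis i (1::real))" by (auto simp: inj_on_def axis_eq_axis)
  have ind: "(\<Prod>j\<in>UNIV. indicator {-8..8} (z $ j)) = (indicator {z. \<forall>j. \<bar>z $ j\<bar> \<le> 8} z :: ennreal)" for z :: "real^'n"
  proof (cases "\<forall>j. \<bar>z $ j\<bar> \<le> 8")
    case True
    then have "z $ j \<in> {-8..8}" for j by (auto simp: abs_le_iff dest!: spec[of _ j])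
    then show ?thesis using True by simp
  next
    case False
    then obtain j where "\<not> \<bar>z $ j\<bar> \<le> 8" by auto
    then have "z $ j \<notin> {-8..8}" by auto
    then have "\<exists>j\<in>UNIV. indicator {-8..8} (z $ j) = (0::ennreal)" by (intro bexI[of _ j]) auto
    then show ?thesis using False by (subst prod_zero) auto
  qed
  have w: "ennreal (schur_weight k \<Lambda> z) = (\<Prod>b\<in>Basis. f b (z \<bullet> b))" for z
  proof -
    have "(\<Prod>b\<in>Basis. f b (z \<bullet> b)) = (\<Prod>j\<in>UNIV. f (axis j 1) (z $ j))"
      unfolding B by (subst prod.reindex[OF inj]) (simp add: inner_axis)
    also have "\<dots> = (\<Prod>j\<in>UNIV. ennreal (if j = k then f2 (z $ j) else f1 (z $ j))) * (\<Prod>j\<in>UNIV. indicator {-8..8} (z $ j))"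
      by (simp add: f_def axis_eq_axis prod.distrib)
    also have "(\<Prod>j\<in>UNIV. ennreal (if j = k then f2 (z $ j) else f1 (z $ j))) = ennreal (\<Prod>j\<in>UNIV. if j = k then f2 (z $ j) else f1 (z $ j))"
      using pos by (intro prod_ennreal) auto
    also have "(\<Prod>j\<in>UNIV. if j = k then f2 (z $ j) else f1 (z $ j)) = f2 (z $ k) * (\<Prod>j\<in>UNIV-{k}. f1 (z $ j))"
      by (subst prod.remove[of _ k]) (auto intro!: prod.cong)
    finally show ?thesis
      unfolding ind schur_weight_def f1_def f2_def
      by (simp add: indicator_def mult.commute)
  qed
  have i1: "(\<integral>\<^sup>+s. ennreal (f1 s) * indicator {-8..8} s \<partial>lborel) \<le> ennreal (16 / sqrt ?L)"
  proof -
    have "(\<integral>\<^sup>+s. ennreal (f1 s) * indicator {-8..8} s \<partial>lborel) \<le> ennreal (2 * (2 / ?L * sqrt (1 + ?L * 8) - 2 / ?L * sqrt (1 + ?L * 0)))"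
    proof (rule nn_integral_symmetric_interval)
      fix s :: real assume s: "0 \<le> s"
      have "1 + ?L * s > 0" using s L by (simp add: add_pos_nonneg)
      then have "DERIV (\<lambda>s. 2 / ?L * sqrt (1 + ?L * s)) s :> 1 / sqrt (1 + ?L * s)"
        using L by (auto intro!: derivative_eq_intros simp: field_simps)
      then show "DERIV (\<lambda>s. 2 / ?L * sqrt (1 + ?L * s)) s :> f1 s" using s by (simp add: f1_def)
    qed (auto simp: pos, simp add: f1_def)
    also have "\<dots> \<le> ennreal (16 / sqrt ?L)"
    proof (rule ennreal_leI)
      have "sqrt (1 + ?L * 8) \<le> 1 + sqrt (?L * 8)"
        using sqrt_add_le_add_sqrt[of 1 "?L * 8"] by simp
      also have "sqrt (?L * 8) \<le> 4 * sqrt ?L"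
      proof -
        have "sqrt (?L * 8) \<le> sqrt (?L * 4\<^sup>2)" using L by (intro real_sqrt_le_mono) simp
        then show ?thesis by (simp add: real_sqrt_mult)
      qed
      finally have "4 / ?L * (sqrt (1 + ?L * 8) - 1) \<le> 4 / ?L * (4 * sqrt ?L)"
        using L by (intro mult_left_mono) auto
      then have "2 * (2 / ?L * sqrt (1 + ?L * 8) - 2 / ?L * sqrt (1 + ?L * 0)) \<le> 4 / ?L * (4 * sqrt ?L)"
        by (simp add: right_diff_distrib)
      also have "\<dots> = 16 / sqrt ?L"
        using L by (simp add: field_simps)
      finally show "2 * (2 / ?L * sqrt (1 + ?L * 8) - 2 / ?L * sqrt (1 + ?L * 0)) \<le> 16 / sqrt ?L" .
    qed
    finally show ?thesis .
  qed
  have i2: "(\<integral>\<^sup>+s. ennreal (f2 s) * indicator {-8..8} s \<partial>lborel) \<le> ennreal (pi / ?L)"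
  proof -
    have "(\<integral>\<^sup>+s. ennreal (f2 s) * indicator {-8..8} s \<partial>lborel) \<le> ennreal (2 * (arctan (\<Lambda> * 8) / \<Lambda> - arctan (\<Lambda> * 0) / \<Lambda>))"
    proof (rule nn_integral_symmetric_interval)
      fix s :: real
      have "DERIV (\<lambda>s. arctan (\<Lambda> * s) / \<Lambda>) s :> (inverse (1 + (\<Lambda> * s)\<^sup>2) * \<Lambda>) / \<Lambda>"
        using \<Lambda> by (auto intro!: derivative_eq_intros)
      moreover have "(inverse (1 + (\<Lambda> * s)\<^sup>2) * \<Lambda>) / \<Lambda> = f2 s"
        using \<Lambda> by (simp add: f2_def inverse_eq_divide)
      ultimately show "DERIV (\<lambda>s. arctan (\<Lambda> * s) / \<Lambda>) s :> f2 s" by metis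
    qed (auto simp: pos, simp add: f2_def)
    also have "\<dots> \<le> ennreal (pi / ?L)"
    proof (rule ennreal_leI)
      have "\<bar>arctan (\<Lambda> * 8)\<bar> \<le> pi / 2" using arctan_lbound[of "\<Lambda> * 8"] arctan_ubound[of "\<Lambda> * 8"] by linarith
      then have "\<bar>arctan (\<Lambda> * 8) / \<Lambda>\<bar> \<le> pi / 2 / ?L" unfolding abs_divide using L by (intro divide_right_mono) auto
      then have "arctan (\<Lambda> * 8) / \<Lambda> \<le> pi / 2 / ?L" by (rule abs_le_D1)
      then show "2 * (arctan (\<Lambda> * 8) / \<Lambda> - arctan (\<Lambda> * 0) / \<Lambda>) \<le> pi / ?L" by (simp add: field_simps)
    qed
    finally show ?thesis .
  qed
  have "(\<integral>\<^sup>+z. ennreal (schur_weight k \<Lambda> z) \<partial>lborel) = (\<Prod>b\<in>Basis. \<integral>\<^sup>+s. f b s \<partial>lborel)"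
    unfolding w by (rule nn_integral_lborel_prod) auto
  also have "\<dots> = (\<Prod>j\<in>UNIV. \<integral>\<^sup>+s. f (axis j 1) s \<partial>lborel)"
    unfolding B by (subst prod.reindex[OF inj]) simp
  also have "\<dots> = (\<integral>\<^sup>+s. ennreal (f2 s) * indicator {-8..8} s \<partial>lborel) * (\<Prod>j\<in>UNIV-{k}. \<integral>\<^sup>+s. ennreal (f1 s) * indicator {-8..8} s \<partial>lborel)"
  proof -
    have "(\<integral>\<^sup>+s. f (axis k 1) s \<partial>lborel) = (\<integral>\<^sup>+s. ennreal (f2 s) * indicator {-8..8} s \<partial>lborel)"
      by (intro nn_integral_cong) (simp add: f_def)
    moreover have "(\<Prod>j\<in>UNIV-{k}. \<integral>\<^sup>+s. f (axis j 1) s \<partial>lborel) = (\<Prod>j\<in>UNIV-{k}. \<integral>\<^sup>+s. ennreal (f1 s) * indicator {-8..8} s \<partial>lborel)"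
      by (intro prod.cong nn_integral_cong) (auto simp: f_def axis_eq_axis)
    moreover have "(\<Prod>j\<in>UNIV. \<integral>\<^sup>+s. f (axis j 1) s \<partial>lborel) = (\<integral>\<^sup>+s. f (axis k 1) s \<partial>lborel) * (\<Prod>j\<in>UNIV-{k}. \<integral>\<^sup>+s. f (axis j 1) s \<partial>lborel)"
      by (rule prod.remove) auto
    ultimately show ?thesis by (simp only:)
  qed
  also have "\<dots> \<le> ennreal (pi / ?L) * (\<Prod>j\<in>UNIV-{k}. ennreal (16 / sqrt ?L))"
    by (intro mult_mono i2 prod_mono_ennreal i1) auto
  also have "\<dots> = ennreal ((16 / sqrt ?L) ^ (CARD('n) - 1) * (pi / ?L))"
    using L by (simp add: ennreal_power ennreal_mult[symmetric] mult.commute)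
  finally show ?thesis .
qed

section \<open>Schur's test for an operator composed with its adjoint\<close>

lemma nn_integral_reflect:
  fixes w :: "'a::euclidean_space \<Rightarrow> ennreal"
  assumes [measurable]: "w \<in> borel_measurable borel"
  shows "(\<integral>\<^sup>+y. w (x - y) \<partial>lborel) = (\<integral>\<^sup>+y. w y \<partial>lborel)"
    and "(\<integral>\<^sup>+y. w (y - x) \<partial>lborel) = (\<integral>\<^sup>+y. w y \<partial>lborel)"
proof -
  have "(\<integral>\<^sup>+y. w y \<partial>lborel) = (\<integral>\<^sup>+y. w y \<partial>density (distr lborel borel (\<lambda>y. x + (-1) *\<^sub>R y)) (\<lambda>_. ennreal (\<bar>-1 :: real\<bar> ^ DIM('a))))"
    by (subst lborel_affine[of "-1" x, symmetric]) auto
  also have "\<dots> = (\<integral>\<^sup>+y. w (x - y) \<partial>lborel)"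
    by (subst nn_integral_density) (auto simp: nn_integral_distr)
  finally show "(\<integral>\<^sup>+y. w (x - y) \<partial>lborel) = (\<integral>\<^sup>+y. w y \<partial>lborel)" by simp
  have "(\<integral>\<^sup>+y. w y \<partial>lborel) = (\<integral>\<^sup>+y. w y \<partial>distr lborel borel ((+) (-x)))"
    by (simp add: lborel_distr_plus)
  also have "\<dots> = (\<integral>\<^sup>+y. w (y - x) \<partial>lborel)"
    by (subst nn_integral_distr) auto
  finally show "(\<integral>\<^sup>+y. w (y - x) \<partial>lborel) = (\<integral>\<^sup>+y. w y \<partial>lborel)" by simp
qed

lemma borel_measurable_cnj [measurable (raw)]:
  "u \<in> borel_measurable M \<Longrightarrow> (\<lambda>z. cnj (u z)) \<in> borel_measurable M"
  by (rule measurable_compose[where g=cnj]) (auto intro!: borel_measurable_continuous_onI continuous_intros)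

lemma borel_measurable_cis [measurable (raw)]:
  "u \<in> borel_measurable M \<Longrightarrow> (\<lambda>z. cis (u z)) \<in> borel_measurable M"
  by (rule measurable_compose[where g=cis]) (auto intro!: borel_measurable_continuous_onI continuous_intros)

text \<open>This crude inequality shows that a square integrable function is locally integrable with an explicit majorant, which is all that the
applications of Fubini's theorem and of dominated convergence below require.\<close>

lemma norm_le_one_plus_square: "norm z \<le> 1 + (norm z)\<^sup>2"
proof -
  have "0 \<le> (norm z - 1)\<^sup>2 + (norm z)\<^sup>2 + 1" by simp
  then show ?thesis by (simp add: power2_eq_square algebra_simps)
qed

lemma integrable_square_majorant:
  fixes f :: "'a::euclidean_space \<Rightarrow> complex"
  assumes "integrable lborel (\<lambda>y. (norm (f y))\<^sup>2)"
  shows "integrable lborel (\<lambda>y. indicator (cball c D) y * (1 + (norm (f y))\<^sup>2))"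
proof -
  have "integrable lborel (\<lambda>y. indicator (cball c D) y * (norm (f y))\<^sup>2)"
    using integrable_mult_indicator[OF _ assms, of "cball c D"] by simp
  moreover have "integrable lborel (indicator (cball c D) :: 'a \<Rightarrow> real)"
    using emeasure_lborel_cball_finite[of c D] by (intro integrable_real_indicator) (auto simp: top.not_eq_extremum)
  ultimately have "integrable lborel (\<lambda>y. indicator (cball c D) y + indicator (cball c D) y * (norm (f y))\<^sup>2)"
    by (intro Bochner_Integration.integrable_add)
  then show ?thesis by (simp add: distrib_left)
qed

lemma integrable_pair_bound:
  fixes F :: "'a::euclidean_space \<times> 'b::euclidean_space \<Rightarrow> complex"
  assumes [measurable]: "F \<in> borel_measurable (lborel \<Otimes>\<^sub>M lborel)"
    and p: "integrable lborel p" and q: "integrable lborel q"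
    and bd: "\<And>x y. norm (F (x, y)) \<le> p x * q y"
  shows "integrable (lborel \<Otimes>\<^sub>M lborel) F"
proof (rule Bochner_Integration.integrable_bound)
  have [measurable]: "p \<in> borel_measurable borel" "q \<in> borel_measurable borel" using p q by auto
  show "integrable (lborel \<Otimes>\<^sub>M lborel) (\<lambda>(x, y). p x * q y)"
  proof (rule lborel_pair.Fubini_integrable)
    show "(\<lambda>(x, y). p x * q y) \<in> borel_measurable (lborel \<Otimes>\<^sub>M lborel)" by measurable
    show "integrable lborel (\<lambda>x. \<integral>y. norm (case (x, y) of (x, y) \<Rightarrow> p x * q y) \<partial>lborel)"
      using p by (simp add: abs_mult)
    show "AE x in lborel. integrable lborel (\<lambda>y. case (x, y) of (x, y) \<Rightarrow> p x * q y)"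
      using q by simp
  qed
  show "AE z in lborel \<Otimes>\<^sub>M lborel. norm (F z) \<le> norm (case z of (x, y) \<Rightarrow> p x * q y)"
    using bd by (auto intro!: AE_I2 order_trans[OF bd])
qed fact

text \<open>By \<open>2 g(x) g(x') \<le> g(x)\<^sup>2 + g(x')\<^sup>2\<close> the kernel is integrated in one variable while the other is fixed.\<close>

lemma schur_test_quadratic_form:
  fixes g :: "'a::euclidean_space \<Rightarrow> real" and w :: "'a \<Rightarrow> real"
  assumes [measurable]: "g \<in> borel_measurable borel" "w \<in> borel_measurable borel"
    and w0: "\<And>z. 0 \<le> w z" and g0: "\<And>x. 0 \<le> g x"
    and A: "(\<integral>\<^sup>+z. ennreal (w z) \<partial>lborel) \<le> A"
  shows "(\<integral>\<^sup>+x. \<integral>\<^sup>+x'. ennreal (g x * g x' * w (x - x')) \<partial>lborel \<partial>lborel) \<le> A * (\<integral>\<^sup>+x. ennreal ((g x)\<^sup>2) \<partial>lborel)"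
proof -
  let ?G = "\<integral>\<^sup>+x. ennreal ((g x)\<^sup>2) \<partial>lborel"
  let ?W = "\<lambda>z. ennreal (w z)"
  have "ennreal (g x * g x' * w (x - x')) \<le> ennreal ((g x)\<^sup>2 / 2) * ?W (x - x') + ennreal ((g x')\<^sup>2 / 2) * ?W (x - x')" for x x'
  proof -
    have "0 \<le> (g x - g x')\<^sup>2" by simp
    then have "g x * g x' \<le> (g x)\<^sup>2 / 2 + (g x')\<^sup>2 / 2" by (simp add: power2_eq_square algebra_simps)
    then have "g x * g x' * w (x - x') \<le> ((g x)\<^sup>2 / 2 + (g x')\<^sup>2 / 2) * w (x - x')" by (intro mult_right_mono w0)
    then show ?thesis
      using w0 by (simp add: ennreal_mult[symmetric] ennreal_plus[symmetric] algebra_simps ennreal_leI del: ennreal_plus)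
  qed
  then have "(\<integral>\<^sup>+x. \<integral>\<^sup>+x'. ennreal (g x * g x' * w (x - x')) \<partial>lborel \<partial>lborel)
     \<le> (\<integral>\<^sup>+x. \<integral>\<^sup>+x'. ennreal ((g x)\<^sup>2 / 2) * ?W (x - x') + ennreal ((g x')\<^sup>2 / 2) * ?W (x - x') \<partial>lborel \<partial>lborel)"
    by (intro nn_integral_mono)
  also have "\<dots> = (\<integral>\<^sup>+x. \<integral>\<^sup>+x'. ennreal ((g x)\<^sup>2 / 2) * ?W (x - x') \<partial>lborel \<partial>lborel)
      + (\<integral>\<^sup>+x. \<integral>\<^sup>+x'. ennreal ((g x')\<^sup>2 / 2) * ?W (x - x') \<partial>lborel \<partial>lborel)"
    by (simp add: nn_integral_add)
  also have "(\<integral>\<^sup>+x. \<integral>\<^sup>+x'. ennreal ((g x')\<^sup>2 / 2) * ?W (x - x') \<partial>lborel \<partial>lborel)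
      = (\<integral>\<^sup>+x'. \<integral>\<^sup>+x. ennreal ((g x')\<^sup>2 / 2) * ?W (x - x') \<partial>lborel \<partial>lborel)"
    by (rule lborel_pair.Fubini') measurable
  also have "(\<integral>\<^sup>+x'. \<integral>\<^sup>+x. ennreal ((g x')\<^sup>2 / 2) * ?W (x - x') \<partial>lborel \<partial>lborel)
      = (\<integral>\<^sup>+x'. ennreal ((g x')\<^sup>2 / 2) * (\<integral>\<^sup>+z. ?W z \<partial>lborel) \<partial>lborel)"
    by (simp add: nn_integral_cmult nn_integral_reflect(2)[of ?W])
  also have "(\<integral>\<^sup>+x. \<integral>\<^sup>+x'. ennreal ((g x)\<^sup>2 / 2) * ?W (x - x') \<partial>lborel \<partial>lborel)
      = (\<integral>\<^sup>+x. ennreal ((g x)\<^sup>2 / 2) * (\<integral>\<^sup>+z. ?W z \<partial>lborel) \<partial>lborel)"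
    by (simp add: nn_integral_cmult nn_integral_reflect(1)[of ?W])
  also have "(\<integral>\<^sup>+x. ennreal ((g x)\<^sup>2 / 2) * (\<integral>\<^sup>+z. ?W z \<partial>lborel) \<partial>lborel) + (\<integral>\<^sup>+x'. ennreal ((g x')\<^sup>2 / 2) * (\<integral>\<^sup>+z. ?W z \<partial>lborel) \<partial>lborel)
     = (\<integral>\<^sup>+x. ennreal ((g x)\<^sup>2) * (\<integral>\<^sup>+z. ?W z \<partial>lborel) \<partial>lborel)"
    by (subst nn_integral_add[symmetric])
       (auto intro!: nn_integral_cong simp: distrib_right[symmetric] ennreal_plus[symmetric] simp del: ennreal_plus)
  also have "\<dots> = (\<integral>\<^sup>+z. ?W z \<partial>lborel) * ?G"
    by (subst nn_integral_multc) (auto simp: mult.commute)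
  also have "\<dots> \<le> A * ?G" by (intro mult_right_mono A) simp
  finally show ?thesis .
qed

text \<open>Let \<open>T f(x) = \<integral> K(x, y) f(y) dy\<close>, let \<open>g\<close> be the restriction of \<open>T f\<close> to a ball, and let \<open>h = T\<^sup>* g\<close>. Then
\<open>\<parallel>g\<parallel>\<^sup>2 = \<langle>f, h\<rangle>\<close>, while \<open>\<parallel>h\<parallel>\<^sup>2\<close> is the quadratic form of \<open>T T\<^sup>*\<close> at \<open>g\<close>, at most \<open>A \<parallel>g\<parallel>\<^sup>2\<close>
by Schur's test. From \<open>2 \<parallel>g\<parallel>\<^sup>2 \<le> A \<parallel>f\<parallel>\<^sup>2 + \<parallel>h\<parallel>\<^sup>2 / A\<close> the term \<open>\<parallel>g\<parallel>\<^sup>2\<close> can be absorbed, since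
it is finite on a ball; then the radius tends to infinity.\<close>

lemma TT_star_bound:
  fixes K :: "'a::euclidean_space \<Rightarrow> 'a \<Rightarrow> complex" and f :: "'a \<Rightarrow> complex" and w :: "'a \<Rightarrow> real"
  assumes Km[measurable]: "(\<lambda>(x, y). K x y) \<in> borel_measurable (borel \<Otimes>\<^sub>M borel)"
    and KM: "\<And>x y. norm (K x y) \<le> M"
    and KD: "\<And>x y. K x y \<noteq> 0 \<Longrightarrow> norm (x - y) \<le> D"
    and wm[measurable]: "w \<in> borel_measurable borel" and w0: "\<And>z. 0 \<le> w z"
    and KK: "\<And>x x'. norm (\<integral>y. K x y * cnj (K x' y) \<partial>lborel) \<le> w (x - x')"
    and A: "(\<integral>\<^sup>+z. ennreal (w z) \<partial>lborel) \<le> ennreal A" and A0: "A > 0"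
    and fm[measurable]: "f \<in> borel_measurable borel"
    and f2: "integrable lborel (\<lambda>y. (norm (f y))\<^sup>2)"
  shows "(\<integral>\<^sup>+x. ennreal ((norm (\<integral>y. K x y * f y \<partial>lborel))\<^sup>2) \<partial>lborel) \<le> ennreal (A * (\<integral>y. (norm (f y))\<^sup>2 \<partial>lborel))"
proof -
  have [measurable (raw)]: "(\<lambda>z. K (u z) (v z)) \<in> borel_measurable N"
    if "u \<in> borel_measurable N" "v \<in> borel_measurable N" for u v and N :: "('a \<times> 'a) measure"
    using measurable_compose[OF measurable_Pair[OF that] Km] by simp
  define T where "T x = (\<integral>y. K x y * f y \<partial>lborel)" for x
  have Tm[measurable]: "T \<in> borel_measurable borel"
    unfolding T_def by measurable
  have M0: "M \<ge> 0" using KM[of undefined undefined] norm_ge_zero order_trans by blast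
  have ball: "(\<integral>\<^sup>+x. ennreal ((norm (T x))\<^sup>2) * indicator (cball 0 (real m)) x \<partial>lborel) \<le> ennreal (A * (\<integral>y. (norm (f y))\<^sup>2 \<partial>lborel))" for m
  proof -
    define R where "R = real m"
    let ?B = "cball 0 R :: 'a set" and ?B' = "cball 0 (R + D) :: 'a set"
    have [measurable]: "?B \<in> sets borel" "?B' \<in> sets borel" by auto
    define q where "q y = indicator ?B' y * (1 + (norm (f y))\<^sup>2)" for y
    have qm[measurable]: "q \<in> borel_measurable borel" unfolding q_def by measurable
    have fin: "emeasure lborel (cball (0::'a) s) < \<infinity>" for s using emeasure_lborel_cball_finite[of 0 s] by (simp add: top.not_eq_extremum)
    have iB: "integrable lborel (indicator (cball 0 s) :: 'a \<Rightarrow> real)" for s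
      using fin[of s] by (intro integrable_real_indicator) auto
    have iq: "integrable lborel q"
      unfolding q_def by (rule integrable_square_majorant[OF f2])
    have q0: "q y \<ge> 0" for y by (simp add: q_def)
    have B': "y \<in> ?B'" if "x \<in> ?B" "K x y \<noteq> 0" for x y
    proof -
      have "norm y \<le> norm x + norm (x - y)" by (metis norm_triangle_sub norm_minus_commute add.commute)
      then show ?thesis using that KD[OF that(2)] by simp
    qed
    have Kf: "norm (K x y * f y) \<le> M * q y" if "x \<in> ?B" for x y
    proof (cases "K x y = 0")
      case True
      then show ?thesis using M0 q0 by simp
    next
      case False
      then show ?thesis using B'[OF that False] KM[of x y] norm_le_one_plus_square[of "f y"] M0
        by (auto simp: norm_mult q_def intro!: mult_mono)
    qed
    define N where "N = M * (\<integral>y. q y \<partial>lborel)"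
    have N0: "N \<ge> 0" unfolding N_def using M0 q0 by (intro mult_nonneg_nonneg Bochner_Integration.integral_nonneg) auto
    have TN: "norm (T x) \<le> N" if "x \<in> ?B" for x
    proof -
      have "norm (T x) \<le> (\<integral>y. M * q y \<partial>lborel)"
        unfolding T_def
      proof (rule order_trans[OF integral_norm_bound integral_mono])
        show "integrable lborel (\<lambda>y. M * q y)" using iq by simp
        then show "integrable lborel (\<lambda>y. norm (K x y * f y))"
          by (rule Bochner_Integration.integrable_bound) (use Kf[OF that] M0 q0 in auto)
      qed (use Kf[OF that] in auto)
      then show ?thesis by (simp add: N_def)
    qed
    define g where "g x = indicator ?B x * T x" for x
    have gm[measurable]: "g \<in> borel_measurable borel" unfolding g_def by measurable
    have gN: "norm (g x) \<le> N * indicator ?B x" for x using TN[of x] N0 by (auto simp: g_def indicator_def)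
    have gN': "norm (g x) \<le> N" for x using TN[of x] N0 by (cases "x \<in> ?B") (auto simp: g_def)
    have ig2: "integrable lborel (\<lambda>x. (norm (g x))\<^sup>2)"
    proof (rule Bochner_Integration.integrable_bound)
      show "integrable lborel (\<lambda>x. N\<^sup>2 * indicator ?B x)" using iB by (intro integrable_mult_right)
      have "(norm (g x))\<^sup>2 \<le> N\<^sup>2 * indicator ?B x" for x
        using power_mono[OF gN[of x], of 2] by (cases "x \<in> ?B") auto
      then show "AE x in lborel. norm ((norm (g x))\<^sup>2) \<le> norm (N\<^sup>2 * indicator ?B x)" by simp
    qed measurable
    define I where "I = (\<integral>x. (norm (g x))\<^sup>2 \<partial>lborel)"
    have I0: "I \<ge> 0" unfolding I_def by (intro Bochner_Integration.integral_nonneg) auto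
    define h where "h y = (\<integral>x. cnj (K x y) * g x \<partial>lborel)" for y
    have hm[measurable]: "h \<in> borel_measurable borel" unfolding h_def by measurable
    have Kg: "norm (cnj (K x y) * g x) \<le> (M * N * indicator ?B x) * indicator ?B' y" for x y
    proof (cases "cnj (K x y) * g x = 0")
      case True
      then show ?thesis using M0 N0 by (simp only: norm_zero) simp
    next
      case False
      then have "x \<in> ?B" "y \<in> ?B'" using B'[of x y] by (auto simp: g_def indicator_def split: if_splits)
      then show ?thesis using KM[of x y] gN'[of x] M0 by (auto simp: norm_mult intro!: mult_mono)
    qed
    define N' where "N' = (\<integral>x. M * N * indicator ?B x \<partial>(lborel :: 'a measure))"
    have iMN: "integrable lborel (\<lambda>x. M * N * indicator ?B x)" using iB by (intro integrable_mult_right)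
    have iKg: "integrable lborel (\<lambda>x. cnj (K x y) * g x)" for y
    proof (rule Bochner_Integration.integrable_bound[OF iMN])
      have "norm (cnj (K x y) * g x) \<le> M * N * indicator ?B x" for x
        by (rule order_trans[OF Kg]) (use M0 N0 in \<open>auto simp: indicator_def\<close>)
      then show "AE x in lborel. norm (cnj (K x y) * g x) \<le> norm (M * N * indicator ?B x)"
        using M0 N0 by simp
    qed measurable
    have N'0: "N' \<ge> 0" unfolding N'_def using M0 N0 by (intro Bochner_Integration.integral_nonneg) auto
    have hN: "norm (h y) \<le> N' * indicator ?B' y" for y
    proof -
      have "norm (h y) \<le> (\<integral>x. (M * N * indicator ?B x) * indicator ?B' y \<partial>lborel)"
        unfolding h_def
        by (rule order_trans[OF integral_norm_bound integral_mono]) (use iKg iMN Kg in auto)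
      then show ?thesis by (simp add: N'_def)
    qed
    have ih2: "integrable lborel (\<lambda>y. (norm (h y))\<^sup>2)"
    proof (rule Bochner_Integration.integrable_bound)
      show "integrable lborel (\<lambda>x. N'\<^sup>2 * indicator ?B' x)" using iB by (intro integrable_mult_right)
      have "(norm (h x))\<^sup>2 \<le> N'\<^sup>2 * indicator ?B' x" for x
        using power_mono[OF hN[of x], of 2] by (cases "x \<in> ?B'") auto
      then show "AE x in lborel. norm ((norm (h x))\<^sup>2) \<le> norm (N'\<^sup>2 * indicator ?B' x)" by simp
    qed measurable
    have step1: "of_real I = (\<integral>y. f y * cnj (h y) \<partial>lborel)"
    proof -
      have F1: "integrable (lborel \<Otimes>\<^sub>M lborel) (\<lambda>(x, y). K x y * f y * cnj (g x))"
      proof (rule integrable_pair_bound[OF _ iMN iq])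
        fix x y
        show "norm (case (x, y) of (x, y) \<Rightarrow> K x y * f y * cnj (g x)) \<le> M * N * indicator ?B x * q y"
        proof (cases "x \<in> ?B")
          case True
          have "norm (K x y * f y) * norm (g x) \<le> (M * q y) * N"
            using Kf[OF True] gN'[of x] M0 q0 by (intro mult_mono) auto
          then show ?thesis using True by (simp add: norm_mult ac_simps)
        next
          case False
          then show ?thesis by (simp add: g_def)
        qed
      qed measurable
      have "of_real I = (\<integral>x. of_real ((norm (g x))\<^sup>2) \<partial>lborel :: complex)"
        unfolding I_def by (rule integral_complex_of_real[symmetric])
      also have "\<dots> = (\<integral>x. T x * cnj (g x) \<partial>lborel)"
        by (intro Bochner_Integration.integral_cong) (auto simp: g_def indicator_def complex_norm_square simp del: of_real_power)
      also have "\<dots> = (\<integral>x. \<integral>y. K x y * f y * cnj (g x) \<partial>lborel \<partial>lborel)"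
        unfolding T_def by (simp only: integral_mult_left_zero)
      also have "\<dots> = (\<integral>y. \<integral>x. K x y * f y * cnj (g x) \<partial>lborel \<partial>lborel)"
        by (rule lborel_pair.Fubini_integral[OF F1, symmetric])
      also have "\<dots> = (\<integral>y. f y * cnj (h y) \<partial>lborel)"
      proof (intro Bochner_Integration.integral_cong refl)
        fix y
        have "cnj (h y) = (\<integral>x. K x y * cnj (g x) \<partial>lborel)"
          unfolding h_def using Bochner_Integration.integral_cnj[of lborel "\<lambda>x. cnj (K x y) * g x"] by simp
        moreover have "(\<lambda>x. K x y * f y * cnj (g x)) = (\<lambda>x. f y * (K x y * cnj (g x)))"
          by (simp add: fun_eq_iff)
        ultimately show "(\<integral>x. K x y * f y * cnj (g x) \<partial>lborel) = f y * cnj (h y)"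
          by (simp only: integral_mult_right_zero)
      qed
      finally show ?thesis .
    qed
    have step2: "2 * I \<le> A * (\<integral>y. (norm (f y))\<^sup>2 \<partial>lborel) + (\<integral>y. (norm (h y))\<^sup>2 \<partial>lborel) / A"
    proof -
      have pt: "norm (f y * cnj (h y)) \<le> (A * (norm (f y))\<^sup>2 + (norm (h y))\<^sup>2 / A) / 2" for y
      proof -
        have "0 \<le> (A * norm (f y) - norm (h y))\<^sup>2 / A" using A0 by simp
        also have "\<dots> = A * (norm (f y))\<^sup>2 + (norm (h y))\<^sup>2 / A - 2 * (norm (f y) * norm (h y))"
          using A0 by (simp add: power2_eq_square field_simps)
        finally show ?thesis by (simp add: norm_mult)
      qed
      have "I = norm (of_real I :: complex)" using I0 by simp
      also have "\<dots> \<le> (\<integral>y. (A * (norm (f y))\<^sup>2 + (norm (h y))\<^sup>2 / A) / 2 \<partial>lborel)"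
        unfolding step1
      proof (rule order_trans[OF integral_norm_bound integral_mono])
        show i: "integrable lborel (\<lambda>y. (A * (norm (f y))\<^sup>2 + (norm (h y))\<^sup>2 / A) / 2)"
          using f2 ih2 by simp
        show "integrable lborel (\<lambda>y. norm (f y * cnj (h y)))"
          by (rule Bochner_Integration.integrable_bound[OF i]) (auto intro!: AE_I2 order_trans[OF pt[simplified]] )
      qed (use pt in auto)
      also have "\<dots> = (A * (\<integral>y. (norm (f y))\<^sup>2 \<partial>lborel) + (\<integral>y. (norm (h y))\<^sup>2 \<partial>lborel) / A) / 2"
        using f2 ih2 by simp
      finally show ?thesis by simp
    qed
    have step3: "ennreal (\<integral>y. (norm (h y))\<^sup>2 \<partial>lborel) \<le> ennreal A * ennreal I"
    proof -
      have F2: "integrable (lborel \<Otimes>\<^sub>M lborel) (\<lambda>(x, y). cnj (h y) * (cnj (K x y) * g x))"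
      proof (rule integrable_pair_bound[OF _ iMN])
        show "integrable lborel (\<lambda>y. N' * indicator ?B' y)" using iB by (intro integrable_mult_right)
        fix x y
        have "norm (h y) * norm (cnj (K x y) * g x) \<le> (N' * indicator ?B' y) * (M * N * indicator ?B x * indicator ?B' y)"
          using hN Kg N'0 by (intro mult_mono) auto
        then show "norm (case (x, y) of (x, y) \<Rightarrow> cnj (h y) * (cnj (K x y) * g x)) \<le> M * N * indicator ?B x * (N' * indicator ?B' y)"
          by (auto simp: norm_mult indicator_def ac_simps split: if_splits)
      qed measurable
      have F3: "integrable (lborel \<Otimes>\<^sub>M lborel) (\<lambda>(x', y). cnj (g x') * (K x' y * cnj (K x y)))" for x
      proof (rule integrable_pair_bound[OF _ iMN])
        show "integrable lborel (\<lambda>y. M * indicator ?B' y)" using iB by (intro integrable_mult_right)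
        fix x' y
        have "norm (cnj (K x' y) * g x') * norm (K x y) \<le> (M * N * indicator ?B x' * indicator ?B' y) * M"
          using KM[of x y] Kg[of x' y] M0 N0 by (intro mult_mono) auto
        then show "norm (case (x', y) of (x', y) \<Rightarrow> cnj (g x') * (K x' y * cnj (K x y))) \<le> M * N * indicator ?B x' * (M * indicator ?B' y)"
          by (simp add: norm_mult ac_simps)
      qed measurable
      define Q where "Q x = (\<integral>y. cnj (h y) * cnj (K x y) \<partial>lborel)" for x
      have Q: "Q x = (\<integral>x'. cnj (g x') * (\<integral>y. K x' y * cnj (K x y) \<partial>lborel) \<partial>lborel)" for x
      proof -
        have "Q x = (\<integral>y. \<integral>x'. cnj (g x') * (K x' y * cnj (K x y)) \<partial>lborel \<partial>lborel)"
          unfolding Q_def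
        proof (intro Bochner_Integration.integral_cong refl)
          fix y
          have "cnj (h y) = (\<integral>x'. K x' y * cnj (g x') \<partial>lborel)"
            unfolding h_def using Bochner_Integration.integral_cnj[of lborel "\<lambda>x. cnj (K x y) * g x"] by simp
          moreover have "(\<lambda>x'. cnj (g x') * (K x' y * cnj (K x y))) = (\<lambda>x'. (K x' y * cnj (g x')) * cnj (K x y))"
            by (simp add: fun_eq_iff)
          ultimately show "cnj (h y) * cnj (K x y) = (\<integral>x'. cnj (g x') * (K x' y * cnj (K x y)) \<partial>lborel)"
            by (simp only: integral_mult_left_zero)
        qed
        also have "\<dots> = (\<integral>x'. \<integral>y. cnj (g x') * (K x' y * cnj (K x y)) \<partial>lborel \<partial>lborel)"
          by (rule lborel_pair.Fubini_integral[OF F3])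
        finally show ?thesis by simp
      qed
      have Qb: "ennreal (norm (Q x)) \<le> (\<integral>\<^sup>+x'. ennreal (norm (g x') * w (x' - x)) \<partial>lborel)" for x
      proof -
        have "integrable lborel (\<lambda>x'. \<integral>y. cnj (g x') * (K x' y * cnj (K x y)) \<partial>lborel)"
          by (rule lborel_pair.integrable_fst[OF F3])
        then have "integrable lborel (\<lambda>x'. cnj (g x') * (\<integral>y. K x' y * cnj (K x y) \<partial>lborel))" by simp
        then have "ennreal (norm (Q x)) \<le> (\<integral>\<^sup>+x'. ennreal (norm (cnj (g x') * (\<integral>y. K x' y * cnj (K x y) \<partial>lborel))) \<partial>lborel)"
          unfolding Q by (rule integral_norm_bound_ennreal)
        also have "\<dots> \<le> (\<integral>\<^sup>+x'. ennreal (norm (g x') * w (x' - x)) \<partial>lborel)"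
          by (intro nn_integral_mono ennreal_leI) (auto simp: norm_mult intro!: mult_left_mono KK)
        finally show ?thesis .
      qed
      have gQ: "(\<integral>y. cnj (h y) * (cnj (K x y) * g x) \<partial>lborel) = g x * Q x" for x
      proof -
        have "(\<lambda>y. cnj (h y) * (cnj (K x y) * g x)) = (\<lambda>y. g x * (cnj (h y) * cnj (K x y)))"
          by (simp add: fun_eq_iff)
        then show ?thesis unfolding Q_def by (simp only: integral_mult_right_zero)
      qed
      have "(of_real (\<integral>y. (norm (h y))\<^sup>2 \<partial>lborel) :: complex) = (\<integral>y. of_real ((norm (h y))\<^sup>2) \<partial>lborel)"
        by (rule integral_complex_of_real[symmetric])
      also have "\<dots> = (\<integral>y. cnj (h y) * h y \<partial>lborel)"
        by (intro Bochner_Integration.integral_cong) (auto simp: complex_norm_square mult.commute simp del: of_real_power)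
      also have "\<dots> = (\<integral>y. \<integral>x. cnj (h y) * (cnj (K x y) * g x) \<partial>lborel \<partial>lborel)"
        by (simp add: h_def)
      also have "\<dots> = (\<integral>x. \<integral>y. cnj (h y) * (cnj (K x y) * g x) \<partial>lborel \<partial>lborel)"
        by (rule lborel_pair.Fubini_integral[OF F2])
      also have "\<dots> = (\<integral>x. g x * Q x \<partial>lborel)" by (simp only: gQ)
      finally have hQ: "(of_real (\<integral>y. (norm (h y))\<^sup>2 \<partial>lborel) :: complex) = (\<integral>x. g x * Q x \<partial>lborel)" .
      have igQ: "integrable lborel (\<lambda>x. g x * Q x)"
        using lborel_pair.integrable_fst[OF F2] by (simp only: gQ)
      have "ennreal (\<integral>y. (norm (h y))\<^sup>2 \<partial>lborel) = ennreal (norm (of_real (\<integral>y. (norm (h y))\<^sup>2 \<partial>lborel) :: complex))"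
        by simp
      also have "\<dots> \<le> (\<integral>\<^sup>+x. ennreal (norm (g x * Q x)) \<partial>lborel)"
        unfolding hQ using igQ by (rule integral_norm_bound_ennreal)
      also have "\<dots> \<le> (\<integral>\<^sup>+x. \<integral>\<^sup>+x'. ennreal (norm (g x) * norm (g x') * w (x' - x)) \<partial>lborel \<partial>lborel)"
      proof (rule nn_integral_mono)
        fix x
        have "ennreal (norm (g x * Q x)) = ennreal (norm (g x)) * ennreal (norm (Q x))" by (simp add: norm_mult ennreal_mult)
        also have "\<dots> \<le> ennreal (norm (g x)) * (\<integral>\<^sup>+x'. ennreal (norm (g x') * w (x' - x)) \<partial>lborel)"
          by (intro mult_left_mono Qb) auto
        also have "\<dots> = (\<integral>\<^sup>+x'. ennreal (norm (g x) * norm (g x') * w (x' - x)) \<partial>lborel)"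
          by (subst nn_integral_cmult[symmetric]) (auto simp: ennreal_mult[symmetric] w0 mult.assoc)
        finally show "ennreal (norm (g x * Q x)) \<le> (\<integral>\<^sup>+x'. ennreal (norm (g x) * norm (g x') * w (x' - x)) \<partial>lborel)" .
      qed
      also have "\<dots> = (\<integral>\<^sup>+x'. \<integral>\<^sup>+x. ennreal (norm (g x') * norm (g x) * w (x' - x)) \<partial>lborel \<partial>lborel)"
        by (subst lborel_pair.Fubini') (auto simp: mult.commute)
      also have "\<dots> \<le> ennreal A * (\<integral>\<^sup>+x. ennreal ((norm (g x))\<^sup>2) \<partial>lborel)"
        by (rule schur_test_quadratic_form) (use A w0 in auto)
      also have "(\<integral>\<^sup>+x. ennreal ((norm (g x))\<^sup>2) \<partial>lborel) = ennreal I"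
        unfolding I_def by (rule nn_integral_eq_integral[OF ig2]) auto
      finally show ?thesis .
    qed
    have "(\<integral>y. (norm (h y))\<^sup>2 \<partial>lborel) \<le> A * I"
      using step3 A0 I0 by (simp add: ennreal_mult[symmetric])
    then have "(\<integral>y. (norm (h y))\<^sup>2 \<partial>lborel) / A \<le> I" using A0 by (simp add: field_simps)
    then have "I \<le> A * (\<integral>y. (norm (f y))\<^sup>2 \<partial>lborel)" using step2 by linarith
    moreover have "(\<integral>\<^sup>+x. ennreal ((norm (T x))\<^sup>2) * indicator ?B x \<partial>lborel) = ennreal I"
    proof -
      have "(\<integral>\<^sup>+x. ennreal ((norm (T x))\<^sup>2) * indicator ?B x \<partial>lborel) = (\<integral>\<^sup>+x. ennreal ((norm (g x))\<^sup>2) \<partial>lborel)"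
        by (intro nn_integral_cong) (auto simp: g_def indicator_def)
      also have "\<dots> = ennreal I" unfolding I_def by (rule nn_integral_eq_integral[OF ig2]) auto
      finally show ?thesis .
    qed
    ultimately show ?thesis by (simp add: R_def ennreal_leI)
  qed
  have sup: "(SUP m. ennreal ((norm (T x))\<^sup>2) * indicator (cball 0 (real m)) x) = ennreal ((norm (T x))\<^sup>2)" for x
  proof (rule antisym)
    show "(SUP m. ennreal ((norm (T x))\<^sup>2) * indicator (cball 0 (real m)) x) \<le> ennreal ((norm (T x))\<^sup>2)"
      by (intro SUP_least) (auto simp: indicator_def)
    obtain m where "norm x \<le> real m" using real_arch_simple by blast
    then show "ennreal ((norm (T x))\<^sup>2) \<le> (SUP m. ennreal ((norm (T x))\<^sup>2) * indicator (cball 0 (real m)) x)"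
      by (intro SUP_upper2[of m]) auto
  qed
  have [measurable]: "cball (0::'a) s \<in> sets borel" for s by auto
  have "(\<integral>\<^sup>+x. (SUP m. ennreal ((norm (T x))\<^sup>2) * indicator (cball 0 (real m)) x) \<partial>lborel)
      = (SUP m. \<integral>\<^sup>+x. ennreal ((norm (T x))\<^sup>2) * indicator (cball 0 (real m)) x \<partial>lborel)"
  proof (rule nn_integral_monotone_convergence_SUP)
    show "incseq (\<lambda>m x. ennreal ((norm (T x))\<^sup>2) * indicator (cball 0 (real m)) x)"
      by (auto simp: incseq_def le_fun_def indicator_def intro!: mult_left_mono)
  qed measurable
  also have "\<dots> \<le> ennreal (A * (\<integral>y. (norm (f y))\<^sup>2 \<partial>lborel))"
    by (intro SUP_least ball)
  finally show ?thesis unfolding sup unfolding T_def .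
qed

section \<open>The maximal bound at a fixed frequency\<close>

lemma borel_measurable_vec_nth [measurable (raw)]:
  fixes u :: "'z \<Rightarrow> real^'n"
  shows "u \<in> borel_measurable N \<Longrightarrow> (\<lambda>z. u z $ j) \<in> borel_measurable N"
  by (rule measurable_compose[where g="\<lambda>x. x $ j"]) (auto intro!: borel_measurable_continuous_onI continuous_intros)

lemma borel_measurable_rescale [measurable (raw)]:
  fixes u r :: "'z \<Rightarrow> real^'n"
  assumes [measurable]: "r \<in> borel_measurable N" "u \<in> borel_measurable N"
  shows "(\<lambda>z. rescale (r z) (u z)) \<in> borel_measurable N"
proof (subst borel_measurable_euclidean_space, safe)
  fix b :: "real^'n" assume "b \<in> Basis"
  then obtain j where b: "b = axis j 1" by (auto simp: Basis_vec_def)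
  show "(\<lambda>z. rescale (r z) (u z) \<bullet> b) \<in> borel_measurable N"
    unfolding b by (simp add: inner_axis rescale_def)
qed

lemma borel_measurable_wave [measurable (raw)]:
  fixes u r :: "'z \<Rightarrow> real^'n"
  assumes "\<psi> \<in> amplitude"
    and [measurable]: "L \<in> borel_measurable N" "r \<in> borel_measurable N" "u \<in> borel_measurable N"
  shows "(\<lambda>z. wave k \<psi> (L z) (r z) (u z)) \<in> borel_measurable N"
proof -
  have [measurable]: "\<psi> \<in> borel_measurable borel"
    using amplitude_continuous[OF assms(1)] by (rule borel_measurable_continuous_onI)
  show ?thesis unfolding wave_def normalized_form_def by measurable
qed

lemma wave_support:
  fixes u :: "real^'n"
  assumes "\<psi> \<in> amplitude" "r \<in> dyadic_box" "wave k \<psi> \<Lambda> r u \<noteq> 0"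
  shows "norm u \<le> norm (vec 4 :: real^'n)"
proof (rule norm_le_componentwise_cart)
  fix j
  show "norm (u $ j) \<le> norm ((vec 4 :: real^'n) $ j)"
    using rescale_bound[OF assms(2) amplitude_support[OF assms(1)], of u j] assms(3) by (simp add: wave_def)
qed

text \<open>This linearises a supremum over finitely many parameters: the maximising parameter becomes a function of \<open>x\<close>.\<close>

lemma measurable_finite_argmax:
  fixes H :: "'a::topological_space \<times> 'b::topological_space \<Rightarrow> real"
  assumes [measurable]: "H \<in> borel_measurable (borel \<Otimes>\<^sub>M borel)" and "finite R" "R \<noteq> {}"
  shows "\<exists>\<rho>. \<rho> \<in> borel_measurable borel \<and> (\<forall>x. \<rho> x \<in> R) \<and> (\<forall>x. \<forall>r\<in>R. H (x, r) \<le> H (x, \<rho> x))"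
  using assms(2,3)
proof (induction R rule: finite_ne_induct)
  case (singleton r)
  show ?case by (intro exI[of _ "\<lambda>x. r"]) auto
next
  case (insert r F)
  then obtain \<rho> where [measurable]: "\<rho> \<in> borel_measurable borel" and \<rho>: "\<forall>x. \<rho> x \<in> F" "\<forall>x. \<forall>r\<in>F. H (x, r) \<le> H (x, \<rho> x)"
    by blast
  show ?case
  proof (intro exI[of _ "\<lambda>x. if H (x, \<rho> x) \<le> H (x, r) then r else \<rho> x"] conjI allI ballI)
    show "(\<lambda>x. if H (x, \<rho> x) \<le> H (x, r) then r else \<rho> x) \<in> borel_measurable borel"
      by measurable
  qed (use \<rho> in \<open>auto intro: order_trans\<close>)
qed

definition wave_average :: "'n \<Rightarrow> ((real^'n) \<Rightarrow> complex) \<Rightarrow> real \<Rightarrow> real^'n \<Rightarrow> ((real^'n) \<Rightarrow> complex) \<Rightarrow> real^'n \<Rightarrow> complex" where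
  "wave_average k \<psi> \<Lambda> r f x = (\<integral>y. wave k \<psi> \<Lambda> r (x - y) * f y \<partial>lborel)"

lemma borel_measurable_wave_average [measurable (raw)]:
  fixes u r :: "'z \<Rightarrow> real^'n"
  assumes "\<psi> \<in> amplitude" "f \<in> borel_measurable borel"
    and "L \<in> borel_measurable N" "r \<in> borel_measurable N" "u \<in> borel_measurable N"
  shows "(\<lambda>z. wave_average k \<psi> (L z) (r z) f (u z)) \<in> borel_measurable N"
proof -
  note [measurable] = assms(2-) borel_measurable_wave[OF assms(1)]
  show ?thesis unfolding wave_average_def by measurable
qed

text \<open>With \<open>r = \<rho>(x)\<close> chosen to attain the maximum, \<open>TT_star_bound\<close> applies, because \<open>kernel_bound\<close> is
uniform in both dilations \<open>\<rho>(x)\<close> and \<open>\<rho>(x')\<close>.\<close>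

lemma fixed_frequency_maximal_bound:
  fixes \<psi> :: "(real^'n) \<Rightarrow> complex"
  assumes \<psi>: "\<psi> \<in> amplitude"
  obtains C where "C > 0"
    "\<And>\<Lambda> R f. \<Lambda> \<noteq> 0 \<Longrightarrow> finite R \<Longrightarrow> R \<noteq> {} \<Longrightarrow> R \<subseteq> dyadic_box \<Longrightarrow> f \<in> borel_measurable borel \<Longrightarrow>
       integrable lborel (\<lambda>y. (norm (f y))\<^sup>2) \<Longrightarrow>
       (\<integral>\<^sup>+x. (SUP r\<in>R. ennreal ((norm (wave_average k \<psi> \<Lambda> r f x))\<^sup>2)) \<partial>lborel)
         \<le> ennreal (C * ((16 / sqrt \<bar>\<Lambda>\<bar>) ^ (CARD('n) - 1) * (pi / \<bar>\<Lambda>\<bar>)) * (\<integral>y. (norm (f y))\<^sup>2 \<partial>lborel))"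
proof -
  obtain C0 where C0: "C0 \<ge> 0" "\<And>\<Lambda> r r' x x'. r \<in> dyadic_box \<Longrightarrow> r' \<in> dyadic_box \<Longrightarrow>
     norm (\<integral>y. wave k \<psi> \<Lambda> r (x - y) * cnj (wave k \<psi> \<Lambda> r' (x' - y)) \<partial>lborel) \<le> C0 * schur_weight k \<Lambda> (x - x')"
    using kernel_bound[OF \<psi>, of k] by blast
  obtain M where M: "M \<ge> 0" "\<And>u. norm (\<psi> u) \<le> M" using amplitude_bounded[OF \<psi>] by blast
  show ?thesis
  proof
    \<comment> \<open>\<open>C0 + 1\<close> is used because \<open>TT_star_bound\<close> needs a strictly positive bound.\<close>
    show "C0 + 1 > 0" using C0(1) by simp
    fix \<Lambda> :: real and R :: "(real^'n) set" and f :: "(real^'n) \<Rightarrow> complex"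
    assume \<Lambda>: "\<Lambda> \<noteq> 0" and R: "finite R" "R \<noteq> {}" "R \<subseteq> dyadic_box"
      and fm[measurable]: "f \<in> borel_measurable borel" and f2: "integrable lborel (\<lambda>y. (norm (f y))\<^sup>2)"
    note [measurable] = borel_measurable_wave_average[OF \<psi> fm] borel_measurable_wave[OF \<psi>]
    let ?H = "\<lambda>(x, r). norm (wave_average k \<psi> \<Lambda> r f x)"
    have "?H \<in> borel_measurable (borel \<Otimes>\<^sub>M borel)" by measurable
    from measurable_finite_argmax[OF this R(1,2)] obtain \<rho> where [measurable]: "\<rho> \<in> borel_measurable borel"
      and \<rho>: "\<And>x. \<rho> x \<in> R" "\<And>x r. r \<in> R \<Longrightarrow> norm (wave_average k \<psi> \<Lambda> r f x) \<le> norm (wave_average k \<psi> \<Lambda> (\<rho> x) f x)"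
      by auto
    have \<rho>b: "\<rho> x \<in> dyadic_box" for x using \<rho>(1) R(3) by auto
    define B where "B = (16 / sqrt \<bar>\<Lambda>\<bar>) ^ (CARD('n) - 1) * (pi / \<bar>\<Lambda>\<bar>)"
    have B0: "B > 0" using \<Lambda> by (simp add: B_def)
    have wm[measurable]: "schur_weight k \<Lambda> \<in> borel_measurable borel"
    proof -
      have "{z :: real^'n. \<forall>j. \<bar>z $ j\<bar> \<le> 8} = (\<Inter>j. {z. \<bar>z $ j\<bar> \<le> 8})" by auto
      moreover have "closed {z :: real^'n. \<bar>z $ j\<bar> \<le> 8}" for j
        by (intro closed_Collect_le continuous_intros)
      ultimately have "closed {z :: real^'n. \<forall>j. \<bar>z $ j\<bar> \<le> 8}" by auto
      then have [measurable]: "{z :: real^'n. \<forall>j. \<bar>z $ j\<bar> \<le> 8} \<in> sets borel" by auto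
      show ?thesis unfolding schur_weight_def by measurable
    qed
    have "(\<integral>\<^sup>+x. (SUP r\<in>R. ennreal ((norm (wave_average k \<psi> \<Lambda> r f x))\<^sup>2)) \<partial>lborel)
        \<le> (\<integral>\<^sup>+x. ennreal ((norm (wave_average k \<psi> \<Lambda> (\<rho> x) f x))\<^sup>2) \<partial>lborel)"
      by (intro nn_integral_mono SUP_least ennreal_leI power_mono \<rho>(2)) auto
    also have "\<dots> = (\<integral>\<^sup>+x. ennreal ((norm (\<integral>y. wave k \<psi> \<Lambda> (\<rho> x) (x - y) * f y \<partial>lborel))\<^sup>2) \<partial>lborel)"
      by (simp only: wave_average_def)
    also have "\<dots> \<le> ennreal (((C0 + 1) * B) * (\<integral>y. (norm (f y))\<^sup>2 \<partial>lborel))"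
    proof (rule TT_star_bound[where w="\<lambda>z. (C0 + 1) * schur_weight k \<Lambda> z" and M=M and D="norm (vec 4 :: real^'n)"])
      show "(\<lambda>(x, y). wave k \<psi> \<Lambda> (\<rho> x) (x - y)) \<in> borel_measurable (borel \<Otimes>\<^sub>M borel)"
        by measurable
      show "norm (wave k \<psi> \<Lambda> (\<rho> x) (x - y)) \<le> M" for x y
        using M by (simp add: wave_def norm_mult)
      show "norm (x - y) \<le> norm (vec 4 :: real^'n)" if "wave k \<psi> \<Lambda> (\<rho> x) (x - y) \<noteq> 0" for x y
        by (rule wave_support[OF \<psi> \<rho>b that])
      show "norm (\<integral>y. wave k \<psi> \<Lambda> (\<rho> x) (x - y) * cnj (wave k \<psi> \<Lambda> (\<rho> x') (x' - y)) \<partial>lborel) \<le> (C0 + 1) * schur_weight k \<Lambda> (x - x')" for x x'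
        using C0(2)[OF \<rho>b[of x] \<rho>b[of x'], of \<Lambda> x x'] schur_weight_nonneg[of k \<Lambda> "x - x'"] by (simp add: algebra_simps)
      show "(\<integral>\<^sup>+z. ennreal ((C0 + 1) * schur_weight k \<Lambda> z) \<partial>lborel) \<le> ennreal ((C0 + 1) * B)"
      proof -
        have "(\<integral>\<^sup>+z. ennreal ((C0 + 1) * schur_weight k \<Lambda> z) \<partial>lborel) = ennreal (C0 + 1) * (\<integral>\<^sup>+z. ennreal (schur_weight k \<Lambda> z) \<partial>lborel)"
          using C0(1) by (subst nn_integral_cmult[symmetric]) (auto simp: ennreal_mult schur_weight_nonneg)
        also have "\<dots> \<le> ennreal (C0 + 1) * ennreal B"
          unfolding B_def by (intro mult_left_mono schur_weight_integral \<Lambda>) auto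
        finally show ?thesis using C0(1) B0 by (simp add: ennreal_mult)
      qed
      show "0 < (C0 + 1) * B" using C0(1) B0 by simp
      show "0 \<le> (C0 + 1) * schur_weight k \<Lambda> z" for z using C0(1) schur_weight_nonneg[of k \<Lambda> z] by simp
    qed (use f2 in measurable)
    finally show "(\<integral>\<^sup>+x. (SUP r\<in>R. ennreal ((norm (wave_average k \<psi> \<Lambda> r f x))\<^sup>2)) \<partial>lborel)
         \<le> ennreal ((C0 + 1) * ((16 / sqrt \<bar>\<Lambda>\<bar>) ^ (CARD('n) - 1) * (pi / \<bar>\<Lambda>\<bar>)) * (\<integral>y. (norm (f y))\<^sup>2 \<partial>lborel))"
      by (simp only: B_def)
  qed
qed

section \<open>Reduction to a fixed frequency\<close>

lemma inverse_fourier_eq: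
  assumes "continuous_on UNIV \<beta>"
  shows "inverse_fourier \<beta> t = (\<integral>\<tau>. cis (2 * pi * t * \<tau>) * \<beta> \<tau> \<partial>lborel)"
proof -
  have [measurable]: "\<beta> \<in> borel_measurable borel" using assms by (rule borel_measurable_continuous_onI)
  have e: "exp (2 * complex_of_real pi * \<i> * complex_of_real (t * \<tau>)) = cis (2 * pi * t * \<tau>)" for \<tau>
    by (simp add: cis_conv_exp ac_simps)
  show ?thesis
    unfolding inverse_fourier_def e by (rule integral_completion) measurable
qed

text \<open>The symbol after the substitution \<open>\<tau> = \<rho> \<sigma>\<close> with \<open>\<rho> = r\<^sub>k\<^sup>2\<close>. Everything in it that depends on
\<open>\<rho>\<close> is bounded, independently of \<open>l\<close>.\<close>

definition rescaled_symbol :: "(real \<Rightarrow> complex) \<Rightarrow> real \<Rightarrow> real \<Rightarrow> real \<Rightarrow> complex" where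
  "rescaled_symbol \<beta> l \<rho> \<sigma> = of_real \<rho> * cis (- (2 * pi * l * \<rho> * \<sigma>)) * \<beta> (\<rho> * \<sigma>)"

lemma inverse_fourier_rescaled:
  assumes "continuous_on UNIV \<beta>" and \<rho>: "\<rho> > 0"
  shows "inverse_fourier \<beta> (l * (Q / \<rho> - 1)) = (\<integral>\<sigma>. rescaled_symbol \<beta> l \<rho> \<sigma> * cis (2 * pi * l * \<sigma> * Q) \<partial>lborel)"
proof -
  have "inverse_fourier \<beta> (l * (Q / \<rho> - 1))
      = \<bar>\<rho>\<bar> *\<^sub>R (\<integral>\<sigma>. cis (2 * pi * (l * (Q / \<rho> - 1)) * (0 + \<rho> * \<sigma>)) * \<beta> (0 + \<rho> * \<sigma>) \<partial>lborel)"
    unfolding inverse_fourier_eq[OF assms(1)] by (rule lborel_integral_real_affine) (use \<rho> in simp)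
  also have "\<dots> = (\<integral>\<sigma>. \<bar>\<rho>\<bar> *\<^sub>R (cis (2 * pi * (l * (Q / \<rho> - 1)) * (0 + \<rho> * \<sigma>)) * \<beta> (0 + \<rho> * \<sigma>)) \<partial>lborel)"
    by simp
  also have "\<dots> = (\<integral>\<sigma>. rescaled_symbol \<beta> l \<rho> \<sigma> * cis (2 * pi * l * \<sigma> * Q) \<partial>lborel)"
  proof (intro Bochner_Integration.integral_cong refl)
    fix \<sigma>
    have "2 * pi * (l * (Q / \<rho> - 1)) * (0 + \<rho> * \<sigma>) = - (2 * pi * l * \<rho> * \<sigma>) + 2 * pi * l * \<sigma> * Q"
      using \<rho> by (simp add: field_simps)
    then have c: "cis (2 * pi * (l * (Q / \<rho> - 1)) * (0 + \<rho> * \<sigma>)) = cis (- (2 * pi * l * \<rho> * \<sigma>)) * cis (2 * pi * l * \<sigma> * Q)"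
      by (simp only: cis_mult)
    show "\<bar>\<rho>\<bar> *\<^sub>R (cis (2 * pi * (l * (Q / \<rho> - 1)) * (0 + \<rho> * \<sigma>)) * \<beta> (0 + \<rho> * \<sigma>))
        = rescaled_symbol \<beta> l \<rho> \<sigma> * cis (2 * pi * l * \<sigma> * Q)"
      unfolding c rescaled_symbol_def using \<rho> by (simp add: scaleR_conv_of_real)
  qed
  finally show ?thesis .
qed

lemma norm_rescale_normalized_form:
  fixes r u :: "real^'n"
  assumes "r $ k \<noteq> 0"
  shows "(norm (rescale r u))\<^sup>2 = normalized_form k r u / (r $ k)\<^sup>2"
proof -
  have "(norm (rescale r u))\<^sup>2 = (\<Sum>j\<in>UNIV. (u $ j / r $ j)\<^sup>2)"
    unfolding power2_norm_eq_inner inner_vec_def by (simp add: rescale_def power2_eq_square)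
  also have "\<dots> = normalized_form k r u / (r $ k)\<^sup>2"
    unfolding normalized_form_def sum_divide_distrib using assms by (intro sum.cong) (auto simp: power_divide power_mult_distrib)
  finally show ?thesis .
qed

lemma dilated_kernel_eq:
  fixes r u :: "real^'n"
  assumes \<beta>: "continuous_on UNIV \<beta>" and r: "r \<in> dyadic_box"
  shows "dilated_kernel \<psi> \<beta> l r u = of_real (l / (\<Prod>i\<in>UNIV. r $ i)) *
      (\<integral>\<sigma>. rescaled_symbol \<beta> l ((r $ k)\<^sup>2) \<sigma> * wave k \<psi> (2 * pi * l * \<sigma>) r u \<partial>lborel)"
proof -
  have rk: "r $ k \<ge> 1" using r by (auto simp: dyadic_box_def)
  let ?\<rho> = "(r $ k)\<^sup>2"
  have "(\<integral>\<sigma>. rescaled_symbol \<beta> l ?\<rho> \<sigma> * wave k \<psi> (2 * pi * l * \<sigma>) r u \<partial>lborel)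
      = (\<integral>\<sigma>. rescaled_symbol \<beta> l ?\<rho> \<sigma> * cis (2 * pi * l * \<sigma> * normalized_form k r u) * \<psi> (rescale r u) \<partial>lborel)"
    by (simp add: wave_def mult.assoc)
  also have "\<dots> = inverse_fourier \<beta> (l * (normalized_form k r u / ?\<rho> - 1)) * \<psi> (rescale r u)"
    using inverse_fourier_rescaled[OF \<beta>, of ?\<rho> l "normalized_form k r u"] rk by simp
  also have "normalized_form k r u / ?\<rho> = (norm (rescale r u))\<^sup>2"
    using rk by (subst norm_rescale_normalized_form[of r k]) auto
  finally show ?thesis
    unfolding dilated_kernel_def kernel_def rescale_def[symmetric] by simp
qed

text \<open>Since \<open>\<rho> \<in> [1, 4]\<close>, the support \<open>1/2 \<le> \<bar>\<rho> \<sigma>\<bar> \<le> 2\<close> lies in the fixed range \<open>1/8 \<le> \<bar>\<sigma>\<bar> \<le> 2\<close>.\<close>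

lemma rescaled_symbol_bound:
  assumes b: "\<And>\<tau>. norm (\<beta> \<tau>) \<le> B" and s: "\<And>\<tau>. \<beta> \<tau> \<noteq> 0 \<Longrightarrow> 1/2 \<le> \<bar>\<tau>\<bar> \<and> \<bar>\<tau>\<bar> \<le> 2"
    and \<rho>: "1 \<le> \<rho>" "\<rho> \<le> 4"
  shows "norm (rescaled_symbol \<beta> l \<rho> \<sigma>) \<le> 4 * B * indicator {\<sigma>. 1/8 \<le> \<bar>\<sigma>\<bar> \<and> \<bar>\<sigma>\<bar> \<le> 2} \<sigma>"
proof (cases "\<beta> (\<rho> * \<sigma>) = 0")
  case True
  have "B \<ge> 0" using b[of 0] norm_ge_zero order_trans by blast
  then show ?thesis using True by (simp add: rescaled_symbol_def)
next
  case False
  have 1: "1/2 \<le> \<rho> * \<bar>\<sigma>\<bar>" "\<rho> * \<bar>\<sigma>\<bar> \<le> 2" using s[OF False] \<rho> by (auto simp: abs_mult)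
  have "\<rho> * \<bar>\<sigma>\<bar> \<le> 4 * \<bar>\<sigma>\<bar>" "1 * \<bar>\<sigma>\<bar> \<le> \<rho> * \<bar>\<sigma>\<bar>" using \<rho> by (intro mult_right_mono; simp)+
  then have "1/8 \<le> \<bar>\<sigma>\<bar> \<and> \<bar>\<sigma>\<bar> \<le> 2" using 1 by linarith
  moreover have "\<rho> * norm (\<beta> (\<rho> * \<sigma>)) \<le> 4 * B" using \<rho> b by (intro mult_mono) auto
  ultimately show ?thesis using \<rho> by (simp add: rescaled_symbol_def norm_mult)
qed

text \<open>Taking absolute values inside the \<open>\<sigma>\<close>-integral removes the parameter \<open>r\<^sub>k\<close> from the phase. By the Cauchy-Schwarz inequality
on the bounded range of \<open>\<sigma>\<close> nothing is lost beyond a constant. In the constant, \<open>64 B\<^sup>2 = (4 B)\<^sup>2 \<cdot> 4\<close>, where \<open>4 B\<close> bounds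
the symbol and \<open>4\<close> bounds the length of the range.\<close>

lemma convolve_pointwise_bound:
  fixes \<psi> :: "(real^'n) \<Rightarrow> complex"
  assumes \<psi>: "\<psi> \<in> amplitude" and \<beta>: "continuous_on UNIV \<beta>" and bB: "\<And>\<tau>. norm (\<beta> \<tau>) \<le> B"
    and s: "\<And>\<tau>. \<beta> \<tau> \<noteq> 0 \<Longrightarrow> 1/2 \<le> \<bar>\<tau>\<bar> \<and> \<bar>\<tau>\<bar> \<le> 2"
    and l: "l \<ge> 0" and r: "r \<in> dyadic_box"
    and fm[measurable]: "f \<in> borel_measurable borel" and f2: "integrable lborel (\<lambda>y. (norm (f y))\<^sup>2)"
  shows "ennreal ((norm (convolve (dilated_kernel \<psi> \<beta> l r) f x))\<^sup>2)
     \<le> ennreal (64 * l\<^sup>2 * B\<^sup>2) * (\<integral>\<^sup>+\<sigma>. indicator {\<sigma>. 1/8 \<le> \<bar>\<sigma>\<bar> \<and> \<bar>\<sigma>\<bar> \<le> 2} \<sigma> *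
          ennreal ((norm (wave_average k \<psi> (2 * pi * l * \<sigma>) r f x))\<^sup>2) \<partial>lborel)"
proof -
  let ?J = "{\<sigma>::real. 1/8 \<le> \<bar>\<sigma>\<bar> \<and> \<bar>\<sigma>\<bar> \<le> 2}"
  let ?D = "norm (vec 4 :: real^'n)"
  note [measurable] = borel_measurable_wave_average[OF \<psi> fm] borel_measurable_wave[OF \<psi>]
  have [measurable]: "\<beta> \<in> borel_measurable borel" using \<beta> by (rule borel_measurable_continuous_onI)
  have B0: "B \<ge> 0" using bB[of 0] norm_ge_zero order_trans by blast
  obtain M where M: "M \<ge> 0" "\<And>u. norm (\<psi> u) \<le> M" using amplitude_bounded[OF \<psi>] by blast
  have Jm[measurable]: "?J \<in> sets borel" by measurable
  have Jsub: "?J \<subseteq> {-2..2}" by auto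
  have Jfin: "emeasure lborel ?J \<le> 4"
    using emeasure_mono[OF Jsub, of lborel] by simp
  have iJ: "integrable lborel (indicator ?J :: real \<Rightarrow> real)"
  proof (rule integrable_real_indicator[OF Jm[folded sets_lborel]])
    show "emeasure lborel ?J < \<infinity>" using Jfin by (rule le_less_trans) simp
  qed
  define \<rho> where "\<rho> = (r $ k)\<^sup>2"
  define b where "b = rescaled_symbol \<beta> l \<rho>"
  have bm[measurable]: "b \<in> borel_measurable borel" unfolding b_def rescaled_symbol_def by measurable
  have rk: "1 \<le> r $ i" "r $ i \<le> 2" for i using r by (auto simp: dyadic_box_def)
  have \<rho>: "1 \<le> \<rho>" "\<rho> \<le> 4"
    using power_mono[OF rk(1)[of k], of 2] power_mono[OF rk(2)[of k], of 2] rk(1)[of k] by (auto simp: \<rho>_def)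
  have bb: "norm (b \<sigma>) \<le> 4 * B * indicator ?J \<sigma>" for \<sigma>
    unfolding b_def by (rule rescaled_symbol_bound[OF bB s \<rho>])
  define W where "W \<sigma> y = wave k \<psi> (2 * pi * l * \<sigma>) r (x - y)" for \<sigma> y
  have [measurable]: "(\<lambda>z. W (u z) (v z)) \<in> borel_measurable N"
    if [measurable]: "u \<in> borel_measurable N" "v \<in> borel_measurable N" for u v and N :: "(real \<times> (real^'n)) measure"
    unfolding W_def by measurable
  have [measurable]: "(\<lambda>z. W (u z) (v z)) \<in> borel_measurable N"
    if [measurable]: "u \<in> borel_measurable N" "v \<in> borel_measurable N" for u v and N :: "((real^'n) \<times> real) measure"
    unfolding W_def by measurable
  have [measurable]: "W \<sigma> \<in> borel_measurable borel" for \<sigma>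
    unfolding W_def by measurable
  define G where "G \<sigma> = wave_average k \<psi> (2 * pi * l * \<sigma>) r f x" for \<sigma>
  have Gm[measurable]: "G \<in> borel_measurable borel" unfolding G_def by measurable
  have G: "G \<sigma> = (\<integral>y. W \<sigma> y * f y \<partial>lborel)" for \<sigma> by (simp only: G_def wave_average_def W_def)
  define q where "q y = indicator (cball x ?D) y * (1 + (norm (f y))\<^sup>2)" for y
  have iq: "integrable lborel q"
    unfolding q_def by (rule integrable_square_majorant[OF f2])
  have Wf: "norm (W \<sigma> y * f y) \<le> M * q y" for \<sigma> y
  proof (cases "W \<sigma> y = 0")
    case True
    then show ?thesis using M by (simp add: q_def)
  next
    case False
    then have "norm (x - y) \<le> ?D" unfolding W_def by (intro wave_support[OF \<psi> r])
    then have y: "y \<in> cball x ?D" by (simp add: dist_norm)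
    have "norm (W \<sigma> y) * norm (f y) \<le> M * (1 + (norm (f y))\<^sup>2)"
      using M by (intro mult_mono norm_le_one_plus_square) (auto simp: W_def wave_def norm_mult)
    then show ?thesis using y by (simp add: q_def norm_mult)
  qed
  have F: "integrable (lborel \<Otimes>\<^sub>M lborel) (\<lambda>(\<sigma>, y). b \<sigma> * (W \<sigma> y * f y))"
  proof (rule integrable_pair_bound)
    show "(\<lambda>(\<sigma>, y). b \<sigma> * (W \<sigma> y * f y)) \<in> borel_measurable (lborel \<Otimes>\<^sub>M lborel)" by measurable
    show "integrable lborel (\<lambda>\<sigma>. 4 * B * indicator ?J \<sigma>)" using iJ by (intro integrable_mult_right)
    show "integrable lborel (\<lambda>y. M * q y)" using iq by (intro integrable_mult_right)
    fix \<sigma> y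
    have "norm (b \<sigma>) * norm (W \<sigma> y * f y) \<le> (4 * B * indicator ?J \<sigma>) * (M * q y)"
      using bb Wf B0 by (intro mult_mono) auto
    then show "norm (case (\<sigma>, y) of (\<sigma>, y) \<Rightarrow> b \<sigma> * (W \<sigma> y * f y)) \<le> (4 * B * indicator ?J \<sigma>) * (M * q y)"
      by (simp add: norm_mult)
  qed
  define c where "c = l / (\<Prod>i\<in>UNIV. r $ i)"
  have c: "\<bar>c\<bar> \<le> l"
  proof -
    have "1 \<le> (\<Prod>i\<in>UNIV. r $ i)" using rk by (intro prod_ge_1) auto
    then show ?thesis using l mult_left_mono[of 1 "\<Prod>i\<in>UNIV. r $ i" l] by (simp add: c_def divide_le_eq abs_of_nonneg)
  qed
  have K: "dilated_kernel \<psi> \<beta> l r (x - y) = of_real c * (\<integral>\<sigma>. b \<sigma> * W \<sigma> y \<partial>lborel)" for y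
    unfolding dilated_kernel_eq[OF \<beta> r, of \<psi> l "x - y" k] by (simp only: c_def b_def \<rho>_def W_def)
  have "convolve (dilated_kernel \<psi> \<beta> l r) f x = (\<integral>y. of_real c * (\<integral>\<sigma>. b \<sigma> * W \<sigma> y \<partial>lborel) * f y \<partial>lborel)"
    unfolding convolve_def K by (rule integral_completion) measurable
  also have "\<dots> = (\<integral>y. of_real c * (\<integral>\<sigma>. b \<sigma> * (W \<sigma> y * f y) \<partial>lborel) \<partial>lborel)"
    by (simp only: mult.assoc integral_mult_left_zero[symmetric])
  also have "\<dots> = of_real c * (\<integral>\<sigma>. \<integral>y. b \<sigma> * (W \<sigma> y * f y) \<partial>lborel \<partial>lborel)"
    by (simp only: integral_mult_right_zero lborel_pair.Fubini_integral[OF F])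
  also have "\<dots> = of_real c * (\<integral>\<sigma>. b \<sigma> * G \<sigma> \<partial>lborel)"
    by (simp only: integral_mult_right_zero G)
  finally have conv: "convolve (dilated_kernel \<psi> \<beta> l r) f x = of_real c * (\<integral>\<sigma>. b \<sigma> * G \<sigma> \<partial>lborel)" .
  have ibG: "integrable lborel (\<lambda>\<sigma>. b \<sigma> * G \<sigma>)"
    using lborel_pair.integrable_fst[OF F] by (simp only: integral_mult_right_zero G)
  have "ennreal (norm (\<integral>\<sigma>. b \<sigma> * G \<sigma> \<partial>lborel)) \<le> (\<integral>\<^sup>+\<sigma>. ennreal (norm (b \<sigma> * G \<sigma>)) \<partial>lborel)"
    by (rule integral_norm_bound_ennreal[OF ibG])
  also have "\<dots> \<le> (\<integral>\<^sup>+\<sigma>. ennreal (4 * B) * (indicator ?J \<sigma> * (indicator ?J \<sigma> * ennreal (norm (G \<sigma>)))) \<partial>lborel)"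
  proof (rule nn_integral_mono)
    fix \<sigma>
    show "ennreal (norm (b \<sigma> * G \<sigma>)) \<le> ennreal (4 * B) * (indicator ?J \<sigma> * (indicator ?J \<sigma> * ennreal (norm (G \<sigma>))))"
    proof (cases "\<sigma> \<in> ?J")
      case True
      have "norm (b \<sigma>) * norm (G \<sigma>) \<le> 4 * B * norm (G \<sigma>)" using bb[of \<sigma>] True by (intro mult_right_mono) auto
      then show ?thesis using True B0 by (simp add: norm_mult ennreal_mult[symmetric] ennreal_leI)
    next
      case False
      then have "b \<sigma> = 0" using bb[of \<sigma>] by simp
      then show ?thesis by simp
    qed
  qed
  also have "\<dots> = ennreal (4 * B) * (\<integral>\<^sup>+\<sigma>. indicator ?J \<sigma> * (indicator ?J \<sigma> * ennreal (norm (G \<sigma>))) \<partial>lborel)"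
    by (rule nn_integral_cmult) measurable
  finally have 1: "ennreal (norm (\<integral>\<sigma>. b \<sigma> * G \<sigma> \<partial>lborel)) \<le> ennreal (4 * B) * (\<integral>\<^sup>+\<sigma>. indicator ?J \<sigma> * (indicator ?J \<sigma> * ennreal (norm (G \<sigma>))) \<partial>lborel)" .
  let ?S = "\<integral>\<^sup>+\<sigma>. indicator ?J \<sigma> * ennreal ((norm (G \<sigma>))\<^sup>2) \<partial>lborel"
  have "(\<integral>\<^sup>+\<sigma>. indicator ?J \<sigma> * (indicator ?J \<sigma> * ennreal (norm (G \<sigma>))) \<partial>lborel)\<^sup>2
     \<le> (\<integral>\<^sup>+\<sigma>. (indicator ?J \<sigma>)\<^sup>2 \<partial>lborel) * (\<integral>\<^sup>+\<sigma>. (indicator ?J \<sigma> * ennreal (norm (G \<sigma>)))\<^sup>2 \<partial>lborel)"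
    by (rule Cauchy_Schwarz_nn_integral) measurable
  also have "(\<integral>\<^sup>+\<sigma>. (indicator ?J \<sigma>)\<^sup>2 \<partial>lborel) = emeasure lborel ?J"
  proof -
    have "(\<lambda>\<sigma>. (indicator ?J \<sigma>)\<^sup>2) = (indicator ?J :: real \<Rightarrow> ennreal)"
      by (auto simp: indicator_def fun_eq_iff)
    then show ?thesis using Jm by (simp only: nn_integral_indicator sets_lborel)
  qed
  also have "(\<integral>\<^sup>+\<sigma>. (indicator ?J \<sigma> * ennreal (norm (G \<sigma>)))\<^sup>2 \<partial>lborel) = ?S"
    by (intro nn_integral_cong) (auto simp: indicator_def ennreal_power)
  also have "emeasure lborel ?J * ?S \<le> 4 * ?S" by (intro mult_right_mono Jfin) auto
  finally have 2: "(\<integral>\<^sup>+\<sigma>. indicator ?J \<sigma> * (indicator ?J \<sigma> * ennreal (norm (G \<sigma>))) \<partial>lborel)\<^sup>2 \<le> 4 * ?S" .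
  have "ennreal ((norm (convolve (dilated_kernel \<psi> \<beta> l r) f x))\<^sup>2) = (ennreal \<bar>c\<bar> * ennreal (norm (\<integral>\<sigma>. b \<sigma> * G \<sigma> \<partial>lborel)))\<^sup>2"
    unfolding conv by (simp add: norm_mult ennreal_mult[symmetric] ennreal_power)
  also have "\<dots> \<le> (ennreal l * (ennreal (4 * B) * (\<integral>\<^sup>+\<sigma>. indicator ?J \<sigma> * (indicator ?J \<sigma> * ennreal (norm (G \<sigma>))) \<partial>lborel)))\<^sup>2"
    using c by (intro power_mono mult_mono 1 ennreal_leI) auto
  also have "\<dots> = ennreal (16 * l\<^sup>2 * B\<^sup>2) * (\<integral>\<^sup>+\<sigma>. indicator ?J \<sigma> * (indicator ?J \<sigma> * ennreal (norm (G \<sigma>))) \<partial>lborel)\<^sup>2"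
    using l B0 by (simp add: power_mult_distrib ennreal_power ennreal_mult[symmetric] mult.assoc[symmetric]) (simp add: mult.commute)
  also have "\<dots> \<le> ennreal (16 * l\<^sup>2 * B\<^sup>2) * (4 * ?S)" by (intro mult_left_mono 2) auto
  also have "\<dots> = ennreal (64 * l\<^sup>2 * B\<^sup>2) * ?S"
  proof -
    have "ennreal (16 * l\<^sup>2 * B\<^sup>2) * 4 = ennreal (64 * l\<^sup>2 * B\<^sup>2)"
      by (subst ennreal_numeral[symmetric], subst ennreal_mult[symmetric]) (auto simp: mult_ac)
    then show ?thesis by (simp only: mult.assoc[symmetric])
  qed
  finally show ?thesis by (simp only: G_def)
qed

section \<open>The bound for finitely many parameters\<close>

text \<open>For \<open>\<bar>\<sigma>\<bar> \<ge> 1/8\<close> the frequency \<open>\<Lambda> = 2\<pi>l\<sigma>\<close> satisfies \<open>\<bar>\<Lambda>\<bar> \<ge> l/2\<close>, so the bound at a fixed frequency is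
\<open>O(l\<^bsup>-(n-1)/2 - 1\<^esup>)\<close> uniformly in \<open>\<sigma>\<close>; it is integrated over \<open>\<sigma>\<close> and multiplied by \<open>l\<^sup>2\<close>.\<close>

lemma finite_maximal_bound:
  fixes \<psi> :: "(real^'n) \<Rightarrow> complex"
  assumes \<psi>: "\<psi> \<in> amplitude" and \<beta>: "continuous_on UNIV \<beta>" and bB: "\<And>\<tau>. norm (\<beta> \<tau>) \<le> B"
    and s: "\<And>\<tau>. \<beta> \<tau> \<noteq> 0 \<Longrightarrow> 1/2 \<le> \<bar>\<tau>\<bar> \<and> \<bar>\<tau>\<bar> \<le> 2"
  obtains C where "C \<ge> 0"
    "\<And>l R f. l \<ge> 1 \<Longrightarrow> finite R \<Longrightarrow> R \<noteq> {} \<Longrightarrow> R \<subseteq> dyadic_box \<Longrightarrow> f \<in> borel_measurable borel \<Longrightarrow>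
       integrable lborel (\<lambda>y. (norm (f y))\<^sup>2) \<Longrightarrow>
       (\<integral>\<^sup>+x. (SUP r\<in>R. ennreal ((norm (convolve (dilated_kernel \<psi> \<beta> l r) f x))\<^sup>2)) \<partial>lborel)
         \<le> ennreal (C * (l powr (- (real CARD('n) - 3) / 4))\<^sup>2 * (\<integral>y. (norm (f y))\<^sup>2 \<partial>lborel))"
proof -
  obtain k :: 'n where "k \<in> UNIV" by simp
  define n where "n = CARD('n) - 1"
  have n: "real n = real CARD('n) - 1"
    unfolding n_def by (simp add: of_nat_diff Suc_leI)
  obtain C0 where C0: "C0 > 0"
    "\<And>\<Lambda> R f. \<Lambda> \<noteq> 0 \<Longrightarrow> finite R \<Longrightarrow> R \<noteq> {} \<Longrightarrow> R \<subseteq> dyadic_box \<Longrightarrow> f \<in> borel_measurable borel \<Longrightarrow>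
       integrable lborel (\<lambda>y. (norm (f y))\<^sup>2) \<Longrightarrow>
       (\<integral>\<^sup>+x. (SUP r\<in>R. ennreal ((norm (wave_average k \<psi> \<Lambda> r f x))\<^sup>2)) \<partial>lborel)
         \<le> ennreal (C0 * ((16 / sqrt \<bar>\<Lambda>\<bar>) ^ n * (pi / \<bar>\<Lambda>\<bar>)) * (\<integral>y. (norm (f y))\<^sup>2 \<partial>lborel))"
    using fixed_frequency_maximal_bound[OF \<psi>, of k] unfolding n_def by blast
  have B0: "B \<ge> 0" using bB[of 0] norm_ge_zero order_trans by blast
  define C where "C = 512 * pi * B\<^sup>2 * C0 * (16 * sqrt 2) ^ n"
  show ?thesis
  proof
    show "C \<ge> 0" using C0(1) by (simp add: C_def)
    fix l :: real and R :: "(real^'n) set" and f :: "(real^'n) \<Rightarrow> complex"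
    assume l: "l \<ge> 1" and R: "finite R" "R \<noteq> {}" "R \<subseteq> dyadic_box"
      and fm: "f \<in> borel_measurable borel" and f2: "integrable lborel (\<lambda>y. (norm (f y))\<^sup>2)"
    let ?J = "{\<sigma>::real. 1/8 \<le> \<bar>\<sigma>\<bar> \<and> \<bar>\<sigma>\<bar> \<le> 2}"
    let ?F = "\<integral>y. (norm (f y))\<^sup>2 \<partial>lborel"
    have F0: "?F \<ge> 0" by (intro Bochner_Integration.integral_nonneg) auto
    have Jm[measurable]: "?J \<in> sets borel" by measurable
    have Jsub: "?J \<subseteq> {-2..2}" by auto
    have Jfin: "emeasure lborel ?J \<le> 4"
      using emeasure_mono[OF Jsub, of lborel] by simp
    note [measurable] = borel_measurable_wave_average[OF \<psi> fm]
    define S where "S \<sigma> x = (SUP r\<in>R. ennreal ((norm (wave_average k \<psi> (2 * pi * l * \<sigma>) r f x))\<^sup>2))" for \<sigma> x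
    have Sm[measurable]: "(\<lambda>(x, \<sigma>). S \<sigma> x) \<in> borel_measurable (borel \<Otimes>\<^sub>M borel)"
      unfolding S_def case_prod_beta
      by (intro borel_measurable_SUP countable_finite[OF R(1)]) measurable
    have [measurable]: "S \<sigma> \<in> borel_measurable borel" for \<sigma>
      unfolding S_def by (intro borel_measurable_SUP countable_finite[OF R(1)]) measurable
    define D where "D = C0 * ((16 * sqrt 2 / sqrt l) ^ n * (2 * pi / l)) * ?F"
    have D0: "D \<ge> 0" using C0(1) l F0 by (simp add: D_def)
    have Sint: "indicator ?J \<sigma> * (\<integral>\<^sup>+x. S \<sigma> x \<partial>lborel) \<le> indicator ?J \<sigma> * ennreal D" for \<sigma>
    proof (cases "\<sigma> \<in> ?J")
      case True
      let ?L = "\<bar>2 * pi * l * \<sigma>\<bar>"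
      have "l * (1/2) \<le> l * (2 * pi * \<bar>\<sigma>\<bar>)"
      proof (rule mult_left_mono)
        have "4 * (1/8) \<le> 2 * pi * \<bar>\<sigma>\<bar>" using True pi_ge_two by (intro mult_mono) auto
        then show "1/2 \<le> 2 * pi * \<bar>\<sigma>\<bar>" by simp
      qed (use l in simp)
      then have L: "l / 2 \<le> ?L" using l by (simp add: abs_mult mult_ac)
      then have nz: "2 * pi * l * \<sigma> \<noteq> 0" using l by auto
      have L0: "?L > 0" using nz by linarith
      have "(\<integral>\<^sup>+x. S \<sigma> x \<partial>lborel) \<le> ennreal (C0 * ((16 / sqrt ?L) ^ n * (pi / ?L)) * ?F)"
        unfolding S_def by (rule C0(2)[OF nz R fm f2])
      also have "\<dots> \<le> ennreal D"
        unfolding D_def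
      proof (intro ennreal_leI mult_right_mono mult_left_mono mult_mono power_mono)
        have "sqrt (l/2) \<le> sqrt ?L" using L by (rule real_sqrt_le_mono)
        then have "16 / sqrt ?L \<le> 16 / sqrt (l/2)" using l by (intro divide_left_mono mult_pos_pos) (auto simp: L0)
        also have "\<dots> = 16 * sqrt 2 / sqrt l" by (simp add: real_sqrt_divide)
        finally show "16 / sqrt ?L \<le> 16 * sqrt 2 / sqrt l" .
        have "pi / ?L \<le> pi / (l/2)" using l L L0 by (intro divide_left_mono mult_pos_pos) auto
        then show "pi / ?L \<le> 2 * pi / l" by (simp add: mult.commute)
      qed (use l C0(1) F0 in auto)
      finally show ?thesis using True by simp
    qed simp
    have "(\<integral>\<^sup>+x. (SUP r\<in>R. ennreal ((norm (convolve (dilated_kernel \<psi> \<beta> l r) f x))\<^sup>2)) \<partial>lborel)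
        \<le> (\<integral>\<^sup>+x. ennreal (64 * l\<^sup>2 * B\<^sup>2) * (\<integral>\<^sup>+\<sigma>. indicator ?J \<sigma> * S \<sigma> x \<partial>lborel) \<partial>lborel)"
    proof (intro nn_integral_mono SUP_least)
      fix x r assume r: "r \<in> R"
      have "ennreal ((norm (convolve (dilated_kernel \<psi> \<beta> l r) f x))\<^sup>2)
         \<le> ennreal (64 * l\<^sup>2 * B\<^sup>2) * (\<integral>\<^sup>+\<sigma>. indicator ?J \<sigma> * ennreal ((norm (wave_average k \<psi> (2 * pi * l * \<sigma>) r f x))\<^sup>2) \<partial>lborel)"
        using convolve_pointwise_bound[OF \<psi> \<beta> bB s _ _ fm f2, of l r x k] l r R(3) by auto
      also have "\<dots> \<le> ennreal (64 * l\<^sup>2 * B\<^sup>2) * (\<integral>\<^sup>+\<sigma>. indicator ?J \<sigma> * S \<sigma> x \<partial>lborel)"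
        unfolding S_def by (intro mult_left_mono nn_integral_mono SUP_upper r) auto
      finally show "ennreal ((norm (convolve (dilated_kernel \<psi> \<beta> l r) f x))\<^sup>2)
         \<le> ennreal (64 * l\<^sup>2 * B\<^sup>2) * (\<integral>\<^sup>+\<sigma>. indicator ?J \<sigma> * S \<sigma> x \<partial>lborel)" .
    qed
    also have "\<dots> = ennreal (64 * l\<^sup>2 * B\<^sup>2) * (\<integral>\<^sup>+x. \<integral>\<^sup>+\<sigma>. indicator ?J \<sigma> * S \<sigma> x \<partial>lborel \<partial>lborel)"
      by (rule nn_integral_cmult) measurable
    finally have outer: "(\<integral>\<^sup>+x. (SUP r\<in>R. ennreal ((norm (convolve (dilated_kernel \<psi> \<beta> l r) f x))\<^sup>2)) \<partial>lborel)
        \<le> ennreal (64 * l\<^sup>2 * B\<^sup>2) * (\<integral>\<^sup>+x. \<integral>\<^sup>+\<sigma>. indicator ?J \<sigma> * S \<sigma> x \<partial>lborel \<partial>lborel)" .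
    have "(\<integral>\<^sup>+x. \<integral>\<^sup>+\<sigma>. indicator ?J \<sigma> * S \<sigma> x \<partial>lborel \<partial>lborel) = (\<integral>\<^sup>+\<sigma>. \<integral>\<^sup>+x. indicator ?J \<sigma> * S \<sigma> x \<partial>lborel \<partial>lborel)"
      by (rule lborel_pair.Fubini'[symmetric]) measurable
    also have "\<dots> = (\<integral>\<^sup>+\<sigma>. indicator ?J \<sigma> * (\<integral>\<^sup>+x. S \<sigma> x \<partial>lborel) \<partial>lborel)"
      by (intro nn_integral_cong nn_integral_cmult) measurable
    also have "\<dots> \<le> (\<integral>\<^sup>+\<sigma>. indicator ?J \<sigma> * ennreal D \<partial>lborel)"
      by (intro nn_integral_mono Sint)
    also have "\<dots> = emeasure lborel ?J * ennreal D"
      using Jm by (subst nn_integral_multc) (auto simp: nn_integral_indicator)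
    also have "\<dots> \<le> 4 * ennreal D" by (intro mult_right_mono Jfin) auto
    finally have inner: "(\<integral>\<^sup>+x. \<integral>\<^sup>+\<sigma>. indicator ?J \<sigma> * S \<sigma> x \<partial>lborel \<partial>lborel) \<le> 4 * ennreal D" .
    note outer
    also have "ennreal (64 * l\<^sup>2 * B\<^sup>2) * (\<integral>\<^sup>+x. \<integral>\<^sup>+\<sigma>. indicator ?J \<sigma> * S \<sigma> x \<partial>lborel \<partial>lborel)
        \<le> ennreal (64 * l\<^sup>2 * B\<^sup>2) * (4 * ennreal D)"
      by (rule mult_left_mono[OF inner]) simp
    also have "ennreal (64 * l\<^sup>2 * B\<^sup>2) * (4 * ennreal D) = ennreal (256 * l\<^sup>2 * B\<^sup>2 * D)"
      using D0 by (simp add: ennreal_mult[symmetric] ennreal_numeral[symmetric] mult_ac del: ennreal_numeral)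
    also have "256 * l\<^sup>2 * B\<^sup>2 * D = C * (l powr (- (real CARD('n) - 3) / 4))\<^sup>2 * ?F"
    proof -
      have e1: "(16 * sqrt 2 / sqrt l) ^ n = (16 * sqrt 2) ^ n * l powr (- real n / 2)"
      proof -
        have "1 / sqrt l ^ n = l powr (- real n / 2)"
        proof -
          have "sqrt l ^ n = l powr (real n / 2)"
            using l by (simp add: powr_half_sqrt[symmetric] powr_powr powr_realpow[symmetric])
          then show ?thesis using l by (simp add: powr_minus_divide)
        qed
        moreover have "(16 * sqrt 2 / sqrt l) ^ n = (16 * sqrt 2) ^ n * (1 / sqrt l ^ n)"
          by (simp only: power_divide times_divide_eq_right mult_1_right)
        ultimately show ?thesis by (simp only:)
      qed
      have e2: "l\<^sup>2 * (1 / l) * l powr (- real n / 2) = (l powr (- (real CARD('n) - 3) / 4))\<^sup>2"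
      proof -
        have "l\<^sup>2 * (1 / l) * l powr (- real n / 2) = l powr 1 * l powr (- real n / 2)"
          using l by (simp add: power2_eq_square)
        also have "\<dots> = l powr (1 + - real n / 2)" by (rule powr_add[symmetric])
        also have "1 + - real n / 2 = (- (real CARD('n) - 3) / 4) + (- (real CARD('n) - 3) / 4)"
          by (simp add: n field_simps)
        also have "l powr \<dots> = (l powr (- (real CARD('n) - 3) / 4))\<^sup>2"
          unfolding powr_add power2_eq_square ..
        finally show ?thesis .
      qed
      have e3: "256 * l\<^sup>2 * B\<^sup>2 * (C0 * (((16 * sqrt 2) ^ n * p) * (2 * pi / l)) * ?F) = C * (l\<^sup>2 * (1 / l) * p) * ?F" for p
        by (simp add: C_def)
      show ?thesis unfolding D_def e1 e3 e2 ..
    qed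
    finally show "(\<integral>\<^sup>+x. (SUP r\<in>R. ennreal ((norm (convolve (dilated_kernel \<psi> \<beta> l r) f x))\<^sup>2)) \<partial>lborel)
         \<le> ennreal (C * (l powr (- (real CARD('n) - 3) / 4))\<^sup>2 * ?F)" .
  qed
qed

lemma inverse_fourier_tendsto:
  assumes "continuous_on UNIV \<beta>" "integrable lborel \<beta>" "t \<longlonglongrightarrow> t0"
  shows "(\<lambda>m. inverse_fourier \<beta> (t m)) \<longlonglongrightarrow> inverse_fourier \<beta> t0"
  unfolding inverse_fourier_eq[OF assms(1)]
proof (rule integral_dominated_convergence[where w="\<lambda>\<tau>. norm (\<beta> \<tau>)"])
  have [measurable]: "\<beta> \<in> borel_measurable borel" using assms(1) by (rule borel_measurable_continuous_onI)
  show "(\<lambda>\<tau>. cis (2 * pi * t0 * \<tau>) * \<beta> \<tau>) \<in> borel_measurable lborel" by measurable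
  show "(\<lambda>\<tau>. cis (2 * pi * t m * \<tau>) * \<beta> \<tau>) \<in> borel_measurable lborel" for m by measurable
  show "AE \<tau> in lborel. (\<lambda>m. cis (2 * pi * t m * \<tau>) * \<beta> \<tau>) \<longlonglongrightarrow> cis (2 * pi * t0 * \<tau>) * \<beta> \<tau>"
    by (intro AE_I2 tendsto_intros assms)
qed (use assms in \<open>auto simp: norm_mult\<close>)

lemma norm_inverse_fourier_le:
  assumes "continuous_on UNIV \<beta>"
  shows "norm (inverse_fourier \<beta> t) \<le> (\<integral>\<tau>. norm (\<beta> \<tau>) \<partial>lborel)"
  unfolding inverse_fourier_eq[OF assms]
  by (rule order_trans[OF integral_norm_bound]) (simp add: norm_mult)

lemma borel_measurable_dilated_kernel:
  fixes \<psi> :: "(real^'n) \<Rightarrow> complex"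
  assumes \<psi>: "\<psi> \<in> amplitude" and \<beta>: "continuous_on UNIV \<beta>" and r: "r \<in> dyadic_box"
  shows "dilated_kernel \<psi> \<beta> l r \<in> borel_measurable borel"
proof -
  note [measurable] = borel_measurable_wave[OF \<psi>]
  have [measurable]: "\<beta> \<in> borel_measurable borel" using \<beta> by (rule borel_measurable_continuous_onI)
  \<comment> \<open>Any coordinate can serve as the normalising one here.\<close>
  show ?thesis
    unfolding dilated_kernel_eq[OF \<beta> r, abs_def, of _ _ undefined] rescaled_symbol_def by measurable
qed

lemma convolve_lborel:
  fixes \<psi> :: "(real^'n) \<Rightarrow> complex"
  assumes \<psi>: "\<psi> \<in> amplitude" and \<beta>: "continuous_on UNIV \<beta>" and r: "r \<in> dyadic_box"
    and [measurable]: "f \<in> borel_measurable borel"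
  shows "convolve (dilated_kernel \<psi> \<beta> l r) f x = (\<integral>y. dilated_kernel \<psi> \<beta> l r (x - y) * f y \<partial>lborel)"
    and "(\<lambda>x. convolve (dilated_kernel \<psi> \<beta> l r) f x) \<in> borel_measurable borel"
proof -
  note [measurable] = borel_measurable_dilated_kernel[OF \<psi> \<beta> r]
  show eq: "convolve (dilated_kernel \<psi> \<beta> l r) f x = (\<integral>y. dilated_kernel \<psi> \<beta> l r (x - y) * f y \<partial>lborel)" for x
    unfolding convolve_def by (rule integral_completion) measurable
  show "(\<lambda>x. convolve (dilated_kernel \<psi> \<beta> l r) f x) \<in> borel_measurable borel"
    unfolding eq by measurable
qed

text \<open>Continuity in the dilation parameters reduces the supremum over the box to one over a
countable dense subset.\<close>

lemma convolve_tendsto: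
  fixes \<psi> :: "(real^'n) \<Rightarrow> complex"
  assumes \<psi>: "\<psi> \<in> amplitude" and \<beta>: "continuous_on UNIV \<beta>" "integrable lborel \<beta>"
    and r: "\<And>m. r m \<in> dyadic_box" "r0 \<in> dyadic_box" "r \<longlonglongrightarrow> r0" and l: "l \<ge> 0"
    and fm[measurable]: "f \<in> borel_measurable borel" and f2: "integrable lborel (\<lambda>y. (norm (f y))\<^sup>2)"
  shows "(\<lambda>m. convolve (dilated_kernel \<psi> \<beta> l (r m)) f x) \<longlonglongrightarrow> convolve (dilated_kernel \<psi> \<beta> l r0) f x"
  unfolding convolve_lborel(1)[OF \<psi> \<beta>(1) r(1) fm] convolve_lborel(1)[OF \<psi> \<beta>(1) r(2) fm]
proof -
  let ?D = "norm (vec 4 :: real^'n)"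
  obtain M where M: "M \<ge> 0" "\<And>u. norm (\<psi> u) \<le> M" using amplitude_bounded[OF \<psi>] by blast
  define N where "N = (\<integral>\<tau>. norm (\<beta> \<tau>) \<partial>lborel)"
  have N0: "N \<ge> 0" unfolding N_def by (intro Bochner_Integration.integral_nonneg) auto
  have bd: "norm (dilated_kernel \<psi> \<beta> l \<rho> u) \<le> M * l * N * indicator (cball 0 ?D) u" if \<rho>: "\<rho> \<in> dyadic_box" for \<rho> u
  proof (cases "\<psi> (rescale \<rho> u) = 0")
    case True
    then show ?thesis using M l N0 by (simp add: dilated_kernel_def kernel_def rescale_def)
  next
    case False
    \<comment> \<open>Only the amplitude matters for the support, so the frequency and the coordinate of the wave are arbitrary.\<close>
    then have "wave undefined \<psi> 0 \<rho> u \<noteq> 0" by (simp add: wave_def)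
    then have u: "norm u \<le> ?D" by (rule wave_support[OF \<psi> \<rho>])
    have p: "1 \<le> (\<Prod>i\<in>UNIV. \<rho> $ i)" using \<rho> by (intro prod_ge_1) (auto simp: dyadic_box_def)
    then have p': "norm (complex_of_real (1 / (\<Prod>i\<in>UNIV. \<rho> $ i))) \<le> 1"
      unfolding norm_of_real by (simp add: abs_of_nonneg)
    have "norm (dilated_kernel \<psi> \<beta> l \<rho> u) \<le> 1 * (M * l * N)"
      unfolding dilated_kernel_def kernel_def rescale_def[symmetric] norm_mult
      using p' M l N0 norm_inverse_fourier_le[OF \<beta>(1)]
      by (intro mult_mono) (auto simp: N_def)
    then show ?thesis using u by simp
  qed
  define q where "q y = indicator (cball x ?D) y * (1 + (norm (f y))\<^sup>2)" for y
  have iq: "integrable lborel q"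
    unfolding q_def by (rule integrable_square_majorant[OF f2])
  have [measurable]: "dilated_kernel \<psi> \<beta> l \<rho> \<in> borel_measurable borel" if "\<rho> \<in> dyadic_box" for \<rho>
    by (rule borel_measurable_dilated_kernel[OF \<psi> \<beta>(1) that])
  show "(\<lambda>m. \<integral>y. dilated_kernel \<psi> \<beta> l (r m) (x - y) * f y \<partial>lborel) \<longlonglongrightarrow> (\<integral>y. dilated_kernel \<psi> \<beta> l r0 (x - y) * f y \<partial>lborel)"
  proof (rule integral_dominated_convergence[where w="\<lambda>y. M * l * N * q y"])
    note [measurable] = borel_measurable_dilated_kernel[OF \<psi> \<beta>(1) r(2)] borel_measurable_dilated_kernel[OF \<psi> \<beta>(1) r(1)]
    show "(\<lambda>y. dilated_kernel \<psi> \<beta> l r0 (x - y) * f y) \<in> borel_measurable lborel" by measurable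
    show "(\<lambda>y. dilated_kernel \<psi> \<beta> l (r m) (x - y) * f y) \<in> borel_measurable lborel" for m by measurable
    show "integrable lborel (\<lambda>y. M * l * N * q y)" using iq by (intro integrable_mult_right)
    have "norm (dilated_kernel \<psi> \<beta> l (r m) (x - y) * f y) \<le> M * l * N * q y" for m y
    proof -
      have "norm (dilated_kernel \<psi> \<beta> l (r m) (x - y)) * norm (f y) \<le> (M * l * N * indicator (cball 0 ?D) (x - y)) * (1 + (norm (f y))\<^sup>2)"
        using M l N0 by (intro mult_mono bd r norm_le_one_plus_square) auto
      also have "indicator (cball 0 ?D) (x - y) = (indicator (cball x ?D) y :: real)"
        by (simp add: indicator_def dist_norm norm_minus_commute)
      finally show ?thesis by (simp add: norm_mult q_def mult.assoc)
    qed
    then show "AE y in lborel. norm (dilated_kernel \<psi> \<beta> l (r m) (x - y) * f y) \<le> M * l * N * q y" for m by simp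
    have lim: "(\<lambda>m. dilated_kernel \<psi> \<beta> l (r m) u) \<longlonglongrightarrow> dilated_kernel \<psi> \<beta> l r0 u" for u
    proof -
      have ri: "(\<lambda>m. r m $ i) \<longlonglongrightarrow> r0 $ i" for i by (intro tendsto_vec_nth r)
      have nz: "r0 $ i \<noteq> 0" for i using r(2) by (auto simp: dyadic_box_def dest!: spec[of _ i])
      have re: "(\<lambda>m. rescale (r m) u) \<longlonglongrightarrow> rescale r0 u"
        unfolding rescale_def by (intro vec_tendstoI) (auto intro!: tendsto_divide ri nz)
      have ps: "(\<lambda>m. \<psi> (rescale (r m) u)) \<longlonglongrightarrow> \<psi> (rescale r0 u)"
        using amplitude_continuous[OF \<psi>] re by (intro continuous_on_tendsto_compose[of UNIV \<psi>]) auto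
      show ?thesis
        unfolding dilated_kernel_def kernel_def rescale_def[symmetric]
        by (intro tendsto_mult tendsto_of_real tendsto_divide tendsto_prod tendsto_const ri ps
              inverse_fourier_tendsto[OF \<beta>] tendsto_diff tendsto_power tendsto_norm re) (auto simp: nz)
    qed
    show "AE y in lborel. (\<lambda>m. dilated_kernel \<psi> \<beta> l (r m) (x - y) * f y) \<longlonglongrightarrow> dilated_kernel \<psi> \<beta> l r0 (x - y) * f y"
      by (intro AE_I2 tendsto_mult lim tendsto_const)
  qed
qed

lemma SUP_power2_ennreal:
  fixes a :: "'i \<Rightarrow> ennreal"
  shows "(SUP i\<in>I. a i)\<^sup>2 = (SUP i\<in>I. (a i)\<^sup>2)"
proof (rule antisym)
  have "(SUP i\<in>I. a i)\<^sup>2 = (SUP i\<in>I. SUP j\<in>I. a i * a j)"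
    unfolding power2_eq_square SUP_mult_left_ennreal[symmetric] SUP_mult_right_ennreal[symmetric] ..
  also have "\<dots> \<le> (SUP i\<in>I. (a i)\<^sup>2)"
  proof (intro SUP_least)
    fix i j assume "i \<in> I" "j \<in> I"
    show "a i * a j \<le> (SUP i\<in>I. (a i)\<^sup>2)"
    proof (cases "a i \<le> a j")
      case True
      then have "a i * a j \<le> (a j)\<^sup>2" unfolding power2_eq_square by (intro mult_right_mono) auto
      then show ?thesis using \<open>j \<in> I\<close> by (meson SUP_upper2)
    next
      case False
      then have "a i * a j \<le> (a i)\<^sup>2" unfolding power2_eq_square by (intro mult_left_mono) auto
      then show ?thesis using \<open>i \<in> I\<close> by (meson SUP_upper2)
    qed
  qed
  finally show "(SUP i\<in>I. a i)\<^sup>2 \<le> (SUP i\<in>I. (a i)\<^sup>2)" .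
  show "(SUP i\<in>I. (a i)\<^sup>2) \<le> (SUP i\<in>I. a i)\<^sup>2"
    by (intro SUP_least power_mono SUP_upper) auto
qed

section \<open>The full supremum\<close>

lemma test_function_amplitude:
  assumes "\<psi> \<in> test_functions {u. 1/2 < norm u \<and> norm u < 2}"
  shows "\<psi> \<in> amplitude"
proof -
  have "{u. \<psi> u \<noteq> 0} \<subseteq> {u. 1/2 < norm u \<and> norm u < 2}"
    using assms closure_subset[of "{u. \<psi> u \<noteq> 0}"] unfolding test_functions_def by auto
  then show ?thesis using assms by (auto simp: amplitude_def test_functions_def)
qed

lemma frequency_cutoff_properties:
  fixes \<beta> :: "real \<Rightarrow> complex"
  assumes "\<beta> \<in> test_functions {\<tau>. 1/2 \<le> \<bar>\<tau>\<bar> \<and> \<bar>\<tau>\<bar> \<le> 2}"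
  obtains B where "continuous_on UNIV \<beta>" "integrable lborel \<beta>" "\<And>\<tau>. norm (\<beta> \<tau>) \<le> B"
    "\<And>\<tau>. \<beta> \<tau> \<noteq> 0 \<Longrightarrow> 1/2 \<le> \<bar>\<tau>\<bar> \<and> \<bar>\<tau>\<bar> \<le> 2"
proof -
  have c: "continuous_on UNIV \<beta>"
    using assms by (auto simp: test_functions_def intro: smooth_continuous)
  have s: "1/2 \<le> \<bar>\<tau>\<bar> \<and> \<bar>\<tau>\<bar> \<le> 2" if "\<beta> \<tau> \<noteq> 0" for \<tau>
    using assms that closure_subset[of "{u. \<beta> u \<noteq> 0}"] unfolding test_functions_def by auto
  have "compact (\<beta> ` cball 0 2)"
    using c by (intro compact_continuous_image) (auto intro: continuous_on_subset)
  then obtain B where B: "\<And>z. z \<in> \<beta> ` cball 0 2 \<Longrightarrow> norm z \<le> B"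
    using compact_imp_bounded bounded_iff by metis
  have "norm (\<beta> \<tau>) \<le> max B 0" for \<tau>
    using B[of "\<beta> \<tau>"] s[of \<tau>] by (cases "\<beta> \<tau> = 0") (auto simp: le_max_iff_disj)
  moreover have "integrable lborel \<beta>"
    by (rule integrable_continuous_bounded_support[OF c, of 0 2]) (use s in auto)
  ultimately show ?thesis using c s that by blast
qed

text \<open>Measurability of an uncountable supremum and the passage from finite sets of parameters to the whole box
both come from a countable dense set, exhausted by finite initial segments of an enumeration.\<close>

lemma maximal_function_borel:
  fixes \<psi> :: "(real^'n) \<Rightarrow> complex"
  assumes \<psi>: "\<psi> \<in> amplitude" and \<beta>: "continuous_on UNIV \<beta>" "integrable lborel \<beta>" and l: "l \<ge> 1"
    and fm[measurable]: "f \<in> borel_measurable borel" and f2: "integrable lborel (\<lambda>y. (norm (f y))\<^sup>2)"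
    and bound: "\<And>R. finite R \<Longrightarrow> R \<noteq> {} \<Longrightarrow> R \<subseteq> dyadic_box \<Longrightarrow>
      (\<integral>\<^sup>+x. (SUP r\<in>R. ennreal ((norm (convolve (dilated_kernel \<psi> \<beta> l r) f x))\<^sup>2)) \<partial>lborel) \<le> A"
  shows "maximal_function \<psi> \<beta> l f \<in> borel_measurable borel"
    and "(\<integral>\<^sup>+x. (maximal_function \<psi> \<beta> l f x)\<^sup>2 \<partial>lborel) \<le> A"
proof -
  let ?c = "\<lambda>r x. convolve (dilated_kernel \<psi> \<beta> l r) f x"
  obtain T :: "(real^'n) set" where T: "countable T" "T \<subseteq> dyadic_box" "dyadic_box \<subseteq> closure T"
    using separable[of "dyadic_box :: (real^'n) set"] by blast
  have cm[measurable]: "?c r \<in> borel_measurable borel" if "r \<in> T" for r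
    using convolve_lborel(2)[OF \<psi> \<beta>(1) _ fm] T(2) that by blast
  have "(vec 1 :: real^'n) \<in> dyadic_box" by (simp add: dyadic_box_def)
  then have Tne: "T \<noteq> {}" using T(3) by auto
  have mf: "maximal_function \<psi> \<beta> l f x = (SUP r\<in>T. ennreal (norm (?c r x)))" for x
    unfolding maximal_function_def dyadic_box_def[symmetric]
  proof (rule antisym)
    show "(SUP r\<in>T. ennreal (norm (?c r x))) \<le> (SUP r\<in>dyadic_box. ennreal (norm (?c r x)))"
      using T(2) by (rule SUP_subset_mono) auto
    show "(SUP r\<in>dyadic_box. ennreal (norm (?c r x))) \<le> (SUP r\<in>T. ennreal (norm (?c r x)))"
    proof (rule SUP_least)
      fix r0 :: "real^'n" assume r0: "r0 \<in> dyadic_box"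
      then obtain r where r: "\<And>m. r m \<in> T" "r \<longlonglongrightarrow> r0" using T(3) unfolding closure_sequential[symmetric]
        by (metis closure_sequential subsetD)
      have "(\<lambda>m. ?c (r m) x) \<longlonglongrightarrow> ?c r0 x"
        by (rule convolve_tendsto[OF \<psi> \<beta> _ r0 r(2) _ fm f2]) (use r(1) T(2) l in auto)
      then have "(\<lambda>m. ennreal (norm (?c (r m) x))) \<longlonglongrightarrow> ennreal (norm (?c r0 x))"
        by (intro tendsto_ennrealI tendsto_norm)
      then show "ennreal (norm (?c r0 x)) \<le> (SUP r\<in>T. ennreal (norm (?c r x)))"
        by (rule LIMSEQ_le_const2) (auto intro!: exI SUP_upper r(1))
    qed
  qed
  show "maximal_function \<psi> \<beta> l f \<in> borel_measurable borel"
    unfolding mf[abs_def] by (intro borel_measurable_SUP T(1)) measurable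
  define e where "e = from_nat_into T"
  have e: "range e = T" unfolding e_def by (rule range_from_nat_into[OF Tne T(1)])
  define a where "a m x = (SUP r\<in>e ` {..m}. ennreal ((norm (?c r x))\<^sup>2))" for m :: nat and x
  have sq: "(maximal_function \<psi> \<beta> l f x)\<^sup>2 = (SUP m. a m x)" for x
  proof -
    have "(maximal_function \<psi> \<beta> l f x)\<^sup>2 = (SUP r\<in>T. ennreal ((norm (?c r x))\<^sup>2))"
      unfolding mf SUP_power2_ennreal by (simp add: ennreal_power)
    also have "\<dots> = (SUP m. a m x)"
    proof (rule antisym)
      show "(SUP r\<in>T. ennreal ((norm (?c r x))\<^sup>2)) \<le> (SUP m. a m x)"
      proof (rule SUP_least)
        fix r assume "r \<in> T"
        then obtain m where "r = e m" using e by auto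
        then show "ennreal ((norm (?c r x))\<^sup>2) \<le> (SUP m. a m x)"
          unfolding a_def by (intro SUP_upper2[of m] SUP_upper) auto
      qed
      show "(SUP m. a m x) \<le> (SUP r\<in>T. ennreal ((norm (?c r x))\<^sup>2))"
        unfolding a_def using e by (intro SUP_least SUP_upper) auto
    qed
    finally show ?thesis .
  qed
  have "(\<integral>\<^sup>+x. (maximal_function \<psi> \<beta> l f x)\<^sup>2 \<partial>lborel) = (SUP m. \<integral>\<^sup>+x. a m x \<partial>lborel)"
    unfolding sq
  proof (rule nn_integral_monotone_convergence_SUP)
    show "incseq a"
      unfolding a_def incseq_def le_fun_def by (intro allI impI SUP_subset_mono) auto
    show "a m \<in> borel_measurable lborel" for m
    proof -
      have [measurable]: "?c r \<in> borel_measurable borel" if "r \<in> e ` {..m}" for r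
        using that e by (intro cm) auto
      show ?thesis unfolding a_def by (intro borel_measurable_SUP countable_finite) auto
    qed
  qed
  also have "\<dots> \<le> A"
  proof (rule SUP_least)
    fix m
    show "(\<integral>\<^sup>+x. a m x \<partial>lborel) \<le> A"
      unfolding a_def using e T(2) by (intro bound) auto
  qed
  finally show "(\<integral>\<^sup>+x. (maximal_function \<psi> \<beta> l f x)\<^sup>2 \<partial>lborel) \<le> A" .
qed

lemma complex_borel_representative:
  fixes f :: "'a::euclidean_space \<Rightarrow> complex"
  assumes [measurable]: "f \<in> borel_measurable lebesgue"
  obtains g where "g \<in> borel_measurable borel" "AE x in lborel. f x = g x"
proof -
  have "(\<lambda>x. Re (f x)) \<in> borel_measurable (completion lborel)" "(\<lambda>x. Im (f x)) \<in> borel_measurable (completion lborel)"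
    by measurable
  then obtain u v where [measurable]: "u \<in> borel_measurable lborel" "v \<in> borel_measurable lborel"
    and uv: "AE x in lborel. Re (f x) = u x" "AE x in lborel. Im (f x) = v x"
    using completion_ex_borel_measurable_real by metis
  have "(\<lambda>x. complex_of_real (u x) + \<i> * complex_of_real (v x)) \<in> borel_measurable borel" by measurable
  moreover have "AE x in lborel. f x = complex_of_real (u x) + \<i> * complex_of_real (v x)"
    using uv by eventually_elim (simp add: complex_eq_iff)
  ultimately show ?thesis using that by blast
qed

theorem proposition1p2:
  fixes \<psi> :: "(real^'n) \<Rightarrow> complex" and \<beta> :: "real \<Rightarrow> complex"
  assumes "CARD('n) \<ge> 2"
    and "\<psi> \<in> test_functions {u. 1/2 < norm u \<and> norm u < 2}"
    and "\<beta> \<in> test_functions {\<tau>. 1/2 \<le> \<bar>\<tau>\<bar> \<and> \<bar>\<tau>\<bar> \<le> 2}"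
  shows "\<exists>C\<ge>0. \<forall>l\<ge>1. \<forall>f\<in>L2_functions.
           maximal_function \<psi> \<beta> l f \<in> borel_measurable lebesgue \<and>
           L2_norm (maximal_function \<psi> \<beta> l f)
             \<le> ennreal (C * l powr (- (real CARD('n) - 3) / 4)) * L2_norm (\<lambda>x. ennreal (norm (f x)))"
proof -
  have \<psi>: "\<psi> \<in> amplitude" by (rule test_function_amplitude[OF assms(2)])
  obtain B where \<beta>: "continuous_on UNIV \<beta>" "integrable lborel \<beta>" "\<And>\<tau>. norm (\<beta> \<tau>) \<le> B"
    "\<And>\<tau>. \<beta> \<tau> \<noteq> 0 \<Longrightarrow> 1/2 \<le> \<bar>\<tau>\<bar> \<and> \<bar>\<tau>\<bar> \<le> 2"
    using frequency_cutoff_properties[OF assms(3)] by blast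
  obtain C where C: "C \<ge> 0"
    "\<And>l R f. l \<ge> 1 \<Longrightarrow> finite R \<Longrightarrow> R \<noteq> {} \<Longrightarrow> R \<subseteq> dyadic_box \<Longrightarrow> f \<in> borel_measurable borel \<Longrightarrow>
       integrable lborel (\<lambda>y. (norm (f y))\<^sup>2) \<Longrightarrow>
       (\<integral>\<^sup>+x. (SUP r\<in>R. ennreal ((norm (convolve (dilated_kernel \<psi> \<beta> l r) f x))\<^sup>2)) \<partial>lborel)
         \<le> ennreal (C * (l powr (- (real CARD('n) - 3) / 4))\<^sup>2 * (\<integral>y. (norm (f y))\<^sup>2 \<partial>lborel))"
    using finite_maximal_bound[OF \<psi> \<beta>(1,3,4)] by blast
  show ?thesis
  proof (intro exI[of _ "sqrt C"] conjI allI impI ballI)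
    show "0 \<le> sqrt C" using C(1) by simp
    fix l :: real and f :: "(real^'n) \<Rightarrow> complex"
    assume l: "1 \<le> l" and f: "f \<in> L2_functions"
    have fm: "f \<in> borel_measurable lebesgue" using f by (simp add: L2_functions_def)
    obtain g where gm[measurable]: "g \<in> borel_measurable borel" and fg: "AE x in lborel. f x = g x"
      using complex_borel_representative[OF fm] by blast
    have fg': "AE x in lebesgue. f x = g x" using fg by (rule AE_completion)
    \<comment> \<open>The convolutions of \<open>f\<close> and of its Borel representative \<open>g\<close> agree at every point, hence so do the two maximal functions.\<close>
    have conv: "convolve (dilated_kernel \<psi> \<beta> l r) f = convolve (dilated_kernel \<psi> \<beta> l r) g" if r: "r \<in> dyadic_box" for r
    proof
      fix x
      have [measurable]: "dilated_kernel \<psi> \<beta> l r \<in> borel_measurable borel"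
        by (rule borel_measurable_dilated_kernel[OF \<psi> \<beta>(1) r])
      have K: "(\<lambda>y. dilated_kernel \<psi> \<beta> l r (x - y)) \<in> borel_measurable lebesgue"
        by (rule measurable_completion) measurable
      have gl: "g \<in> borel_measurable lebesgue" by (rule measurable_completion) measurable
      show "convolve (dilated_kernel \<psi> \<beta> l r) f x = convolve (dilated_kernel \<psi> \<beta> l r) g x"
        unfolding convolve_def
      proof (rule integral_cong_AE)
        show "AE y in lebesgue. dilated_kernel \<psi> \<beta> l r (x - y) * f y = dilated_kernel \<psi> \<beta> l r (x - y) * g y"
          using fg' by eventually_elim simp
      qed (intro borel_measurable_times K fm gl)+
    qed
    have mfg: "maximal_function \<psi> \<beta> l f = maximal_function \<psi> \<beta> l g"
      unfolding maximal_function_def dyadic_box_def[symmetric] fun_eq_iff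
      by (intro allI SUP_cong refl) (simp add: conv)
    have n2: "(\<integral>\<^sup>+x. (ennreal (norm (f x)))\<^sup>2 \<partial>lebesgue) = (\<integral>\<^sup>+x. ennreal ((norm (g x))\<^sup>2) \<partial>lborel)"
      unfolding nn_integral_completion
      by (rule nn_integral_cong_AE) (use fg in eventually_elim, simp add: ennreal_power)
    have fin: "(\<integral>\<^sup>+x. ennreal ((norm (g x))\<^sup>2) \<partial>lborel) < \<infinity>"
    proof (rule ccontr)
      assume "\<not> ?thesis"
      then have inf: "(\<integral>\<^sup>+x. ennreal ((norm (g x))\<^sup>2) \<partial>lborel) = \<infinity>" by (simp add: not_less top_unique)
      then have "L2_norm (\<lambda>x. ennreal (norm (f x))) = \<infinity>"
        unfolding L2_norm_def n2 inf by simp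
      then show False using f by (simp add: L2_functions_def)
    qed
    have g2: "integrable lborel (\<lambda>y. (norm (g y))\<^sup>2)"
      by (rule integrableI_nonneg) (use fin in auto)
    define F where "F = (\<integral>y. (norm (g y))\<^sup>2 \<partial>lborel)"
    have F0: "F \<ge> 0" unfolding F_def by (intro Bochner_Integration.integral_nonneg) auto
    have gF: "(\<integral>\<^sup>+x. ennreal ((norm (g x))\<^sup>2) \<partial>lborel) = ennreal F"
      unfolding F_def by (rule nn_integral_eq_integral[OF g2]) auto
    have nf: "L2_norm (\<lambda>x. ennreal (norm (f x))) = ennreal (sqrt F)"
      unfolding L2_norm_def n2 gF using F0 by simp
    define P where "P = l powr (- (real CARD('n) - 3) / 4)"
    have P0: "P \<ge> 0" by (simp add: P_def)
    note mb = maximal_function_borel[OF \<psi> \<beta>(1,2) l gm g2 C(2)[OF l _ _ _ gm g2], folded P_def F_def]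
    show "maximal_function \<psi> \<beta> l f \<in> borel_measurable lebesgue"
      unfolding mfg by (rule measurable_completion) (use mb(1) in simp)
    define I where "I = (\<integral>\<^sup>+x. (maximal_function \<psi> \<beta> l f x)\<^sup>2 \<partial>lebesgue)"
    have I: "I \<le> ennreal (C * P\<^sup>2 * F)"
      unfolding I_def nn_integral_completion mfg by (rule mb(2))
    then have Ifin: "I \<noteq> \<infinity>" by (auto simp: top_unique)
    have "enn2real I \<le> C * P\<^sup>2 * F" using I C(1) F0 by (intro enn2real_leI) auto
    then have "sqrt (enn2real I) \<le> sqrt (C * P\<^sup>2 * F)" by (rule real_sqrt_le_mono)
    also have "\<dots> = sqrt C * P * sqrt F" using P0 by (simp add: real_sqrt_mult)
    finally have "ennreal (sqrt (enn2real I)) \<le> ennreal (sqrt C * P * sqrt F)" by (rule ennreal_leI)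
    also have "\<dots> = ennreal (sqrt C * P) * ennreal (sqrt F)"
      using C(1) P0 F0 by (simp add: ennreal_mult)
    finally show "L2_norm (maximal_function \<psi> \<beta> l f)
             \<le> ennreal (sqrt C * l powr (- (real CARD('n) - 3) / 4)) * L2_norm (\<lambda>x. ennreal (norm (f x)))"
      unfolding nf using Ifin by (simp add: L2_norm_def I_def[symmetric] P_def)
  qed
qed

end
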